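(* Let $h_{11},h_{20},h_{40}\in\mathbb{R}$ with $h_{20}^2+h_{40}<0$, let $\delta=(c_{00},c_{02},c_{11},c_{20})\in\mathbb{R}^4$, and consider the near-Hamiltonian system $$\dot u=\frac{\partial H_2}{\partial v}(u,v)+\varepsilon\hat p(u,v,\delta),\qquad \dot v=-\frac{\partial H_2}{\partial u}(u,v)+\varepsilon\hat q(u,v,\delta),$$ where $$H_2(u,v)=\tfrac12v^2+(4h_{20}-2h_{11}^2)u^2v+\tfrac12v^3+2(h_{11}^4-4h_{11}^2h_{20}-4h_{40})u^4+(2h_{20}-h_{11}^2)u^2v^2+\tfrac18v^4,$$ and $\hat p,\hat q$ are polynomials of degree at most $3$ in $(u,v)$, depending linearly on $\delta$, with $$\hat p_u+\hat q_v=(c_{00}+c_{02})+(-2c_{11}+4h_{11}c_{02})u+2c_{02}v+(4c_{20}-4h_{11}c_{11}+4h_{11}^2c_{02})u^2+(-2c_{11}+4h_{11}c_{02})uv+c_{02}v^2 .$$ Let $\sigma=(h_{11},h_{20},h_{40})$, and let $\delta_0=(c_{00}^*,c_{02}^*,c_{11}^*,c_{20}^* )$, $\sigma_0=(h_{11}^*,h_{20}^*,h_{40}^* )$ satisfy $$(h_{20}^* )^2+h_{40}^*<0,\quad c_{00}^*=-c_{02}^*,\quad c_{02}^*\neq0,\quad c_{20}^*=h_{11}^*c_{11}^*-2c_{02}^*\big[(h_{11}^* )^2-h_{20}^*\big].$$ Then for some $(\varepsilon,\delta,\sigma)$ near $(0,\delta_0,\sigma_0)$ (with $\varepsilon\neq0$)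 the system has $2$ limit cycles near the origin.
   Context: This system is the normal form, near the point $(0,1)$, of the perturbed symmetric cubic Hamiltonian system $\dot x=H_y+\varepsilon p,\ \dot y=-H_x+\varepsilon q$ with $H=\sum_{i+j\in\{2,4\}}h_{ij}x^iy^j$, $h_{04}=-h_{02}/2$, $h_{13}=-h_{11}$, $p,q$ odd cubic polynomials, in the case $-4h_{11}^2-8h_{02}(h_{20}+h_{22})=0$, $h_{31}=-2h_{11}h_{20}$, normalized by $h_{02}=\tfrac12$, $h_{22}=-h_{11}^2-h_{20}$, after the change $u=-\tfrac12x$, $v=h_{11}x+y-1$; for $h_{20}^2+h_{40}<0$ the origin is a nilpotent center of order 1 of the unperturbed system. "For some $(\varepsilon,\delta,\sigma)$ near $(0,\delta_0,\sigma_0)$ the system has $N$ limit cycles near the origin" means: for every neighborhood $V$ of the origin and every $\eta>0$ there exist $\varepsilon,\delta,\sigma$ with $0<|\varepsilon|<\eta$, $|\delta-\delta_0|<\eta$, $|\sigma-\sigma_0|<\eta$ for which the system has $N$ limit cycles in $V$. *)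

theory Defs
  imports "HOL-Analysis.Analysis"
begin

definition poly3 :: "(nat \<Rightarrow> nat \<Rightarrow> real) \<Rightarrow> real \<Rightarrow> real \<Rightarrow> real" where
  "poly3 a u v = (\<Sum>i\<le>3. \<Sum>j\<le>3 - i. a i j * u ^ i * v ^ j)"

text \<open>Perturbation depending linearly on delta = (c00,c02,c11,c20); the coefficient tables
  P sigma k (k = 0..3) may depend on sigma = (h11,h20,h40).\<close>
definition pert ::
  "(real \<times> real \<times> real \<Rightarrow> nat \<Rightarrow> nat \<Rightarrow> nat \<Rightarrow> real) \<Rightarrow> real \<times> real \<times> real
    \<Rightarrow> real \<times> real \<times> real \<times> real \<Rightarrow> real \<Rightarrow> real \<Rightarrow> real" where
  "pert P \<sigma> \<delta> u v =
     (case \<delta> of (c00, c02, c11, c20) \<Rightarrow>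
        c00 * poly3 (P \<sigma> 0) u v + c02 * poly3 (P \<sigma> 1) u v
      + c11 * poly3 (P \<sigma> 2) u v + c20 * poly3 (P \<sigma> 3) u v)"

definition H2 :: "real \<times> real \<times> real \<Rightarrow> real \<Rightarrow> real \<Rightarrow> real" where
  "H2 \<sigma> u v = (case \<sigma> of (h11, h20, h40) \<Rightarrow>
      1/2 * v^2 + (4*h20 - 2*h11^2) * u^2 * v + 1/2 * v^3
    + 2 * (h11^4 - 4*h11^2*h20 - 4*h40) * u^4 + (2*h20 - h11^2) * u^2 * v^2 + 1/8 * v^4)"

definition field ::
  "(real \<times> real \<times> real \<Rightarrow> nat \<Rightarrow> nat \<Rightarrow> nat \<Rightarrow> real) \<Rightarrow>
   (real \<times> real \<times> real \<Rightarrow> nat \<Rightarrow> nat \<Rightarrow> nat \<Rightarrow> real) \<Rightarrow>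
   real \<times> real \<times> real \<Rightarrow> real \<times> real \<times> real \<times> real \<Rightarrow> real \<Rightarrow> real \<times> real \<Rightarrow> real \<times> real" where
  "field P Q \<sigma> \<delta> \<epsilon> z = (case z of (u, v) \<Rightarrow>
     (deriv (\<lambda>v'. H2 \<sigma> u v') v + \<epsilon> * pert P \<sigma> \<delta> u v,
      - deriv (\<lambda>u'. H2 \<sigma> u' v) u + \<epsilon> * pert Q \<sigma> \<delta> u v))"

definition is_solution :: "(real \<times> real \<Rightarrow> real \<times> real) \<Rightarrow> (real \<Rightarrow> real \<times> real) \<Rightarrow> bool" where
  "is_solution f x \<longleftrightarrow> (\<forall>t. (x has_vector_derivative f (x t)) (at t))"

definition periodic_orbit :: "(real \<times> real \<Rightarrow> real \<times> real) \<Rightarrow> (real \<times> real) set \<Rightarrow> bool" where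
  "periodic_orbit f \<Gamma> \<longleftrightarrow> (\<exists>x T. is_solution f x \<and> T > 0 \<and> (\<forall>t. x (t + T) = x t)
      \<and> \<not> (\<forall>t. x t = x 0) \<and> \<Gamma> = range x)"

definition limit_cycle :: "(real \<times> real \<Rightarrow> real \<times> real) \<Rightarrow> (real \<times> real) set \<Rightarrow> bool" where
  "limit_cycle f \<Gamma> \<longleftrightarrow> periodic_orbit f \<Gamma> \<and>
     (\<exists>U. open U \<and> \<Gamma> \<subseteq> U \<and> (\<forall>\<Gamma>'. periodic_orbit f \<Gamma>' \<and> \<Gamma>' \<subseteq> U \<longrightarrow> \<Gamma>' = \<Gamma>))"

end

theory Submission
  imports Defs
begin

text \<open>
  In suitable coordinates the unperturbed Hamiltonian is \<open>w\<^sup>2/2 + b\<^sup>4 u\<^sup>4\<close>, so its level curves have an explicit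
  parametrisation by an angle \<open>\<theta>\<close> and a radius \<open>r\<close>, and the perturbed system becomes a scalar equation
  \<open>dr/d\<theta> = \<epsilon> f \<epsilon> \<theta> r\<close>, periodic in \<open>\<theta>\<close>. A simple zero of the mean of \<open>f 0 \<theta> r\<close>, which is the
  Melnikov function up to a positive factor, yields for small \<open>\<epsilon> > 0\<close> a periodic solution by the contraction
  principle and the intermediate value theorem. It is isolated: the difference to another solution nearby
  grows exponentially in one direction of time, hence is unbounded.

  Only the divergence enters the Melnikov function, since Hamiltonian parts of the perturbation integrate to zero.
  With \<open>e = c00 + c02\<close> and \<open>d = 4 (c20 - h11 c11 + 2 c02 (h11\<^sup>2 - h20))\<close>, both zero at \<open>\<delta>\<^sub>0\<close>, it is
  \<open>r\<^sup>3 (e I0 r + d r\<^sup>2 I1 r + c02 r\<^sup>4 I2 r)\<close> with \<open>I0 0, I1 0 > 0\<close> and \<open>I2 0 < 0\<close>, and suitable small \<open>e\<close>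
  and \<open>d\<close> give two simple zeros close to \<open>0\<close>; \<open>\<sigma>\<close> can stay at \<open>\<sigma>\<^sub>0\<close>.
\<close>

section \<open>Periodic solutions of slowly varying scalar equations\<close>

text \<open>The origin is nilpotent, so ordinary polar coordinates do not follow the level curves:
  \<open>u\<close> scales like \<open>r\<close> but \<open>w\<close> like \<open>r^2\<close>, and
  taking the fourth root of the energy as radius makes the chart smooth in \<open>r\<close>. The
  offset in \<open>d\<close> removes the \<open>r^5\<close> contribution of \<open>c02\<close>: on a
  level curve \<open>w^2 - a^2 * u^4\<close> depends on \<open>u\<close> alone, so its integral
  against \<open>du\<close> vanishes, and \<open>c02\<close> first acts at order \<open>r^7\<close>.
  Three terms of orders 3, 5 and 7 leave room for two positive zeros. Coefficients of sizes
  \<open>s^4\<close> and \<open>s^2\<close> balance them at \<open>r = s * x\<close>, and the limit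
  \<open>s = 0\<close> is a quadratic in \<open>x^2\<close>. Hence continuous differentiability down
  to \<open>s = 0\<close> suffices and no series expansion of the integrals is needed. The scale
  \<open>s\<close> is fixed first and \<open>\<epsilon>\<close> is taken small depending on it, so
  that both cycles occur for one system. A limit cycle must be isolated among all periodic orbits
  near it, so every orbit staying in an open annulus is lifted to the chart and compared with the
  constructed one. Whether differences grow forward or backward in time depends on the sign of the
  derivative of the mean; in the averaging argument this sign is \<open>\<sigma>\<close>.\<close>

lemma periodic_representative:
  fixes x :: real
  obtains k :: int where "x - 2*pi* of_int k \<in> {0..2*pi}"
proof
  let ?k = "\<lfloor>x / (2*pi)\<rfloor>"
  have p: "2*pi > 0" by simp
  have "of_int ?k \<le> x / (2*pi)" "x / (2*pi) < of_int ?k + 1"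
    by (rule of_int_floor_le, rule floor_correct[THEN conjunct2, simplified])
  then have "of_int ?k * (2*pi) \<le> x" "x < (of_int ?k + 1) * (2*pi)"
    using p by (simp_all only: pos_le_divide_eq pos_divide_less_eq)
  then show "x - 2*pi* of_int ?k \<in> {0..2*pi}"
    by (simp add: algebra_simps)
qed

lemma periodic_int:
  fixes f :: "real \<Rightarrow> 'a"
  assumes "\<And>x. f (x + T) = f x"
  shows "f (x + T * of_int k) = f x"
proof (induction k rule: int_induct[where k = 0])
  case (step1 i)
  have "f (x + T * of_int (i + 1)) = f ((x + T * of_int i) + T)" by (simp add: algebra_simps)
  then show ?case using assms step1 by simp
next
  case (step2 i)
  have "f (x + T * of_int (i - 1)) = f ((x + T * of_int (i - 1)) + T)" using assms by simp
  also have "\<dots> = f (x + T * of_int i)" by (simp add: algebra_simps)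
  finally show ?case using step2 by simp
qed simp

lemma periodic_in_period:
  fixes f :: "real \<Rightarrow> 'a"
  assumes "\<And>x. f (x + 2*pi) = f x"
  obtains y where "y \<in> {0..2*pi}" "f x = f y"
proof -
  obtain k :: int where k: "x - 2*pi* of_int k \<in> {0..2*pi}" by (rule periodic_representative)
  have "f ((x - 2*pi* of_int k) + 2*pi* of_int k) = f (x - 2*pi* of_int k)"
    by (rule periodic_int) (rule assms)
  then show ?thesis using that[OF k] by simp
qed

text \<open>The signed integral from \<open>0\<close> to \<open>x\<close> on the whole line: the
  interval of one of the two terms is always empty or a point, and that term is
  \<open>0\<close>.\<close>

definition primitive :: "(real \<Rightarrow> real) \<Rightarrow> real \<Rightarrow> real" where
  "primitive g x = integral {0..x} g - integral {x..0} g"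

lemma primitive_0 [simp]: "primitive g 0 = 0"
  by (simp add: primitive_def)

lemma primitive_zero [simp]: "primitive (\<lambda>_. 0) x = 0"
  by (simp add: primitive_def)

lemma primitive_pos: "x \<ge> 0 \<Longrightarrow> primitive g x = integral {0..x} g"
  by (cases "x = 0") (auto simp: primitive_def)

lemma primitive_has_derivative:
  assumes g: "continuous_on UNIV g"
  shows "(primitive g has_real_derivative g x) (at x)"
proof -
  define N where "N = \<bar>x\<bar> + 1"
  have int: "g integrable_on {p..q}" for p q
    by (rule integrable_continuous_real) (use g continuous_on_subset in blast)
  \<comment> \<open>Near \<open>x\<close> the sign distinction disappears: up to a constant, this is
    the integral from a fixed left end point.\<close>
  have eq: "primitive g y = integral {-N..y} g - integral {-N..0} g" if "y \<in> {-N<..<N}" for y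
  proof (cases "y \<ge> 0")
    case True
    have "integral {-N..0} g + integral {0..y} g = integral {-N..y} g"
      by (rule Henstock_Kurzweil_Integration.integral_combine) (use that True int in \<open>auto simp: N_def\<close>)
    then show ?thesis using True by (simp add: primitive_pos)
  next
    case False
    have "integral {-N..y} g + integral {y..0} g = integral {-N..0} g"
      by (rule Henstock_Kurzweil_Integration.integral_combine) (use that False int in \<open>auto simp: N_def\<close>)
    then show ?thesis using False by (simp add: primitive_def)
  qed
  have "((\<lambda>y. integral {-N..y} g) has_real_derivative g x) (at x within {-N..N})"
    by (rule integral_has_real_derivative) (use g continuous_on_subset in \<open>auto simp: N_def\<close>)
  then have "((\<lambda>y. integral {-N..y} g) has_real_derivative g x) (at x)"
    by (subst (asm) at_within_interior) (auto simp: N_def)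
  then have "((\<lambda>y. integral {-N..y} g - integral {-N..0} g) has_real_derivative g x) (at x)"
    by (auto intro!: derivative_eq_intros)
  then show ?thesis
    by (rule has_field_derivative_transform_within_open[where S = "{-N<..<N}"]) (auto simp: eq N_def)
qed

lemma real_derivative_zero_const:
  fixes f :: "real \<Rightarrow> real"
  assumes "\<And>x. (f has_real_derivative 0) (at x)"
  shows "f x = f y"
  using DERIV_isconst_all assms by blast

lemma derivative_imp_continuous_on:
  fixes f :: "real \<Rightarrow> real"
  assumes "\<And>x. (f has_real_derivative f' x) (at x)"
  shows "continuous_on S f"
  by (intro continuous_at_imp_continuous_on ballI DERIV_isCont[OF assms])

text \<open>The increment over one period has derivative zero by periodicity of \<open>g\<close>, so
  it equals its value at \<open>0\<close>.\<close>

lemma primitive_periodic: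
  assumes g: "continuous_on UNIV g" and p: "\<And>x. g (x + 2*pi) = g x"
  shows "primitive g (x + 2*pi) = primitive g x + primitive g (2*pi)"
proof -
  have "((\<lambda>x. primitive g (x + 2*pi) - primitive g x) has_real_derivative 0) (at x)" for x
  proof -
    have "((\<lambda>x. primitive g (x + 2*pi)) has_real_derivative g (x + 2*pi)) (at x)"
      using DERIV_shift[of "primitive g" "g (x+2*pi)" x "2*pi"] primitive_has_derivative[OF g, of "x+2*pi"]
      by simp
    then show ?thesis using primitive_has_derivative[OF g, of x] p
      by (auto intro!: derivative_eq_intros)
  qed
  from real_derivative_zero_const[OF this, of x 0] show ?thesis by simp
qed

lemma primitive_diff_le:
  assumes g: "continuous_on UNIV g" and h: "continuous_on UNIV h"
    and d: "\<And>x. \<bar>g x - h x\<bar> \<le> C" and x: "x \<ge> 0"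
  shows "\<bar>primitive g x - primitive h x\<bar> \<le> C * x"
proof (cases "x = 0")
  case False
  have D: "((\<lambda>x. primitive g x - primitive h x) has_real_derivative g y - h y) (at y)" for y
    by (intro derivative_intros primitive_has_derivative g h)
  from x False have "0 < x" by simp
  from MVT2[OF this D] obtain z where "primitive g x - primitive h x = x * (g z - h z)" by auto
  then show ?thesis using mult_left_mono[OF d[of z] x] x by (simp add: abs_mult mult.commute)
qed simp

lemma periodic_bounded:
  fixes g :: "real \<Rightarrow> real"
  assumes g: "continuous_on UNIV g" and p: "\<And>x. g (x + 2*pi) = g x"
  shows "bounded (range g)"
proof -
  have "range g \<subseteq> g ` {0..2*pi}"
  proof safe
    fix x
    obtain y where "y \<in> {0..2*pi}" "g x = g y" by (rule periodic_in_period[of g x]) (auto simp: p)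
    then show "g x \<in> g ` {0..2*pi}" by blast
  qed
  moreover have "compact (g ` {0..2*pi})"
    using g by (intro compact_continuous_image) (auto intro: continuous_on_subset)
  ultimately show ?thesis using compact_imp_bounded bounded_subset by blast
qed


text \<open>Subtracting the mean of the right-hand side makes the Picard map preserve periodic functions, so that
  Banach's theorem applies; a zero of the mean as a function of \<^term>\<open>c\<close> then gives a periodic solution.\<close>

lemma averaged_equation_solvable:
  fixes f :: "real \<Rightarrow> real \<Rightarrow> real"
  assumes contf: "continuous_on UNIV (\<lambda>z. f (fst z) (snd z))"
    and per: "\<And>\<theta> r. f (\<theta> + 2*pi) r = f \<theta> r"
    and bnd: "\<And>\<theta> r. \<bar>f \<theta> r\<bar> \<le> F0"
    and lip: "\<And>\<theta> r r'. \<bar>f \<theta> r - f \<theta> r'\<bar> \<le> L * \<bar>r - r'\<bar>" and L: "L \<ge> 0"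
    and \<epsilon>: "\<epsilon> \<ge> 0" "8 * pi * \<epsilon> * L \<le> 1"
  obtains \<phi> :: "real \<Rightarrow> real \<Rightarrow> real" where
    "\<And>c. continuous_on UNIV (\<phi> c)"
    "\<And>c \<theta>. (\<phi> c has_real_derivative
        \<epsilon> * (f \<theta> (\<phi> c \<theta>) - integral {0..2*pi} (\<lambda>s. f s (\<phi> c s)) / (2*pi))) (at \<theta>)"
    "\<And>c \<theta>. \<phi> c (\<theta> + 2*pi) = \<phi> c \<theta>"
    "\<And>c \<theta>. \<bar>\<phi> c \<theta> - c\<bar> \<le> 4 * pi * \<epsilon> * F0"
    "\<And>c c' \<theta>. \<bar>\<phi> c \<theta> - \<phi> c' \<theta>\<bar> \<le> 2 * \<bar>c - c'\<bar>"
proof -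
  \<comment> \<open>The periodic functions form a closed, hence complete, subset of the Banach space
    of bounded continuous functions.\<close>
  define S where "S = {\<phi> :: real \<Rightarrow>\<^sub>C real. \<forall>\<theta>. apply_bcontfun \<phi> (\<theta> + 2*pi) = apply_bcontfun \<phi> \<theta>}"
  define g where "g \<phi> s = f s (apply_bcontfun \<phi> s)" for \<phi> s
  \<comment> \<open>The linear correction cancels the growth of the primitive over one period, so
    \<open>T c \<phi>\<close> is again periodic; its value at \<open>0\<close> is
    \<open>c\<close>.\<close>
  define T where "T c \<phi> \<theta> = c + \<epsilon> * (primitive (g \<phi>) \<theta> - \<theta> / (2*pi) * primitive (g \<phi>) (2*pi))" for c \<phi> \<theta>
  have contg: "continuous_on UNIV (g \<phi>)" for \<phi>
  proof -
    have "continuous_on UNIV (\<lambda>s. (\<lambda>z. f (fst z) (snd z)) (s, apply_bcontfun \<phi> s))"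
      by (rule continuous_on_compose2[OF contf]) (auto intro!: continuous_intros)
    then show ?thesis by (simp add: g_def)
  qed
  have perg: "g \<phi> (s + 2*pi) = g \<phi> s" if "\<phi> \<in> S" for \<phi> s
    using that by (simp add: g_def S_def per)
  have derT: "(T c \<phi> has_real_derivative \<epsilon> * (g \<phi> \<theta> - primitive (g \<phi>) (2*pi) / (2*pi))) (at \<theta>)" for c \<phi> \<theta>
  proof -
    define m where "m = primitive (g \<phi>) (2*pi) / (2*pi)"
    have "((\<lambda>\<theta>. c + \<epsilon> * (primitive (g \<phi>) \<theta> - \<theta> * m)) has_real_derivative 0 + \<epsilon> * (g \<phi> \<theta> - 1 * m)) (at \<theta>)"
      by (intro DERIV_add DERIV_const DERIV_cmult DERIV_diff DERIV_cmult_right DERIV_ident primitive_has_derivative contg)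
    moreover have "T c \<phi> = (\<lambda>\<theta>. c + \<epsilon> * (primitive (g \<phi>) \<theta> - \<theta> * m))"
      by (simp add: T_def m_def fun_eq_iff)
    ultimately show ?thesis by (simp add: m_def)
  qed
  have contT: "continuous_on UNIV (T c \<phi>)" for c \<phi>
    by (intro continuous_at_imp_continuous_on ballI DERIV_isCont[OF derT])
  have perT: "T c \<phi> (\<theta> + 2*pi) = T c \<phi> \<theta>" if "\<phi> \<in> S" for c \<phi> \<theta>
    
  proof -
    have "(\<theta> + 2*pi) / (2*pi) = \<theta> / (2*pi) + 1" by (simp add: field_simps)
    then show ?thesis using primitive_periodic[OF contg perg[OF that], of \<theta>]
      by (simp add: T_def distrib_right)
  qed
  have T_bcont: "apply_bcontfun (Bcontfun (T c \<phi>)) = T c \<phi>" if "\<phi> \<in> S" for c \<phi>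
  proof (rule Bcontfun_inverse)
    show "T c \<phi> \<in> bcontfun"
      using contT periodic_bounded[OF contT perT[OF that]] by (simp add: bcontfun_def)
  qed
  \<comment> \<open>On one period the primitive and the linear correction each contribute at most
    \<open>2 * pi * C\<close>. Periodicity then carries the estimate to all angles.\<close>
  have mean_diff: "\<bar>\<epsilon> * (primitive h \<theta> - \<theta> / (2*pi) * primitive h (2*pi)) - \<epsilon> * (primitive k \<theta> - \<theta> / (2*pi) * primitive k (2*pi))\<bar>
      \<le> 4 * pi * \<epsilon> * C"
    if h: "continuous_on UNIV h" and k: "continuous_on UNIV k" and d: "\<And>x. \<bar>h x - k x\<bar> \<le> C"
      and \<theta>: "\<theta> \<in> {0..2*pi}" for h k C \<theta>
  proof -
    have C: "C \<ge> 0" using d[of 0] by linarith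
    have 1: "\<bar>primitive h \<theta> - primitive k \<theta>\<bar> \<le> C * (2*pi)"
      using primitive_diff_le[OF h k d, of \<theta>] \<theta> C mult_left_mono[of \<theta> "2*pi" C] by auto
    have "\<bar>\<theta> / (2*pi) * (primitive h (2*pi) - primitive k (2*pi))\<bar> \<le> 1 * (C * (2*pi))"
      unfolding abs_mult
      by (rule mult_mono) (use primitive_diff_le[OF h k d, of "2*pi"] \<theta> in auto)
    then have "\<bar>(primitive h \<theta> - primitive k \<theta>) - \<theta> / (2*pi) * (primitive h (2*pi) - primitive k (2*pi))\<bar> \<le> C * (2*pi) + 1 * (C * (2*pi))"
      by (rule order_trans[OF abs_triangle_ineq4 add_mono[OF 1]])
    then have "\<bar>(primitive h \<theta> - primitive k \<theta>) - \<theta> / (2*pi) * (primitive h (2*pi) - primitive k (2*pi))\<bar> \<le> 4 * pi * C"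
      by (simp add: mult.commute)
    then have "\<bar>\<epsilon> * ((primitive h \<theta> - primitive k \<theta>) - \<theta> / (2*pi) * (primitive h (2*pi) - primitive k (2*pi)))\<bar> \<le> \<epsilon> * (4 * pi * C)"
      unfolding abs_mult using \<epsilon>(1) by (simp add: mult_left_mono)
    then show ?thesis by (simp add: algebra_simps)
  qed
  have T_diff: "\<bar>T c \<phi> \<theta> - T c' \<psi> \<theta>\<bar> \<le> \<bar>c - c'\<bar> + dist \<phi> \<psi> / 2" if S: "\<phi> \<in> S" "\<psi> \<in> S" for c c' \<phi> \<psi> \<theta>
  proof -
    obtain y where y: "y \<in> {0..2*pi}" "T c \<phi> \<theta> - T c' \<psi> \<theta> = T c \<phi> y - T c' \<psi> y"
      by (rule periodic_in_period[of "\<lambda>\<theta>. T c \<phi> \<theta> - T c' \<psi> \<theta>" \<theta>]) (auto simp: perT[OF S(1)] perT[OF S(2)])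
    have "\<bar>g \<phi> s - g \<psi> s\<bar> \<le> L * dist \<phi> \<psi>" for s
      using lip[of s "\<phi> s" "\<psi> s"] dist_bounded[of \<phi> s \<psi>] L mult_left_mono[of "dist (\<phi> s) (\<psi> s)" "dist \<phi> \<psi>" L]
      by (simp add: g_def dist_real_def)
    from mean_diff[OF contg contg this y(1)]
    have "\<bar>T c \<phi> y - T c' \<psi> y\<bar> \<le> \<bar>c - c'\<bar> + 4 * pi * \<epsilon> * (L * dist \<phi> \<psi>)" by (simp add: T_def)
    \<comment> \<open>This is where the smallness of \<open>\<epsilon>\<close> enters: it makes the
      contraction factor \<open>1/2\<close>.\<close>
    moreover have "(8 * pi * \<epsilon> * L) * dist \<phi> \<psi> \<le> 1 * dist \<phi> \<psi>"
      by (rule mult_right_mono) (use \<epsilon> in auto)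
    ultimately show ?thesis using y(2) by (simp add: algebra_simps)
  qed
  have T_close: "\<bar>T c \<phi> \<theta> - c\<bar> \<le> 4 * pi * \<epsilon> * F0" if S: "\<phi> \<in> S" for c \<phi> \<theta>
  proof -
    obtain y where y: "y \<in> {0..2*pi}" "T c \<phi> \<theta> = T c \<phi> y"
      by (rule periodic_in_period[of "T c \<phi>" \<theta>]) (auto simp: perT[OF S])
    have "\<bar>g \<phi> s - 0\<bar> \<le> F0" for s using bnd by (simp add: g_def)
    from mean_diff[OF contg _ this y(1)] show ?thesis unfolding y(2) by (simp add: T_def)
  qed
  have closedS: "closed S"
  proof -
    have cont_eval: "continuous_on UNIV (\<lambda>\<phi> :: real \<Rightarrow>\<^sub>C real. apply_bcontfun \<phi> \<theta>)" for \<theta>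
      
      unfolding continuous_on_iff by (metis dist_bounded le_less_trans)
    have "closed {\<phi> :: real \<Rightarrow>\<^sub>C real. apply_bcontfun \<phi> (\<theta> + 2*pi) = apply_bcontfun \<phi> \<theta>}" for \<theta>
      by (intro closed_Collect_eq cont_eval)
    then have "closed (\<Inter>\<theta>. {\<phi> :: real \<Rightarrow>\<^sub>C real. apply_bcontfun \<phi> (\<theta> + 2*pi) = apply_bcontfun \<phi> \<theta>})" by blast
    moreover have "S = (\<Inter>\<theta>. {\<phi> :: real \<Rightarrow>\<^sub>C real. apply_bcontfun \<phi> (\<theta> + 2*pi) = apply_bcontfun \<phi> \<theta>})"
      by (auto simp: S_def)
    ultimately show ?thesis by simp
  qed
  have "\<exists>\<phi>\<in>S. Bcontfun (T c \<phi>) = \<phi>" for c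
  proof -
    have "\<exists>!\<phi>. \<phi> \<in> S \<and> Bcontfun (T c \<phi>) = \<phi>"
    proof (rule Banach_fix[where c = "1/2"])
      show "complete S" using closedS by (simp add: complete_eq_closed)
      have "const_bcontfun 0 \<in> S" by (simp add: S_def)
      then show "S \<noteq> {}" by blast
      show "(\<lambda>\<phi>. Bcontfun (T c \<phi>)) ` S \<subseteq> S"
        using perT T_bcont by (auto simp: S_def)
      show "dist (Bcontfun (T c \<phi>)) (Bcontfun (T c \<psi>)) \<le> 1/2 * dist \<phi> \<psi>" if "\<phi> \<in> S" "\<psi> \<in> S" for \<phi> \<psi>
        by (rule dist_bound) (use T_diff[OF that, of c _ c] T_bcont that in \<open>auto simp: dist_real_def\<close>)
    qed auto
    then show ?thesis by blast
  qed
  then obtain \<Phi> where \<Phi>: "\<Phi> c \<in> S" "Bcontfun (T c (\<Phi> c)) = \<Phi> c" for c by metis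
  have fixed: "apply_bcontfun (\<Phi> c) = T c (\<Phi> c)" for c using \<Phi> T_bcont by metis
  show ?thesis
  proof (rule that[of "\<lambda>c. apply_bcontfun (\<Phi> c)"])
    fix c \<theta>
    have "primitive (g (\<Phi> c)) (2*pi) = integral {0..2*pi} (\<lambda>s. f s (\<Phi> c s))"
      by (simp add: primitive_pos g_def[abs_def])
    moreover have "g (\<Phi> c) \<theta> = f \<theta> (\<Phi> c \<theta>)" by (simp add: g_def)
    ultimately show "(apply_bcontfun (\<Phi> c) has_real_derivative
        \<epsilon> * (f \<theta> (\<Phi> c \<theta>) - integral {0..2*pi} (\<lambda>s. f s (\<Phi> c s)) / (2*pi))) (at \<theta>)"
      using derT[of c "\<Phi> c" \<theta>] unfolding fixed[symmetric] by simp
    show "\<Phi> c (\<theta> + 2*pi) = \<Phi> c \<theta>" using \<Phi>(1)[of c] by (simp add: S_def)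
    show "\<bar>\<Phi> c \<theta> - c\<bar> \<le> 4 * pi * \<epsilon> * F0" using T_close[OF \<Phi>(1)[of c], of c \<theta>] by (simp only: fixed)
  next
    fix c c' \<theta>
    \<comment> \<open>Comparing two fixed points bounds their distance by itself; absorbing the half
      gives the Lipschitz constant \<open>2\<close> in \<open>c\<close>.\<close>
    have "dist (\<Phi> c) (\<Phi> c') \<le> \<bar>c - c'\<bar> + dist (\<Phi> c) (\<Phi> c') / 2"
      by (rule dist_bound) (use T_diff[OF \<Phi>(1)[of c] \<Phi>(1)[of c'], of c _ c'] in \<open>auto simp: dist_real_def fixed[symmetric]\<close>)
    then show "\<bar>\<Phi> c \<theta> - \<Phi> c' \<theta>\<bar> \<le> 2 * \<bar>c - c'\<bar>"
      using dist_bounded[of "\<Phi> c" \<theta> "\<Phi> c'"] by (simp add: dist_real_def)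
  qed auto
qed


lemma integral_diff_le:
  fixes g h :: "real \<Rightarrow> real"
  assumes "continuous_on UNIV g" "continuous_on UNIV h" "\<And>x. \<bar>g x - h x\<bar> \<le> C"
  shows "\<bar>integral {0..2*pi} g - integral {0..2*pi} h\<bar> \<le> C * (2*pi)"
  using primitive_diff_le[OF assms, of "2*pi"] by (simp add: primitive_pos)

lemma continuous_on_curve:
  assumes "continuous_on UNIV (\<lambda>z. f (fst z) (snd z))" "continuous_on UNIV \<phi>"
  shows "continuous_on UNIV (\<lambda>s. f s (\<phi> s))"
proof -
  have "continuous_on UNIV (\<lambda>s. (\<lambda>z. f (fst z) (snd z)) (s, \<phi> s))"
    by (rule continuous_on_compose2[OF assms(1)]) (auto intro!: continuous_intros assms(2))
  then show ?thesis by simp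
qed

text \<open>Clamping \<open>r\<close> to the band extends \<open>f\<close> to a globally bounded
  Lipschitz function, to which the fixed point construction applies. The mean along
  \<open>\<phi> c\<close> is continuous in \<open>c\<close> and changes sign between
  \<open>c0 - \<eta>/2\<close> and \<open>c0 + \<eta>/2\<close>. At a zero the subtracted mean
  vanishes, and the solution stays in the band, where the clamping does nothing.\<close>

lemma periodic_solution_exists:
  fixes f :: "real \<Rightarrow> real \<Rightarrow> real"
  assumes contf: "continuous_on (UNIV \<times> {c0-\<eta>..c0+\<eta>}) (\<lambda>z. f (fst z) (snd z))"
    and per: "\<And>\<theta> r. f (\<theta> + 2*pi) r = f \<theta> r"
    and bnd: "\<And>\<theta> r. \<bar>r - c0\<bar> \<le> \<eta> \<Longrightarrow> \<bar>f \<theta> r\<bar> \<le> F0"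
    and lip: "\<And>\<theta> r r'. \<bar>r - c0\<bar> \<le> \<eta> \<Longrightarrow> \<bar>r' - c0\<bar> \<le> \<eta> \<Longrightarrow> \<bar>f \<theta> r - f \<theta> r'\<bar> \<le> L * \<bar>r - r'\<bar>"
    and L: "L \<ge> 0" and \<eta>: "\<eta> > 0"
    and \<epsilon>: "\<epsilon> > 0" "8 * pi * \<epsilon> * L \<le> 1" "8 * pi * \<epsilon> * F0 \<le> \<eta>"
    and \<sigma>: "\<bar>\<sigma>\<bar> = 1"
    and up: "\<sigma> * integral {0..2*pi} (\<lambda>\<theta>. f \<theta> (c0 + \<eta>/2)) \<ge> 8 * pi\<^sup>2 * \<epsilon> * L * F0"
    and down: "\<sigma> * integral {0..2*pi} (\<lambda>\<theta>. f \<theta> (c0 - \<eta>/2)) \<le> - (8 * pi\<^sup>2 * \<epsilon> * L * F0)"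
  obtains r where "\<And>\<theta>. (r has_real_derivative \<epsilon> * f \<theta> (r \<theta>)) (at \<theta>)"
    "\<And>\<theta>. r (\<theta> + 2*pi) = r \<theta>" "\<And>\<theta>. \<bar>r \<theta> - c0\<bar> \<le> \<eta>"
proof -
  define cl where "cl r = max (c0-\<eta>) (min (c0+\<eta>) r)" for r :: real
  define F where "F \<theta> r = f \<theta> (cl r)" for \<theta> r
  have cl_in: "\<bar>cl r - c0\<bar> \<le> \<eta>" for r using \<eta> by (auto simp: cl_def)
  have cl_id: "cl r = r" if "\<bar>r - c0\<bar> \<le> \<eta>" for r using that by (auto simp: cl_def)
  have cl_lip: "\<bar>cl r - cl r'\<bar> \<le> \<bar>r - r'\<bar>" for r r' by (auto simp: cl_def)
  have contF: "continuous_on UNIV (\<lambda>z. F (fst z) (snd z))"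
  proof -
    have "continuous_on UNIV (\<lambda>z::real\<times>real. (\<lambda>z. f (fst z) (snd z)) (fst z, cl (snd z)))"
      by (rule continuous_on_compose2[OF contf])
         (use \<eta> in \<open>auto simp: cl_def intro!: continuous_intros\<close>)
    then show ?thesis by (simp add: F_def)
  qed
  have F0: "F0 \<ge> 0" using bnd[of c0 0] \<eta> by auto
  have bndF: "\<bar>F \<theta> r\<bar> \<le> F0" for \<theta> r by (simp add: F_def bnd cl_in)
  have lipF: "\<bar>F \<theta> r - F \<theta> r'\<bar> \<le> L * \<bar>r - r'\<bar>" for \<theta> r r'
    using lip[OF cl_in[of r] cl_in[of r'], of \<theta>] mult_left_mono[OF cl_lip[of r r'] L]
    by (simp add: F_def)
  obtain \<phi> where cont\<phi>: "\<And>c. continuous_on UNIV (\<phi> c)"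
    and der\<phi>: "\<And>c \<theta>. (\<phi> c has_real_derivative
        \<epsilon> * (F \<theta> (\<phi> c \<theta>) - integral {0..2*pi} (\<lambda>s. F s (\<phi> c s)) / (2*pi))) (at \<theta>)"
    and per\<phi>: "\<And>c \<theta>. \<phi> c (\<theta> + 2*pi) = \<phi> c \<theta>"
    and close\<phi>: "\<And>c \<theta>. \<bar>\<phi> c \<theta> - c\<bar> \<le> 4 * pi * \<epsilon> * F0"
    and lip\<phi>: "\<And>c c' \<theta>. \<bar>\<phi> c \<theta> - \<phi> c' \<theta>\<bar> \<le> 2 * \<bar>c - c'\<bar>"
    by (rule averaged_equation_solvable[OF contF _ bndF lipF L _ \<epsilon>(2)]) (use \<epsilon> per in \<open>auto simp: F_def\<close>)
  define \<mu> where "\<mu> c = integral {0..2*pi} (\<lambda>s. F s (\<phi> c s))" for c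
  have \<mu>_lip: "\<bar>\<mu> c - \<mu> c'\<bar> \<le> (4 * pi * L) * \<bar>c - c'\<bar>" for c c'
  proof -
    have "\<bar>F s (\<phi> c s) - F s (\<phi> c' s)\<bar> \<le> L * (2 * \<bar>c - c'\<bar>)" for s
      by (rule order_trans[OF lipF mult_left_mono[OF lip\<phi> L]])
    from integral_diff_le[OF continuous_on_curve[OF contF cont\<phi>] continuous_on_curve[OF contF cont\<phi>] this]
    show ?thesis by (simp add: \<mu>_def algebra_simps)
  qed
  have cont\<mu>: "continuous_on S \<mu>" for S
  proof (rule lipschitz_on_continuous_on)
    show "(4 * pi * L)-lipschitz_on S \<mu>"
      using \<mu>_lip L by (auto intro!: lipschitz_onI simp: dist_real_def)
  qed
  \<comment> \<open>The error is \<open>L\<close> times the distance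
    \<open>4 * pi * \<epsilon> * F0\<close> of \<open>\<phi> c\<close> from the constant
    \<open>c\<close>, times the period \<open>2 * pi\<close>.\<close>
  have \<mu>_near: "\<bar>\<mu> c - integral {0..2*pi} (\<lambda>\<theta>. f \<theta> c)\<bar> \<le> 8 * pi\<^sup>2 * \<epsilon> * L * F0" if "\<bar>c - c0\<bar> \<le> \<eta>" for c
  proof -
    have "\<bar>F s (\<phi> c s) - F s c\<bar> \<le> L * (4 * pi * \<epsilon> * F0)" for s
      by (rule order_trans[OF lipF mult_left_mono[OF close\<phi> L]])
    from integral_diff_le[OF continuous_on_curve[OF contF cont\<phi>] continuous_on_curve[OF contF] this]
    show ?thesis by (simp add: \<mu>_def F_def cl_id[OF that] algebra_simps power2_eq_square)
  qed
  have "\<exists>c. c0 - \<eta>/2 \<le> c \<and> c \<le> c0 + \<eta>/2 \<and> \<sigma> * \<mu> c = 0"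
  proof (rule IVT')
    have *: "\<bar>\<sigma> * x - \<sigma> * y\<bar> = \<bar>x - y\<bar>" for x y
      using \<sigma> by (metis abs_mult mult_1 right_diff_distrib)
    show "\<sigma> * \<mu> (c0 - \<eta>/2) \<le> 0"
      using \<mu>_near[of "c0 - \<eta>/2"] \<eta> down *[of "\<mu> (c0 - \<eta>/2)" "integral {0..2*pi} (\<lambda>\<theta>. f \<theta> (c0 - \<eta>/2))"] by auto
    show "0 \<le> \<sigma> * \<mu> (c0 + \<eta>/2)"
      using \<mu>_near[of "c0 + \<eta>/2"] \<eta> up *[of "\<mu> (c0 + \<eta>/2)" "integral {0..2*pi} (\<lambda>\<theta>. f \<theta> (c0 + \<eta>/2))"] by auto
  qed (use \<eta> in \<open>auto intro!: continuous_intros cont\<mu>\<close>)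
  then obtain c where c': "c0 - \<eta>/2 \<le> c" "c \<le> c0 + \<eta>/2" "\<sigma> * \<mu> c = 0" by blast
  from c'(1,2) have c: "\<bar>c - c0\<bar> \<le> \<eta>/2" unfolding abs_le_iff by linarith
  from c'(3) \<sigma> have \<mu>c: "\<mu> c = 0" by auto
  have near: "\<bar>\<phi> c \<theta> - c0\<bar> \<le> \<eta>" for \<theta>
    using close\<phi>[of c \<theta>] c \<epsilon>(3) by linarith
  show ?thesis
  proof (rule that[of "\<phi> c"])
    show "(\<phi> c has_real_derivative \<epsilon> * f \<theta> (\<phi> c \<theta>)) (at \<theta>)" for \<theta>
      using der\<phi>[of c \<theta>] \<mu>c by (simp add: \<mu>_def F_def cl_id[OF near])
  qed (use per\<phi> near in auto)
qed

section \<open>Growth of bounded differences, and motion along a circle\<close>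

lemma primitive_multiple_period:
  assumes k: "continuous_on UNIV k" and p: "\<And>x. k (x + 2*pi) = k x"
  shows "primitive k (2*pi * of_int j) = of_int j * primitive k (2*pi)"
proof (induction j rule: int_induct[where k = 0])
  case (step1 i)
  have "primitive k (2*pi * of_int i + 2*pi) = primitive k (2*pi * of_int i) + primitive k (2*pi)"
    by (rule primitive_periodic[OF k p])
  then show ?case using step1 by (simp add: algebra_simps)
next
  case (step2 i)
  have "primitive k (2*pi * of_int (i - 1) + 2*pi) = primitive k (2*pi * of_int (i - 1)) + primitive k (2*pi)"
    by (rule primitive_periodic[OF k p])
  then show ?case using step2 by (simp add: algebra_simps)
qed simp

text \<open>The weight is chosen such that the weighted square of \<^term>\<open>y\<close> is monotone in time, in the
  direction given by the sign \<^term>\<open>\<sigma>\<close>. For the difference of two solutions this replaces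
  a uniqueness theorem for differential equations.\<close>

lemma bounded_growth_zero:
  fixes y y' \<theta> \<theta>' k :: "real \<Rightarrow> real"
  assumes k: "continuous_on UNIV k" "\<And>x. k (x + 2*pi) = k x" "integral {0..2*pi} k > 0"
    and \<epsilon>: "\<epsilon> > 0" and \<sigma>: "\<bar>\<sigma>\<bar> = 1"
    and \<theta>: "\<And>t. (\<theta> has_real_derivative \<theta>' t) (at t)" and m: "m > 0" "\<And>t. \<theta>' t \<ge> m"
    and y: "\<And>t. (y has_real_derivative y' t) (at t)"
    and growth: "\<And>t. \<sigma> * (y t * y' t) \<ge> \<epsilon> * \<theta>' t * k (\<theta> t) * (y t)\<^sup>2"
    and bnd: "\<And>t. \<bar>y t\<bar> \<le> B"
  shows "y t = 0"
proof -
  define E0 where "E0 = primitive k (2*pi)"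
  have E0: "E0 > 0" using k(3) by (simp add: E0_def primitive_pos)
  have \<sigma>2: "\<sigma> * \<sigma> = 1" using \<sigma> by (metis abs_mult_self_eq mult_1)
  have \<sigma>\<sigma>: "\<sigma> * (\<sigma> * q) = q" for q using \<sigma>2 by (simp flip: mult.assoc)
  \<comment> \<open>Time runs in direction \<open>\<sigma>\<close>, so that in both cases
    \<open>Z\<close> is nondecreasing in \<open>s\<close> and the oriented angle
    \<open>\<psi>\<close> increases.\<close>
  define Z where "Z s = (y (\<sigma> * s))\<^sup>2 * exp (- (2 * \<epsilon> * \<sigma>) * primitive k (\<theta> (\<sigma> * s)))" for s
  define \<psi> where "\<psi> s = \<sigma> * \<theta> (\<sigma> * s)" for s
  have scale: "((\<lambda>s. h (\<sigma> * s)) has_real_derivative \<sigma> * D) (at s)"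
    if "(h has_real_derivative D) (at (\<sigma> * s))" for h D s
    using DERIV_chain2[OF that DERIV_cmult_Id] by (simp add: mult.commute)
  have d\<psi>: "(\<psi> has_real_derivative \<theta>' (\<sigma> * s)) (at s)" for s
  proof -
    have "(\<psi> has_real_derivative \<sigma> * (\<sigma> * \<theta>' (\<sigma> * s))) (at s)"
      unfolding \<psi>_def by (intro DERIV_cmult scale \<theta>)
    then show ?thesis using \<sigma>2 by (simp flip: mult.assoc)
  qed
  have dZ: "(Z has_real_derivative exp (- (2 * \<epsilon> * \<sigma>) * primitive k (\<theta> (\<sigma> * s))) *
      (2 * (\<sigma> * (y (\<sigma> * s) * y' (\<sigma> * s))) - 2 * (\<epsilon> * \<theta>' (\<sigma> * s) * k (\<theta> (\<sigma> * s)) * (y (\<sigma> * s))\<^sup>2))) (at s)" for s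
  proof -
    have dE: "((\<lambda>t. primitive k (\<theta> t)) has_real_derivative k (\<theta> t) * \<theta>' t) (at t)" for t
      by (rule DERIV_chain2[OF primitive_has_derivative[OF k(1)] \<theta>])
    have "((\<lambda>s. primitive k (\<theta> (\<sigma> * s))) has_real_derivative \<sigma> * (k (\<theta> (\<sigma> * s)) * \<theta>' (\<sigma> * s))) (at s)"
      by (rule scale[OF dE])
    moreover have "((\<lambda>s. y (\<sigma> * s)) has_real_derivative \<sigma> * y' (\<sigma> * s)) (at s)"
      by (rule scale[OF y])
    ultimately have "(Z has_real_derivative
        2 * y (\<sigma> * s) * (\<sigma> * y' (\<sigma> * s)) * exp (- (2 * \<epsilon> * \<sigma>) * primitive k (\<theta> (\<sigma> * s)))
        + exp (- (2 * \<epsilon> * \<sigma>) * primitive k (\<theta> (\<sigma> * s))) * (- (2 * \<epsilon> * \<sigma>) * (\<sigma> * (k (\<theta> (\<sigma> * s)) * \<theta>' (\<sigma> * s)))) * (y (\<sigma> * s))\<^sup>2) (at s)"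
      unfolding Z_def[abs_def] by (auto intro!: derivative_eq_intros)
    moreover have "\<sigma> * (\<sigma> * q) = q" for q using \<sigma>2 by (simp add: mult.assoc[symmetric])
    ultimately show ?thesis by (simp add: algebra_simps)
  qed
  have mono: "Z s \<le> Z s'" if "s \<le> s'" for s s'
  proof (rule DERIV_nonneg_imp_nondecreasing[OF that])
    fix s
    show "\<exists>D. (Z has_real_derivative D) (at s) \<and> 0 \<le> D"
      by (rule exI, rule conjI, rule dZ) (use growth[of "\<sigma> * s"] in \<open>simp add: zero_le_mult_iff\<close>)
  qed
  \<comment> \<open>The speed of \<open>\<psi>\<close> is at least \<open>m\<close>, so by time
    \<open>s1\<close> it has passed \<open>q\<close>.\<close>
  have cofinal: "\<exists>s' \<ge> s. \<psi> s' = q" if "\<psi> s \<le> q" for s q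
  proof -
    define s1 where "s1 = s + (q - \<psi> s) / m"
    have s1: "s \<le> s1" using that m by (simp add: s1_def)
    have "\<psi> s1 - m * s1 \<ge> \<psi> s - m * s"
      by (rule DERIV_nonneg_imp_nondecreasing[OF s1]) (use d\<psi> m in \<open>auto intro!: derivative_eq_intros exI\<close>)
    then have "\<psi> s1 \<ge> q" using m(1) by (simp add: s1_def field_simps)
    then show ?thesis using IVT'[of \<psi> s q s1, OF that _ s1 derivative_imp_continuous_on[OF d\<psi>]]
      by blast
  qed
  define s0 where "s0 = \<sigma> * t"
  define q where "q = exp (- (2 * \<epsilon> * E0))"
  \<comment> \<open>After \<open>n\<close> oriented turns the weight is exactly \<open>q ^ n\<close>
    with \<open>q < 1\<close>, while \<open>y\<close> stays bounded by \<open>B\<close>.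
    Monotonicity carries this bound back to \<open>s0\<close>, and \<open>n\<close> is arbitrarily
    large.\<close>
  have upper: "Z s0 \<le> B\<^sup>2 * q ^ n" if n: "n \<ge> nat \<lceil>\<psi> s0 / (2*pi)\<rceil>" for n
  proof -
    have "\<psi> s0 / (2*pi) \<le> real n" using n by linarith
    then have "\<psi> s0 \<le> 2*pi*real n" by (simp add: field_simps)
    from cofinal[OF this] obtain s where s: "s \<ge> s0" "\<psi> s = 2*pi*real n" by blast
    have "\<theta> (\<sigma> * s) = \<sigma> * \<psi> s" using \<sigma>2 by (simp add: \<psi>_def flip: mult.assoc)
    then have \<theta>s: "\<theta> (\<sigma> * s) = 2*pi * (\<sigma> * real n)" using s by simp
    have "primitive k (2*pi * (\<sigma> * real n)) = \<sigma> * real n * E0"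
      using primitive_multiple_period[OF k(1,2), of "int n"] primitive_multiple_period[OF k(1,2), of "- int n"] \<sigma>
      unfolding E0_def by (cases "\<sigma> = 1") (auto simp: abs_if split: if_splits)
    then have "- (2 * \<epsilon> * \<sigma>) * primitive k (\<theta> (\<sigma> * s)) = real n * (- (2 * \<epsilon> * E0))"
      using \<sigma>2 \<theta>s by (simp add: mult_ac)
    then have "Z s = (y (\<sigma> * s))\<^sup>2 * exp (real n * (- (2 * \<epsilon> * E0)))" by (simp only: Z_def)
    then have "Z s = (y (\<sigma> * s))\<^sup>2 * q ^ n" by (simp only: q_def exp_of_nat_mult)
    also have "\<dots> \<le> B\<^sup>2 * q ^ n"
      using bnd[of "\<sigma> * s"] by (intro mult_right_mono) (auto simp: q_def abs_le_square_iff[symmetric])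
    finally show ?thesis using mono[OF s(1)] by linarith
  qed
  have "(\<lambda>n. B\<^sup>2 * q ^ n) \<longlonglongrightarrow> B\<^sup>2 * 0"
    by (intro tendsto_mult_left LIMSEQ_power_zero) (use \<epsilon> E0 in \<open>simp add: q_def\<close>)
  then have "(\<lambda>n. B\<^sup>2 * q ^ n) \<longlonglongrightarrow> 0" by simp
  then have "Z s0 \<le> 0"
    by (rule LIMSEQ_le_const[OF _ exI[of _ "nat \<lceil>\<psi> s0 / (2*pi)\<rceil>"]]) (use upper in auto)
  then have "(y (\<sigma> * s0))\<^sup>2 \<le> 0" by (simp add: Z_def mult_le_0_iff)
  then show ?thesis using \<sigma>2 by (simp add: s0_def flip: mult.assoc)
qed

text \<open>Separation of variables: \<open>P\<close> is elapsed time as a function of the angle,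
  the primitive of \<open>1/\<tau>\<close>. It is an increasing bijection of the line, its inverse
  is the motion, and one turn takes time \<open>P (2*pi)\<close>.\<close>

lemma periodic_phase_flow:
  fixes \<tau> :: "real \<Rightarrow> real"
  assumes c: "continuous_on UNIV \<tau>" and pos: "\<And>x. \<tau> x > 0" and p: "\<And>x. \<tau> (x + 2*pi) = \<tau> x"
  obtains \<Theta> T where "\<And>t. (\<Theta> has_real_derivative \<tau> (\<Theta> t)) (at t)" "T > 0" "\<And>t. \<Theta> (t + T) = \<Theta> t + 2*pi"
    "surj \<Theta>"
proof -
  define k where "k x = inverse (\<tau> x)" for x
  have k: "continuous_on UNIV k" unfolding k_def
    using pos by (intro continuous_on_inverse c) (auto simp: less_imp_neq[THEN not_sym])
  have kp: "k (x + 2*pi) = k x" for x by (simp add: k_def p)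
  have kpos: "k x > 0" for x by (simp add: k_def pos)
  define P where "P = primitive k"
  have dP: "(P has_real_derivative k x) (at x)" for x unfolding P_def by (rule primitive_has_derivative[OF k])
  have smono: "P x < P y" if "x < y" for x y
    by (rule DERIV_pos_imp_increasing[OF that]) (use dP kpos in blast)
  have P2: "P (x + 2*pi) = P x + P (2*pi)" for x unfolding P_def by (rule primitive_periodic[OF k kp])
  have T: "P (2*pi) > 0" using smono[of 0 "2*pi"] by (simp add: P_def)
  have inj: "inj P" by (rule injI) (metis smono linorder_neqE less_irrefl)
  have surj: "surj P"
    unfolding surj_def
  proof
    fix z
    obtain n :: nat where n: "\<bar>z\<bar> < real n * P (2*pi)" using T reals_Archimedean3 by blast
    have "P (2*pi * of_int j) = of_int j * P (2*pi)" for j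
      unfolding P_def by (rule primitive_multiple_period[OF k kp])
    from this[of "int n"] this[of "- int n"]
    have "P (- (2*pi*real n)) \<le> z" "z \<le> P (2*pi*real n)" using n by auto
    then have "\<exists>x. P x = z"
      using IVT'[of P "- (2*pi*real n)" z "2*pi*real n", OF _ _ _ derivative_imp_continuous_on[OF dP]]
      by auto
    then show "\<exists>x. z = P x" by metis
  qed
  define \<Theta> where "\<Theta> = inv P"
  have P\<Theta>: "P (\<Theta> t) = t" for t unfolding \<Theta>_def by (rule surj_f_inv_f[OF surj])
  have \<Theta>P: "\<Theta> (P x) = x" for x unfolding \<Theta>_def by (rule inv_f_f[OF inj])
  have cont: "isCont \<Theta> t" for t
    using isCont_inverse_function[of 1 "\<Theta> t" \<Theta> P] \<Theta>P P\<Theta> dP DERIV_isCont by fastforce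
  show ?thesis
  proof (rule that[of \<Theta> "P (2*pi)"])
    fix t
    have "(\<Theta> has_real_derivative inverse (k (\<Theta> t))) (at t)"
      by (rule DERIV_inverse_function[where f = P and a = "t-1" and b = "t+1"])
         (use dP kpos[of "\<Theta> t"] P\<Theta> cont in auto)
    then show "(\<Theta> has_real_derivative \<tau> (\<Theta> t)) (at t)" by (simp add: k_def)
    have "P (\<Theta> t + 2*pi) = t + P (2*pi)" by (simp add: P2 P\<Theta>)
    then show "\<Theta> (t + P (2*pi)) = \<Theta> t + 2*pi" by (metis \<Theta>P)
    show "surj \<Theta>" by (rule surjI) (rule \<Theta>P)
  qed (rule T)
qed

section \<open>Limit cycles in an annular chart\<close>

text \<open>In the chart, the vector field has angular speed \<^term>\<open>\<tau>\<close> and its orbits are the graphs of the solutions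
  of \<open>dr/d\<theta> = g \<theta> r\<close>. The assumption \<open>lift\<close> supplies polar coordinates along every solution
  that stays in \<open>N\<close> for all time.\<close>

locale annulus_chart =
  fixes F :: "real \<times> real \<Rightarrow> real \<times> real" and U V U1 U2 V1 V2 \<tau> g :: "real \<Rightarrow> real \<Rightarrow> real"
    and c0 \<eta> :: real and N :: "(real \<times> real) set"
  assumes \<eta>: "\<eta> > 0"
    and dU: "\<And>\<theta> r. \<bar>r - c0\<bar> \<le> \<eta> \<Longrightarrow>
      ((\<lambda>z. U (fst z) (snd z)) has_derivative (\<lambda>h. U1 \<theta> r * fst h + U2 \<theta> r * snd h)) (at (\<theta>, r))"
    and dV: "\<And>\<theta> r. \<bar>r - c0\<bar> \<le> \<eta> \<Longrightarrow>
      ((\<lambda>z. V (fst z) (snd z)) has_derivative (\<lambda>h. V1 \<theta> r * fst h + V2 \<theta> r * snd h)) (at (\<theta>, r))"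
    and perU: "\<And>\<theta> r. U (\<theta> + 2*pi) r = U \<theta> r" and perV: "\<And>\<theta> r. V (\<theta> + 2*pi) r = V \<theta> r"
    and jac: "\<And>\<theta> r. \<bar>r - c0\<bar> \<le> \<eta> \<Longrightarrow> U1 \<theta> r * V2 \<theta> r - V1 \<theta> r * U2 \<theta> r \<noteq> 0"
    and cont\<tau>: "continuous_on (UNIV \<times> {c0-\<eta>..c0+\<eta>}) (\<lambda>z. \<tau> (fst z) (snd z))"
    and pos\<tau>: "\<And>\<theta> r. \<bar>r - c0\<bar> \<le> \<eta> \<Longrightarrow> \<tau> \<theta> r > 0"
    and per\<tau>: "\<And>\<theta> r. \<tau> (\<theta> + 2*pi) r = \<tau> \<theta> r"
    and field: "\<And>\<theta> r. \<bar>r - c0\<bar> \<le> \<eta> \<Longrightarrow> F (U \<theta> r, V \<theta> r) =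
        (\<tau> \<theta> r * (U1 \<theta> r + g \<theta> r * U2 \<theta> r), \<tau> \<theta> r * (V1 \<theta> r + g \<theta> r * V2 \<theta> r))"
    and openN: "open N" and inN: "\<And>\<theta> r. \<bar>r - c0\<bar> < \<eta> \<Longrightarrow> (U \<theta> r, V \<theta> r) \<in> N"
    and lift: "\<And>x. is_solution F x \<Longrightarrow> range x \<subseteq> N \<Longrightarrow>
        \<exists>\<theta> r \<theta>' r'. \<forall>t. (\<theta> has_real_derivative \<theta>' t) (at t) \<and> (r has_real_derivative r' t) (at t)
          \<and> x t = (U (\<theta> t) (r t), V (\<theta> t) (r t)) \<and> \<bar>r t - c0\<bar> \<le> \<eta>"
begin

lemma chain:
  assumes "\<bar>r t - c0\<bar> \<le> \<eta>" "(\<theta> has_real_derivative \<theta>') (at t)" "(r has_real_derivative r') (at t)"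
  shows "((\<lambda>t. (U (\<theta> t) (r t), V (\<theta> t) (r t))) has_vector_derivative
    (U1 (\<theta> t) (r t) * \<theta>' + U2 (\<theta> t) (r t) * r', V1 (\<theta> t) (r t) * \<theta>' + V2 (\<theta> t) (r t) * r')) (at t)"
proof -
  have p: "((\<lambda>t. (\<theta> t, r t)) has_derivative (\<lambda>h. (h * \<theta>', h * r'))) (at t)"
    using assms(2,3) unfolding has_field_derivative_def by (intro has_derivative_Pair) (simp_all only: mult_commute_abs)
  have "((\<lambda>t. U (\<theta> t) (r t)) has_derivative (\<lambda>h. U1 (\<theta> t) (r t) * (h * \<theta>') + U2 (\<theta> t) (r t) * (h * r'))) (at t)"
    using has_derivative_compose[OF p dU[OF assms(1), of "\<theta> t"]] by simp
  moreover have "((\<lambda>t. V (\<theta> t) (r t)) has_derivative (\<lambda>h. V1 (\<theta> t) (r t) * (h * \<theta>') + V2 (\<theta> t) (r t) * (h * r'))) (at t)"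
    using has_derivative_compose[OF p dV[OF assms(1), of "\<theta> t"]] by simp
  ultimately have "((\<lambda>t. (U (\<theta> t) (r t), V (\<theta> t) (r t))) has_derivative
    (\<lambda>h. (U1 (\<theta> t) (r t) * (h * \<theta>') + U2 (\<theta> t) (r t) * (h * r'), V1 (\<theta> t) (r t) * (h * \<theta>') + V2 (\<theta> t) (r t) * (h * r')))) (at t)"
    by (rule has_derivative_Pair)
  then show ?thesis unfolding has_vector_derivative_def
    by (simp add: algebra_simps)
qed

text \<open>Compactness of one period times the band. The uniform bound is what forces a lifted
  orbit to run through all angles.\<close>

lemma tau_lower_bound:
  obtains m where "m > 0" "\<And>\<theta> r. \<bar>r - c0\<bar> \<le> \<eta> \<Longrightarrow> \<tau> \<theta> r \<ge> m"
proof -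
  let ?K = "{0..2*pi} \<times> {c0-\<eta>..c0+\<eta>}"
  have "compact ?K" by (intro compact_Times) auto
  moreover have "?K \<noteq> {}" using \<eta> by auto
  moreover have "continuous_on ?K (\<lambda>z. \<tau> (fst z) (snd z))" by (rule continuous_on_subset[OF cont\<tau>]) auto
  ultimately obtain z where z: "z \<in> ?K" "\<And>z'. z' \<in> ?K \<Longrightarrow> \<tau> (fst z) (snd z) \<le> \<tau> (fst z') (snd z')"
    using continuous_attains_inf[of ?K "\<lambda>z. \<tau> (fst z) (snd z)"] by blast
  show ?thesis
  proof (rule that[of "\<tau> (fst z) (snd z)"])
    show "\<tau> (fst z) (snd z) > 0" using z(1) by (intro pos\<tau>) (auto simp: abs_le_iff)
    fix \<theta> r assume r: "\<bar>r - c0\<bar> \<le> \<eta>"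
    obtain \<theta>' where "\<theta>' \<in> {0..2*pi}" "\<tau> \<theta> r = \<tau> \<theta>' r"
      by (rule periodic_in_period[of "\<lambda>\<theta>. \<tau> \<theta> r" \<theta>]) (auto simp: per\<tau>)
    then show "\<tau> \<theta> r \<ge> \<tau> (fst z) (snd z)" using z(2)[of "(\<theta>', r)"] r by (auto simp: abs_le_iff)
  qed
qed

text \<open>The chain rule and \<open>field\<close> express the same velocity in the frame of the
  chart. The frame is independent because the Jacobian does not vanish, so the coefficients agree;
  the \<open>algebra\<close> steps are Cramer's rule.\<close>

lemma lifted_equations:
  assumes "is_solution F x" "\<bar>r t - c0\<bar> \<le> \<eta>" "(\<theta> has_real_derivative \<theta>') (at t)" "(r has_real_derivative r') (at t)"
    and "\<And>t. x t = (U (\<theta> t) (r t), V (\<theta> t) (r t))"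
  shows "\<theta>' = \<tau> (\<theta> t) (r t)" "r' = \<tau> (\<theta> t) (r t) * g (\<theta> t) (r t)"
proof -
  let ?J = "U1 (\<theta> t) (r t) * V2 (\<theta> t) (r t) - V1 (\<theta> t) (r t) * U2 (\<theta> t) (r t)"
  have "x = (\<lambda>t. (U (\<theta> t) (r t), V (\<theta> t) (r t)))" using assms(5) by auto
  then have "(x has_vector_derivative (U1 (\<theta> t) (r t) * \<theta>' + U2 (\<theta> t) (r t) * r', V1 (\<theta> t) (r t) * \<theta>' + V2 (\<theta> t) (r t) * r')) (at t)"
    using chain[of r t \<theta>, OF assms(2-4)] by simp
  moreover have "(x has_vector_derivative F (U (\<theta> t) (r t), V (\<theta> t) (r t))) (at t)"
    using assms(1) by (simp add: is_solution_def flip: assms(5))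
  ultimately have "(U1 (\<theta> t) (r t) * \<theta>' + U2 (\<theta> t) (r t) * r', V1 (\<theta> t) (r t) * \<theta>' + V2 (\<theta> t) (r t) * r')
     = F (U (\<theta> t) (r t), V (\<theta> t) (r t))"
    by (rule vector_derivative_unique_at)
  then have *: "U1 (\<theta> t) (r t) * \<theta>' + U2 (\<theta> t) (r t) * r' = \<tau> (\<theta> t) (r t) * (U1 (\<theta> t) (r t) + g (\<theta> t) (r t) * U2 (\<theta> t) (r t))"
    "V1 (\<theta> t) (r t) * \<theta>' + V2 (\<theta> t) (r t) * r' = \<tau> (\<theta> t) (r t) * (V1 (\<theta> t) (r t) + g (\<theta> t) (r t) * V2 (\<theta> t) (r t))"
    unfolding field[OF assms(2)] by auto
  have "?J * (\<theta>' - \<tau> (\<theta> t) (r t)) = 0" using * by algebra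
  with jac[OF assms(2), of "\<theta> t"] show "\<theta>' = \<tau> (\<theta> t) (r t)" by simp
  have "?J * (r' - \<tau> (\<theta> t) (r t) * g (\<theta> t) (r t)) = 0" using * by algebra
  with jac[OF assms(2), of "\<theta> t"] show "r' = \<tau> (\<theta> t) (r t) * g (\<theta> t) (r t)" by simp
qed

text \<open>On the graph only the scalar autonomous equation for the angle remains, with a positive
  periodic speed, and \<open>periodic_phase_flow\<close> solves it.\<close>

lemma periodic_orbit_of_graph:
  assumes h: "\<And>\<theta>. (h has_real_derivative g \<theta> (h \<theta>)) (at \<theta>)" "\<And>\<theta>. h (\<theta> + 2*pi) = h \<theta>" "\<And>\<theta>. \<bar>h \<theta> - c0\<bar> \<le> \<eta>"
  shows "periodic_orbit F (range (\<lambda>\<theta>. (U \<theta> (h \<theta>), V \<theta> (h \<theta>))))"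
proof -
  have conth: "continuous_on UNIV h"
    by (rule derivative_imp_continuous_on[OF h(1)])
  have "continuous_on UNIV (\<lambda>\<theta>. (\<lambda>z. \<tau> (fst z) (snd z)) (\<theta>, h \<theta>))"
    by (rule continuous_on_compose2[OF cont\<tau>]) (use h(3) in \<open>auto intro!: continuous_intros conth simp: abs_le_iff algebra_simps\<close>)
  then have c: "continuous_on UNIV (\<lambda>\<theta>. \<tau> \<theta> (h \<theta>))" by simp
  obtain \<Theta> T where \<Theta>: "\<And>t. (\<Theta> has_real_derivative \<tau> (\<Theta> t) (h (\<Theta> t))) (at t)" "T > 0"
      "\<And>t. \<Theta> (t + T) = \<Theta> t + 2*pi" "surj \<Theta>"
    by (rule periodic_phase_flow[OF c]) (use pos\<tau> h per\<tau> in auto)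
  define x where "x t = (U (\<Theta> t) (h (\<Theta> t)), V (\<Theta> t) (h (\<Theta> t)))" for t
  have dh: "((\<lambda>t. h (\<Theta> t)) has_real_derivative g (\<Theta> t) (h (\<Theta> t)) * \<tau> (\<Theta> t) (h (\<Theta> t))) (at t)" for t
    by (rule DERIV_chain2[OF h(1) \<Theta>(1)])
  have sol: "is_solution F x"
    unfolding is_solution_def
  proof
    fix t
    show "(x has_vector_derivative F (x t)) (at t)"
      using chain[where r = "\<lambda>t. h (\<Theta> t)" and t = t, OF h(3) \<Theta>(1) dh]
      unfolding x_def field[OF h(3)] by (simp add: algebra_simps)
  qed
  have "\<not> (\<forall>t. x t = x 0)"
  proof
    assume "\<forall>t. x t = x 0"
    then have "x = (\<lambda>_. x 0)" by auto
    then have "(x has_vector_derivative 0) (at 0)" by (metis has_vector_derivative_const)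
    moreover have "(x has_vector_derivative F (x 0)) (at 0)" using sol by (simp add: is_solution_def)
    ultimately have "F (x 0) = 0" by (rule vector_derivative_unique_at[rotated])
    \<comment> \<open>A constant orbit would be an equilibrium, which makes the two frame vectors
      linearly dependent.\<close>
    then have z: "U1 (\<Theta> 0) (h (\<Theta> 0)) + g (\<Theta> 0) (h (\<Theta> 0)) * U2 (\<Theta> 0) (h (\<Theta> 0)) = 0"
      "V1 (\<Theta> 0) (h (\<Theta> 0)) + g (\<Theta> 0) (h (\<Theta> 0)) * V2 (\<Theta> 0) (h (\<Theta> 0)) = 0"
      using field[OF h(3)] pos\<tau>[OF h(3)] by (auto simp: x_def zero_prod_def less_le)
    then have "U1 (\<Theta> 0) (h (\<Theta> 0)) * V2 (\<Theta> 0) (h (\<Theta> 0)) - V1 (\<Theta> 0) (h (\<Theta> 0)) * U2 (\<Theta> 0) (h (\<Theta> 0)) = 0"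
      by algebra
    then show False using jac[OF h(3)] by simp
  qed
  moreover have "x (t + T) = x t" for t by (simp add: x_def \<Theta>(3) perU perV h(2))
  moreover have "range (\<lambda>\<theta>. (U \<theta> (h \<theta>), V \<theta> (h \<theta>))) = range x"
  proof -
    have "range x = (\<lambda>\<theta>. (U \<theta> (h \<theta>), V \<theta> (h \<theta>))) ` range \<Theta>" unfolding x_def image_image ..
    then show ?thesis unfolding \<Theta>(4) by simp
  qed
  ultimately show ?thesis unfolding periodic_orbit_def using sol \<Theta>(2) by blast
qed

text \<open>For a periodic orbit inside \<open>N\<close>, the radial difference \<open>y\<close> to
  the graph is bounded and satisfies the growth inequality of \<open>bounded_growth_zero\<close>, so
  it vanishes. In \<open>hyp\<close> the sign \<open>\<sigma>\<close> distinguishes a repelling from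
  an attracting cycle; only the mean of the rate \<open>k\<close> has to be positive.\<close>

lemma limit_cycle_of_graph:
  assumes h: "\<And>\<theta>. (h has_real_derivative g \<theta> (h \<theta>)) (at \<theta>)" "\<And>\<theta>. h (\<theta> + 2*pi) = h \<theta>" "\<And>\<theta>. \<bar>h \<theta> - c0\<bar> < \<eta>"
    and k: "continuous_on UNIV k" "\<And>x. k (x + 2*pi) = k x" "integral {0..2*pi} k > 0"
    and \<epsilon>: "\<epsilon> > 0" and \<sigma>: "\<bar>\<sigma>\<bar> = 1"
    and hyp: "\<And>\<theta> r r'. \<bar>r - c0\<bar> \<le> \<eta> \<Longrightarrow> \<bar>r' - c0\<bar> \<le> \<eta> \<Longrightarrow>
        \<sigma> * ((r - r') * (g \<theta> r - g \<theta> r')) \<ge> \<epsilon> * k \<theta> * (r - r')\<^sup>2"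
  shows "limit_cycle F (range (\<lambda>\<theta>. (U \<theta> (h \<theta>), V \<theta> (h \<theta>))))" (is "limit_cycle F ?\<Gamma>")
proof -
  have h3: "\<bar>h \<theta> - c0\<bar> \<le> \<eta>" for \<theta> using h(3)[of \<theta>] by simp
  obtain m where m: "m > 0" "\<And>\<theta> r. \<bar>r - c0\<bar> \<le> \<eta> \<Longrightarrow> \<tau> \<theta> r \<ge> m" by (rule tau_lower_bound) blast
  have "\<Gamma>' = ?\<Gamma>" if \<Gamma>': "periodic_orbit F \<Gamma>'" "\<Gamma>' \<subseteq> N" for \<Gamma>'
  proof -
    obtain x where x: "is_solution F x" "\<Gamma>' = range x" using \<Gamma>'(1) by (auto simp: periodic_orbit_def)
    obtain \<theta> r \<theta>' r' where l: "\<And>t. (\<theta> has_real_derivative \<theta>' t) (at t)" "\<And>t. (r has_real_derivative r' t) (at t)"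
      "\<And>t. x t = (U (\<theta> t) (r t), V (\<theta> t) (r t))" "\<And>t. \<bar>r t - c0\<bar> \<le> \<eta>"
      using lift[OF x(1)] \<Gamma>'(2) x(2) by blast
    note eq = lifted_equations[OF x(1) l(4) l(1) l(2) l(3)]
    define y where "y t = r t - h (\<theta> t)" for t
    have dy: "(y has_real_derivative \<tau> (\<theta> t) (r t) * (g (\<theta> t) (r t) - g (\<theta> t) (h (\<theta> t)))) (at t)" for t
      unfolding y_def using DERIV_diff[OF l(2)[of t] DERIV_chain2[OF h(1) l(1)[of t]]] eq[of t]
      by (simp add: algebra_simps)
    have y0: "y t = 0" for t
    proof (rule bounded_growth_zero[OF k \<epsilon> \<sigma> l(1) m(1) _ dy])
      show "m \<le> \<theta>' t" for t using m(2)[OF l(4)] eq(1) by simp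
      show "\<bar>y t\<bar> \<le> 2 * \<eta>" for t using l(4)[of t] h3[of "\<theta> t"] unfolding y_def by linarith
      show "\<epsilon> * \<theta>' t * k (\<theta> t) * (y t)\<^sup>2 \<le> \<sigma> * (y t * (\<tau> (\<theta> t) (r t) * (g (\<theta> t) (r t) - g (\<theta> t) (h (\<theta> t)))))" for t
      proof -
        have "\<tau> (\<theta> t) (r t) * (\<epsilon> * k (\<theta> t) * (y t)\<^sup>2) \<le>
            \<tau> (\<theta> t) (r t) * (\<sigma> * (y t * (g (\<theta> t) (r t) - g (\<theta> t) (h (\<theta> t)))))"
          unfolding y_def by (rule mult_left_mono[OF hyp]) (use l(4)[of t] h3 pos\<tau>[OF l(4)[of t], of "\<theta> t"] in auto)
        then show ?thesis by (simp add: eq(1)[of t] mult_ac)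
      qed
    qed
    \<comment> \<open>So far the orbit lies on the graph; it must also cover it, hence the angle has
      to take every value.\<close>
    have surj: "\<exists>t. \<theta> t = q" for q
    proof -
      have mono: "\<theta> s - m * s \<le> \<theta> t - m * t" if "s \<le> t" for s t
        by (rule DERIV_nonneg_imp_nondecreasing[OF that])
           (use l(1) m(2)[OF l(4)] eq(1) in \<open>fastforce intro!: derivative_eq_intros exI\<close>)
      define s1 where "s1 = \<bar>q - \<theta> 0\<bar> / m"
      have s1: "0 \<le> s1" "m * s1 = \<bar>q - \<theta> 0\<bar>" using m by (auto simp: s1_def)
      have "\<theta> (- s1) \<le> q" "q \<le> \<theta> s1" using mono[of "-s1" 0] mono[of 0 s1] s1 by auto
      then show ?thesis
        using IVT'[of \<theta> "-s1" q s1, OF _ _ _ derivative_imp_continuous_on[OF l(1)]] s1 by auto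
    qed
    have "x = (\<lambda>t. (U (\<theta> t) (h (\<theta> t)), V (\<theta> t) (h (\<theta> t))))" using l(3) y0 by (simp add: y_def fun_eq_iff)
    then have "range x = (\<lambda>\<theta>. (U \<theta> (h \<theta>), V \<theta> (h \<theta>))) ` range \<theta>" by (simp add: image_image)
    moreover have "range \<theta> = UNIV" using surj by (auto simp: surj_def) metis
    ultimately show ?thesis unfolding x(2) by simp
  qed
  moreover have "?\<Gamma> \<subseteq> N" using inN h(3) by auto
  ultimately show ?thesis
    unfolding limit_cycle_def using periodic_orbit_of_graph[OF h(1,2) h3] openN by blast
qed

end

section \<open>Parametrised continuously differentiable functions\<close>

text \<open>The derivative is two-sided also at the end points of \<^term>\<open>J\<close>.\<close>

definition C1_deriv :: "'a::topological_space set \<Rightarrow> real set \<Rightarrow> ('a \<Rightarrow> real \<Rightarrow> real) \<Rightarrow> ('a \<Rightarrow> real \<Rightarrow> real) \<Rightarrow> bool" where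
  "C1_deriv K J f f' \<longleftrightarrow> continuous_on (K \<times> J) (\<lambda>z. f (fst z) (snd z)) \<and>
     continuous_on (K \<times> J) (\<lambda>z. f' (fst z) (snd z)) \<and>
     (\<forall>x\<in>K. \<forall>r\<in>J. (f x has_real_derivative f' x r) (at r))"

text \<open>The derivative is hidden in an existential so that the closure rules compose without
  tracking derivative formulas.\<close>

definition C1_on :: "'a::topological_space set \<Rightarrow> real set \<Rightarrow> ('a \<Rightarrow> real \<Rightarrow> real) \<Rightarrow> bool" where
  "C1_on K J f \<longleftrightarrow> (\<exists>f'. C1_deriv K J f f')"

lemma C1_onI: "C1_deriv K J f f' \<Longrightarrow> C1_on K J f"
  by (auto simp: C1_on_def)

lemma C1_on_continuous: "C1_on K J f \<Longrightarrow> continuous_on (K \<times> J) (\<lambda>z. f (fst z) (snd z))"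
  by (auto simp: C1_on_def C1_deriv_def)

lemma C1_on_param: "continuous_on K g \<Longrightarrow> C1_on K J (\<lambda>x r. g x)"
  by (rule C1_onI[of _ _ _ "\<lambda>_ _. 0"])
     (auto simp: C1_deriv_def intro!: continuous_intros continuous_on_compose2[of K g])

lemma C1_on_id: "C1_on K J (\<lambda>x r. r)"
  by (rule C1_onI[of _ _ _ "\<lambda>_ _. 1"]) (auto simp: C1_deriv_def intro!: continuous_intros derivative_eq_intros)

lemma C1_on_add: "C1_on K J f \<Longrightarrow> C1_on K J g \<Longrightarrow> C1_on K J (\<lambda>x r. f x r + g x r)"
  unfolding C1_on_def
proof (elim exE)
  fix f' g' assume *: "C1_deriv K J f f'" "C1_deriv K J g g'"
  show "\<exists>h'. C1_deriv K J (\<lambda>x r. f x r + g x r) h'"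
    by (rule exI[of _ "\<lambda>x r. f' x r + g' x r"])
       (use * in \<open>auto simp: C1_deriv_def intro!: continuous_intros DERIV_add\<close>)
qed

lemma C1_on_mult: "C1_on K J f \<Longrightarrow> C1_on K J g \<Longrightarrow> C1_on K J (\<lambda>x r. f x r * g x r)"
  unfolding C1_on_def
proof (elim exE)
  fix f' g' assume *: "C1_deriv K J f f'" "C1_deriv K J g g'"
  show "\<exists>h'. C1_deriv K J (\<lambda>x r. f x r * g x r) h'"
    by (rule exI[of _ "\<lambda>x r. f' x r * g x r + g' x r * f x r"])
       (use * in \<open>auto simp: C1_deriv_def intro!: continuous_intros DERIV_mult\<close>)
qed

lemma C1_on_const: "C1_on K J (\<lambda>x r. c)"
  by (rule C1_on_param) (rule continuous_on_const)

lemma C1_on_minus: "C1_on K J f \<Longrightarrow> C1_on K J (\<lambda>x r. - f x r)"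
  using C1_on_mult[OF C1_on_const[of K J "-1"]] by simp

lemma C1_on_diff:
  assumes "C1_on K J f" "C1_on K J g"
  shows "C1_on K J (\<lambda>x r. f x r - g x r)"
  using C1_on_add[OF assms(1) C1_on_minus[OF assms(2)]] by simp

lemma C1_on_power: "C1_on K J f \<Longrightarrow> C1_on K J (\<lambda>x r. f x r ^ n)"
proof (induction n)
  case 0 then show ?case by (simp add: C1_on_const)
next
  case (Suc n) then show ?case using C1_on_mult by simp
qed

lemma C1_on_sum: "(\<And>i. i \<in> I \<Longrightarrow> C1_on K J (f i)) \<Longrightarrow> C1_on K J (\<lambda>x r. \<Sum>i\<in>I. f i x r)"
  by (induction I rule: infinite_finite_induct) (auto intro: C1_on_const C1_on_add)

lemma C1_on_inverse:
  assumes "C1_on K J f" "\<And>x r. x \<in> K \<Longrightarrow> r \<in> J \<Longrightarrow> f x r \<noteq> 0"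
  shows "C1_on K J (\<lambda>x r. inverse (f x r))"
proof -
  obtain f' where *: "C1_deriv K J f f'" using assms(1) by (auto simp: C1_on_def)
  show ?thesis
  proof (rule C1_onI[of _ _ _ "\<lambda>x r. - (inverse (f x r) * f' x r * inverse (f x r))"], unfold C1_deriv_def, intro conjI ballI)
    show "((\<lambda>r. inverse (f x r)) has_real_derivative - (inverse (f x r) * f' x r * inverse (f x r))) (at r)"
      if "x \<in> K" "r \<in> J" for x r
      by (rule DERIV_inverse') (use * assms(2) that in \<open>auto simp: C1_deriv_def\<close>)
  qed (use * assms(2) in \<open>auto simp: C1_deriv_def intro!: continuous_intros\<close>)
qed

lemma C1_on_divide:
  assumes "C1_on K J f" "C1_on K J g" "\<And>x r. x \<in> K \<Longrightarrow> r \<in> J \<Longrightarrow> g x r \<noteq> 0"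
  shows "C1_on K J (\<lambda>x r. f x r / g x r)"
  unfolding divide_inverse by (intro C1_on_mult C1_on_inverse assms)

lemma C1_on_sqrt:
  assumes "C1_on K J f" "\<And>x r. x \<in> K \<Longrightarrow> r \<in> J \<Longrightarrow> f x r > 0"
  shows "C1_on K J (\<lambda>x r. sqrt (f x r))"
proof -
  obtain f' where *: "C1_deriv K J f f'" using assms(1) by (auto simp: C1_on_def)
  show ?thesis
  proof (rule C1_onI[of _ _ _ "\<lambda>x r. inverse (sqrt (f x r)) / 2 * f' x r"], unfold C1_deriv_def, intro conjI ballI)
    show "((\<lambda>r. sqrt (f x r)) has_real_derivative inverse (sqrt (f x r)) / 2 * f' x r) (at r)"
      if "x \<in> K" "r \<in> J" for x r
      by (rule DERIV_chain2[OF DERIV_real_sqrt]) (use * assms(2) that in \<open>auto simp: C1_deriv_def\<close>)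
  qed (use * assms(2) in \<open>auto simp: C1_deriv_def less_imp_neq[THEN not_sym] intro!: continuous_intros\<close>)
qed

lemmas C1_intros = C1_on_param C1_on_id C1_on_const C1_on_add C1_on_diff C1_on_minus C1_on_mult C1_on_power
  C1_on_divide C1_on_sqrt C1_on_sum

lemma C1_deriv_integral:
  assumes G: "C1_deriv {0..2*pi} {a..b} G G'" and r: "r \<in> {a<..<b}"
  shows "((\<lambda>r. integral {0..2*pi} (\<lambda>\<theta>. G \<theta> r)) has_real_derivative integral {0..2*pi} (\<lambda>\<theta>. G' \<theta> r)) (at r)"
proof -
  have contG: "continuous_on ({0..2*pi} \<times> {a..b}) (\<lambda>z. G (fst z) (snd z))"
    and contG': "continuous_on ({0..2*pi} \<times> {a..b}) (\<lambda>z. G' (fst z) (snd z))"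
    and der: "\<And>\<theta> r. \<theta> \<in> {0..2*pi} \<Longrightarrow> r \<in> {a..b} \<Longrightarrow> (G \<theta> has_real_derivative G' \<theta> r) (at r)"
    using G by (auto simp: C1_deriv_def)
  have "((\<lambda>r. integral (cbox 0 (2*pi)) (\<lambda>\<theta>. G \<theta> r)) has_real_derivative
      integral (cbox 0 (2*pi)) (\<lambda>\<theta>. G' \<theta> r)) (at r within {a..b})"
  proof (rule leibniz_rule_field_derivative)
    fix s \<theta> assume "s \<in> {a..b}" "\<theta> \<in> cbox 0 (2*pi)"
    then show "((\<lambda>x. G \<theta> x) has_real_derivative G' \<theta> s) (at s within {a..b})"
      by (intro has_field_derivative_at_within[OF der]) auto
  next
    fix s assume s: "s \<in> {a..b}"
    have "continuous_on {0..2*pi} (\<lambda>\<theta>. (\<lambda>z. G (fst z) (snd z)) (\<theta>, s))"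
      by (rule continuous_on_compose2[OF contG]) (use s in \<open>auto intro!: continuous_intros\<close>)
    then show "(\<lambda>\<theta>. G \<theta> s) integrable_on cbox 0 (2*pi)"
      by (simp add: integrable_continuous_real)
  next
    have "continuous_on ({a..b} \<times> {0..2*pi}) (\<lambda>z. (\<lambda>z. G' (fst z) (snd z)) (snd z, fst z))"
      by (rule continuous_on_compose2[OF contG']) (auto intro!: continuous_intros)
    then show "continuous_on ({a..b} \<times> cbox 0 (2*pi)) (\<lambda>(x, t). G' t x)"
      by (simp add: split_def)
  qed (use r in auto)
  moreover have "at r within {a..b} = at r"
    by (rule at_within_interior) (use r in simp)
  ultimately show ?thesis by simp
qed

text \<open>Near the zero \<open>\<sigma> * L s\<close> is strictly increasing in \<open>r\<close>,
  and its signs at \<open>r0 - q\<close> and \<open>r0 + q\<close> survive small changes of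
  \<open>s\<close>. The intermediate value theorem therefore replaces the implicit function theorem,
  which suits a parameter available only on the side \<open>s \<ge> 0\<close>.\<close>

lemma C1_simple_zero_persists:
  assumes L: "C1_deriv {0..s1::real} {r0-\<eta>..r0+\<eta>} L L'" and s1: "s1 > 0" and \<eta>: "\<eta> > 0"
    and zero: "L 0 r0 = 0" and simple: "L' 0 r0 \<noteq> 0"
  obtains s0 where "s0 > 0" "\<And>s. 0 \<le> s \<Longrightarrow> s < s0 \<Longrightarrow>
     \<exists>r D. \<bar>r - r0\<bar> < \<eta> \<and> L s r = 0 \<and> (L s has_real_derivative D) (at r) \<and> D \<noteq> 0"
proof -
  define \<sigma> where "\<sigma> = sgn (L' 0 r0)"
  have \<sigma>: "\<sigma> \<noteq> 0" "\<sigma> * L' 0 r0 > 0" using simple by (auto simp: \<sigma>_def sgn_if)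
  let ?K = "{0..s1} \<times> {r0-\<eta>..r0+\<eta>}"
  have contL: "continuous_on ?K (\<lambda>z. L (fst z) (snd z))" and contL': "continuous_on ?K (\<lambda>z. L' (fst z) (snd z))"
    and der: "\<And>s r. s \<in> {0..s1} \<Longrightarrow> r \<in> {r0-\<eta>..r0+\<eta>} \<Longrightarrow> (L s has_real_derivative L' s r) (at r)"
    using L by (auto simp: C1_deriv_def)
  have "continuous_on ?K (\<lambda>z. \<sigma> * L' (fst z) (snd z))" by (intro continuous_intros contL')
  from this[unfolded continuous_on_iff, rule_format, of "(0, r0)" "\<sigma> * L' 0 r0"] s1 \<eta> \<sigma>
  obtain d where d: "d > 0" "\<And>z. z \<in> ?K \<Longrightarrow> dist z (0, r0) < d \<Longrightarrow> dist (\<sigma> * L' (fst z) (snd z)) (\<sigma> * L' 0 r0) < \<sigma> * L' 0 r0"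
    by auto
  \<comment> \<open>At most \<open>d/3\<close> in \<open>r\<close> and \<open>d/3\<close> in
    \<open>s\<close> add up to less than \<open>d\<close>.\<close>
  define q where "q = min (\<eta>/2) (d/3)"
  have q: "0 < q" "q < \<eta>" "q \<le> d/3" using d(1) \<eta> by (auto simp: q_def)
  have pos: "\<sigma> * L' s r > 0" if "0 \<le> s" "s \<le> s1" "s \<le> d/3" "\<bar>r - r0\<bar> \<le> q" for s r
  proof -
    have "dist (s, r) (0, r0) \<le> \<bar>s\<bar> + \<bar>r - r0\<bar>"
      unfolding dist_prod_def dist_real_def using sqrt_sum_squares_le_sum_abs[of "s - 0" "r - r0"] by simp
    then have "dist (s, r) (0, r0) < d" using that q d(1) by auto
    from d(2)[OF _ this] that q show ?thesis by (auto simp: dist_real_def abs_le_iff)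
  qed
  have incr: "\<sigma> * L s r < \<sigma> * L s r'" if "0 \<le> s" "s \<le> s1" "s \<le> d/3" "r < r'" "\<bar>r - r0\<bar> \<le> q" "\<bar>r' - r0\<bar> \<le> q" for s r r'
  proof (rule DERIV_pos_imp_increasing[OF \<open>r < r'\<close>])
    fix x assume x: "r \<le> x" "x \<le> r'"
    then have xq: "\<bar>x - r0\<bar> \<le> q" using that by auto
    have "(L s has_real_derivative L' s x) (at x)"
      by (rule der) (use that(1,2) xq q in \<open>auto simp: abs_le_iff\<close>)
    with xq show "\<exists>y. ((\<lambda>x. \<sigma> * L s x) has_real_derivative y) (at x) \<and> 0 < y"
      using pos[OF that(1-3), of x] by (intro exI[of _ "\<sigma> * L' s x"]) (auto intro!: DERIV_cmult)
  qed
  have near: "\<exists>e>0. \<forall>s. 0 \<le> s \<and> s \<le> s1 \<and> s < e \<longrightarrow> dist (\<sigma> * L s r) (\<sigma> * L 0 r) < \<bar>\<sigma> * L 0 r\<bar>"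
    if "\<bar>r - r0\<bar> \<le> q" "L 0 r \<noteq> 0" for r
  proof -
    have "continuous_on {0..s1} (\<lambda>s. \<sigma> * (\<lambda>z. L (fst z) (snd z)) (s, r))"
      by (intro continuous_intros continuous_on_compose2[OF contL]) (use that q in \<open>auto simp: abs_le_iff\<close>)
    from this[unfolded continuous_on_iff, rule_format, of 0 "\<bar>\<sigma> * L 0 r\<bar>"] that \<sigma> s1
    obtain e where "e > 0" "\<And>s. s \<in> {0..s1} \<Longrightarrow> dist s 0 < e \<Longrightarrow> dist (\<sigma> * L s r) (\<sigma> * L 0 r) < \<bar>\<sigma> * L 0 r\<bar>" by auto
    then show ?thesis by (intro exI[of _ e]) auto
  qed
  have up: "\<sigma> * L 0 (r0 + q) > 0" and down: "\<sigma> * L 0 (r0 - q) < 0"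
    using incr[of 0 r0 "r0 + q"] incr[of 0 "r0 - q" r0] q d(1) s1 zero by auto
  from near[of "r0 + q"] up q have "\<exists>e>0. \<forall>s. 0 \<le> s \<and> s \<le> s1 \<and> s < e \<longrightarrow> dist (\<sigma> * L s (r0 + q)) (\<sigma> * L 0 (r0 + q)) < \<bar>\<sigma> * L 0 (r0 + q)\<bar>"
    by fastforce
  then obtain e1 where e1: "e1 > 0" "\<And>s. 0 \<le> s \<Longrightarrow> s \<le> s1 \<Longrightarrow> s < e1 \<Longrightarrow> dist (\<sigma> * L s (r0 + q)) (\<sigma> * L 0 (r0 + q)) < \<bar>\<sigma> * L 0 (r0 + q)\<bar>"
    by blast
  from near[of "r0 - q"] down q have "\<exists>e>0. \<forall>s. 0 \<le> s \<and> s \<le> s1 \<and> s < e \<longrightarrow> dist (\<sigma> * L s (r0 - q)) (\<sigma> * L 0 (r0 - q)) < \<bar>\<sigma> * L 0 (r0 - q)\<bar>"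
    by fastforce
  then obtain e2 where e2: "e2 > 0" "\<And>s. 0 \<le> s \<Longrightarrow> s \<le> s1 \<Longrightarrow> s < e2 \<Longrightarrow> dist (\<sigma> * L s (r0 - q)) (\<sigma> * L 0 (r0 - q)) < \<bar>\<sigma> * L 0 (r0 - q)\<bar>"
    by blast
  show ?thesis
  proof (rule that[of "min (min e1 e2) (min s1 (d/3))"])
    fix s assume s: "0 \<le> s" "s < min (min e1 e2) (min s1 (d/3))"
    have "\<sigma> * L s (r0 + q) > 0" using e1(2)[of s] s up by (auto simp: dist_real_def)
    moreover have "\<sigma> * L s (r0 - q) < 0" using e2(2)[of s] s down by (auto simp: dist_real_def)
    moreover have "continuous_on {r0 - q..r0 + q} (\<lambda>r. \<sigma> * (\<lambda>z. L (fst z) (snd z)) (s, r))"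
      by (intro continuous_intros continuous_on_compose2[OF contL]) (use s q in auto)
    ultimately obtain r where r: "r0 - q \<le> r" "r \<le> r0 + q" "\<sigma> * L s r = 0"
      using IVT'[of "\<lambda>r. \<sigma> * L s r" "r0 - q" 0 "r0 + q"] q by auto
    have r': "\<bar>r - r0\<bar> \<le> q" using r by auto
    show "\<exists>r D. \<bar>r - r0\<bar> < \<eta> \<and> L s r = 0 \<and> (L s has_real_derivative D) (at r) \<and> D \<noteq> 0"
      using r \<sigma> q r' pos[of s r] s der[of s r] by (intro exI[of _ r] exI[of _ "L' s r"]) auto
  qed (use e1 e2 s1 d in auto)
qed

section \<open>From a simple zero of the mean to periodic solutions\<close>

lemma compact_abs_bound:
  fixes F :: "'a::metric_space \<Rightarrow> real"
  assumes "compact K" "continuous_on K F"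
  obtains B where "B \<ge> 0" "\<And>z. z \<in> K \<Longrightarrow> \<bar>F z\<bar> \<le> B"
proof -
  have "bounded (F ` K)" using assms by (intro compact_imp_bounded compact_continuous_image)
  then obtain B where B: "\<And>y. y \<in> F ` K \<Longrightarrow> norm y \<le> B" by (auto simp: bounded_iff)
  show ?thesis by (rule that[of "\<bar>B\<bar>"]) (use B in force)+
qed

lemma integral_lower_bound:
  fixes g h :: "real \<Rightarrow> real"
  assumes "continuous_on UNIV g" "continuous_on UNIV h" "\<And>x. g x \<le> h x"
  shows "integral {0..2*pi} g \<le> integral {0..2*pi} h"
  by (rule integral_le) (use assms in \<open>auto intro!: integrable_continuous_real intro: continuous_on_subset\<close>)

text \<open>At \<open>\<epsilon> = 0\<close> the function \<^term>\<open>f\<close> is the integrand of the Melnikov function, for which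
  \<^term>\<open>c0\<close> is a simple zero.\<close>

locale averaged_family =
  fixes f f' :: "real \<Rightarrow> real \<Rightarrow> real \<Rightarrow> real" and c0 \<eta>0 \<epsilon>1 :: real
  assumes C1: "C1_deriv ({0..\<epsilon>1} \<times> UNIV) {c0-\<eta>0..c0+\<eta>0} (\<lambda>x. f (fst x) (snd x)) (\<lambda>x. f' (fst x) (snd x))"
    and \<epsilon>1: "\<epsilon>1 > 0" and \<eta>0: "\<eta>0 > 0"
    and per: "\<And>\<epsilon> \<theta> r. f \<epsilon> (\<theta> + 2*pi) r = f \<epsilon> \<theta> r"
    and zero: "integral {0..2*pi} (\<lambda>\<theta>. f 0 \<theta> c0) = 0"
    and simple: "integral {0..2*pi} (\<lambda>\<theta>. f' 0 \<theta> c0) \<noteq> 0"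
begin

abbreviation "J \<equiv> {c0-\<eta>0..c0+\<eta>0}"

lemma contf: "continuous_on (({0..\<epsilon>1} \<times> UNIV) \<times> J) (\<lambda>z. f (fst (fst z)) (snd (fst z)) (snd z))"
  and contf': "continuous_on (({0..\<epsilon>1} \<times> UNIV) \<times> J) (\<lambda>z. f' (fst (fst z)) (snd (fst z)) (snd z))"
  using C1 by (simp_all add: C1_deriv_def)

lemma der: "\<epsilon> \<in> {0..\<epsilon>1} \<Longrightarrow> r \<in> J \<Longrightarrow> (f \<epsilon> \<theta> has_real_derivative f' \<epsilon> \<theta> r) (at r)"
  using C1 by (auto simp: C1_deriv_def)

lemma per': "\<epsilon> \<in> {0..\<epsilon>1} \<Longrightarrow> r \<in> J \<Longrightarrow> f' \<epsilon> (\<theta> + 2*pi) r = f' \<epsilon> \<theta> r"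
proof -
  assume *: "\<epsilon> \<in> {0..\<epsilon>1}" "r \<in> J"
  have "f \<epsilon> (\<theta> + 2*pi) = f \<epsilon> \<theta>" using per by auto
  with der[OF *, of "\<theta> + 2*pi"] der[OF *, of \<theta>] show ?thesis by (auto intro: DERIV_unique)
qed

lemma cont_slice:
  assumes "\<epsilon> \<in> {0..\<epsilon>1}" "r \<in> J"
  shows "continuous_on UNIV (\<lambda>\<theta>. f \<epsilon> \<theta> r)" "continuous_on UNIV (\<lambda>\<theta>. f' \<epsilon> \<theta> r)"
proof -
  have "continuous_on UNIV (\<lambda>\<theta>. (\<lambda>z. f (fst (fst z)) (snd (fst z)) (snd z)) ((\<epsilon>, \<theta>), r))"
    by (rule continuous_on_compose2[OF contf]) (use assms in \<open>auto intro!: continuous_intros\<close>)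
  then show "continuous_on UNIV (\<lambda>\<theta>. f \<epsilon> \<theta> r)" by simp
  have "continuous_on UNIV (\<lambda>\<theta>. (\<lambda>z. f' (fst (fst z)) (snd (fst z)) (snd z)) ((\<epsilon>, \<theta>), r))"
    by (rule continuous_on_compose2[OF contf']) (use assms in \<open>auto intro!: continuous_intros\<close>)
  then show "continuous_on UNIV (\<lambda>\<theta>. f' \<epsilon> \<theta> r)" by simp
qed

abbreviation "K0 \<equiv> ({0..\<epsilon>1} \<times> {0..2*pi}) \<times> J"

lemma compact_K0: "compact K0"
  by (intro compact_Times) auto

lemma contf_K0: "continuous_on K0 (\<lambda>z. f (fst (fst z)) (snd (fst z)) (snd z))"
  and contf'_K0: "continuous_on K0 (\<lambda>z. f' (fst (fst z)) (snd (fst z)) (snd z))"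
  by (rule continuous_on_subset[OF contf], auto) (rule continuous_on_subset[OF contf'], auto)

text \<open>Uniform continuity over one period yields a \<open>d\<close> independent of the angle,
  and periodicity extends it to all angles.\<close>

lemma uniform_at_c0:
  assumes g: "continuous_on K0 (\<lambda>z. g (fst (fst z)) (snd (fst z)) (snd z))"
    and p: "\<And>\<epsilon> \<theta> r. \<epsilon> \<in> {0..\<epsilon>1} \<Longrightarrow> r \<in> J \<Longrightarrow> g \<epsilon> (\<theta> + 2*pi) r = (g \<epsilon> \<theta> r :: real)"
    and e: "e > 0"
  obtains d where "d > 0" "\<And>\<epsilon> \<theta> r. \<epsilon> \<in> {0..\<epsilon>1} \<Longrightarrow> \<epsilon> < d \<Longrightarrow> r \<in> J \<Longrightarrow> \<bar>r - c0\<bar> < d \<Longrightarrow> \<bar>g \<epsilon> \<theta> r - g 0 \<theta> c0\<bar> < e"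
proof -
  have "uniformly_continuous_on K0 (\<lambda>z. g (fst (fst z)) (snd (fst z)) (snd z))"
    by (rule compact_uniformly_continuous[OF g compact_K0])
  then obtain d where d: "d > 0" and dd: "\<And>z z'. z \<in> K0 \<Longrightarrow> z' \<in> K0 \<Longrightarrow> dist z' z < d \<Longrightarrow>
      dist (g (fst (fst z')) (snd (fst z')) (snd z')) (g (fst (fst z)) (snd (fst z)) (snd z)) < e"
    using e unfolding uniformly_continuous_on_def by metis
  show ?thesis
  proof (rule that[of "d/2"])
    fix \<epsilon> \<theta> r assume *: "\<epsilon> \<in> {0..\<epsilon>1}" "\<epsilon> < d/2" "r \<in> J" "\<bar>r - c0\<bar> < d/2"
    \<comment> \<open>One representative angle has to serve both functions at once, hence the
      pair.\<close>
    obtain y where y: "y \<in> {0..2*pi}" "(g \<epsilon> \<theta> r, g 0 \<theta> c0) = (g \<epsilon> y r, g 0 y c0)"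
      by (rule periodic_in_period[of "\<lambda>\<theta>. (g \<epsilon> \<theta> r, g 0 \<theta> c0)" \<theta>])
         (use p[OF *(1,3)] p[of 0 c0] \<epsilon>1 \<eta>0 in auto)
    have "dist ((\<epsilon>, y), r) ((0, y), c0) \<le> \<bar>\<epsilon>\<bar> + \<bar>r - c0\<bar>"
      unfolding dist_prod_def dist_real_def using sqrt_sum_squares_le_sum_abs[of \<epsilon> "r - c0"] by simp
    then have "dist ((\<epsilon>, y), r) ((0, y), c0) < d" using * by auto
    with dd[of "((0, y), c0)" "((\<epsilon>, y), r)"] * y(1) \<epsilon>1 \<eta>0
    have "dist (g \<epsilon> y r) (g 0 y c0) < e" by auto
    then show "\<bar>g \<epsilon> \<theta> r - g 0 \<theta> c0\<bar> < e" using y(2) by (simp add: dist_real_def)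
  qed (use d in simp)
qed

lemma uniform_bound:
  assumes g: "continuous_on K0 (\<lambda>z. g (fst (fst z)) (snd (fst z)) (snd z))"
    and p: "\<And>\<epsilon> \<theta> r. \<epsilon> \<in> {0..\<epsilon>1} \<Longrightarrow> r \<in> J \<Longrightarrow> g \<epsilon> (\<theta> + 2*pi) r = (g \<epsilon> \<theta> r :: real)"
  obtains B where "B \<ge> 0" "\<And>\<epsilon> \<theta> r. \<epsilon> \<in> {0..\<epsilon>1} \<Longrightarrow> r \<in> J \<Longrightarrow> \<bar>g \<epsilon> \<theta> r\<bar> \<le> B"
proof -
  obtain B where B: "B \<ge> 0" "\<And>z. z \<in> K0 \<Longrightarrow> \<bar>g (fst (fst z)) (snd (fst z)) (snd z)\<bar> \<le> B"
    by (rule compact_abs_bound[OF compact_K0 g]) blast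
  show ?thesis
  proof (rule that[OF B(1)])
    fix \<epsilon> \<theta> r assume *: "\<epsilon> \<in> {0..\<epsilon>1}" "r \<in> J"
    obtain y where y: "y \<in> {0..2*pi}" "g \<epsilon> \<theta> r = g \<epsilon> y r"
      by (rule periodic_in_period[of "\<lambda>\<theta>. g \<epsilon> \<theta> r" \<theta>]) (use p[OF *] in auto)
    then show "\<bar>g \<epsilon> \<theta> r\<bar> \<le> B" using B(2)[of "((\<epsilon>, y), r)"] * by auto
  qed
qed

text \<open>The weight \<open>k\<close> is a lower bound for \<open>\<sigma>\<close> times the
  radial derivative, valid uniformly near \<open>c0\<close> and for small \<open>\<epsilon>\<close>.
  Through the mean value theorem it gives the one-sided monotonicity used for isolation, and
  integrated over a period it gives the sign change used for existence.\<close>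

lemma hyperbolic_periodic_solutions:
  obtains \<eta> \<epsilon>0 k \<sigma> where "0 < \<eta>" "\<eta> \<le> \<eta>0" "0 < \<epsilon>0" "\<epsilon>0 \<le> \<epsilon>1" "\<bar>\<sigma>\<bar> = 1"
    "continuous_on UNIV k" "\<And>\<theta>. k (\<theta> + 2*pi) = k \<theta>" "integral {0..2*pi} k > 0"
    "\<And>\<epsilon> \<theta> r r'. 0 < \<epsilon> \<Longrightarrow> \<epsilon> < \<epsilon>0 \<Longrightarrow> \<bar>r - c0\<bar> \<le> \<eta> \<Longrightarrow> \<bar>r' - c0\<bar> \<le> \<eta> \<Longrightarrow>
       k \<theta> * (r - r')\<^sup>2 \<le> \<sigma> * ((r - r') * (f \<epsilon> \<theta> r - f \<epsilon> \<theta> r'))"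
    "\<And>\<epsilon>. 0 < \<epsilon> \<Longrightarrow> \<epsilon> < \<epsilon>0 \<Longrightarrow> \<exists>h. (\<forall>\<theta>. (h has_real_derivative \<epsilon> * f \<epsilon> \<theta> (h \<theta>)) (at \<theta>)) \<and>
       (\<forall>\<theta>. h (\<theta> + 2*pi) = h \<theta>) \<and> (\<forall>\<theta>. \<bar>h \<theta> - c0\<bar> < \<eta>)"
proof -
  have 0: "0 \<in> {0..\<epsilon>1}" "c0 \<in> J" using \<epsilon>1 \<eta>0 by auto
  define \<Lambda> where "\<Lambda> = integral {0..2*pi} (\<lambda>\<theta>. f' 0 \<theta> c0)"
  define \<sigma> where "\<sigma> = sgn \<Lambda>"
  \<comment> \<open>Lowering the weight by \<open>\<kappa>\<close> costs half of the integral
    \<open>|\<Lambda>|\<close>, so its mean stays positive while \<open>f'\<close> may vary by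
    \<open>\<kappa>\<close>.\<close>
  define \<kappa> where "\<kappa> = \<bar>\<Lambda>\<bar> / (4*pi)"
  define k where "k \<theta> = \<sigma> * f' 0 \<theta> c0 - \<kappa>" for \<theta>
  have \<Lambda>: "\<bar>\<Lambda>\<bar> > 0" using simple by (simp add: \<Lambda>_def)
  have \<sigma>: "\<bar>\<sigma>\<bar> = 1" "\<sigma> * \<Lambda> = \<bar>\<Lambda>\<bar>" using \<Lambda> by (auto simp: \<sigma>_def sgn_if abs_if)
  have \<kappa>: "\<kappa> > 0" using \<Lambda> by (simp add: \<kappa>_def)
  have contk: "continuous_on UNIV k" unfolding k_def by (intro continuous_intros cont_slice 0)
  have perk: "k (\<theta> + 2*pi) = k \<theta>" for \<theta> unfolding k_def by (simp add: per'[OF 0])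
  have intk: "integral {0..2*pi} k = \<bar>\<Lambda>\<bar> / 2"
  proof -
    have i: "(\<lambda>\<theta>. f' 0 \<theta> c0) integrable_on {0..2*pi}"
      by (rule integrable_continuous_real) (rule continuous_on_subset[OF cont_slice(2)[OF 0]], simp)
    have "integral {0..2*pi} k = \<sigma> * \<Lambda> - 2*pi*\<kappa>"
      unfolding k_def \<Lambda>_def using i by (subst integral_diff) (auto intro: integrable_on_mult_right)
    also have "\<dots> = \<bar>\<Lambda>\<bar> / 2" using \<sigma>(2) by (simp add: \<kappa>_def)
    finally show ?thesis .
  qed
  obtain F0 where F0: "F0 \<ge> 0" "\<And>\<epsilon> \<theta> r. \<epsilon> \<in> {0..\<epsilon>1} \<Longrightarrow> r \<in> J \<Longrightarrow> \<bar>f \<epsilon> \<theta> r\<bar> \<le> F0"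
    by (rule uniform_bound[OF contf_K0]) (use per in auto)
  obtain L where L: "L \<ge> 0" "\<And>\<epsilon> \<theta> r. \<epsilon> \<in> {0..\<epsilon>1} \<Longrightarrow> r \<in> J \<Longrightarrow> \<bar>f' \<epsilon> \<theta> r\<bar> \<le> L"
    by (rule uniform_bound[OF contf'_K0]) (use per' in auto)
  obtain d1 where d1: "d1 > 0" "\<And>\<epsilon> \<theta> r. \<epsilon> \<in> {0..\<epsilon>1} \<Longrightarrow> \<epsilon> < d1 \<Longrightarrow> r \<in> J \<Longrightarrow> \<bar>r - c0\<bar> < d1 \<Longrightarrow> \<bar>f' \<epsilon> \<theta> r - f' 0 \<theta> c0\<bar> < \<kappa>"
    by (rule uniform_at_c0[OF contf'_K0 _ \<kappa>]) (use per' in auto)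
  define \<eta> where "\<eta> = min \<eta>0 (d1/2)"
  have \<eta>: "0 < \<eta>" "\<eta> \<le> \<eta>0" "\<eta> < d1" using d1(1) \<eta>0 by (auto simp: \<eta>_def)
  have inJ: "r \<in> J" if "\<bar>r - c0\<bar> \<le> \<eta>" for r using that \<eta>(2) by (auto simp: abs_le_iff)
  have mvt: "\<exists>z. \<bar>z - c0\<bar> \<le> \<eta> \<and> f \<epsilon> \<theta> r - f \<epsilon> \<theta> r' = (r - r') * f' \<epsilon> \<theta> z"
    if "\<epsilon> \<in> {0..\<epsilon>1}" "\<bar>r - c0\<bar> \<le> \<eta>" "\<bar>r' - c0\<bar> \<le> \<eta>" for \<epsilon> \<theta> r r'
  proof -
    have *: "\<exists>z. \<bar>z - c0\<bar> \<le> \<eta> \<and> f \<epsilon> \<theta> b - f \<epsilon> \<theta> a = (b - a) * f' \<epsilon> \<theta> z"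
      if ab: "a < b" "\<bar>a - c0\<bar> \<le> \<eta>" "\<bar>b - c0\<bar> \<le> \<eta>" for a b
    proof -
      have "(f \<epsilon> \<theta> has_real_derivative f' \<epsilon> \<theta> x) (at x)" if "a \<le> x" "x \<le> b" for x
        by (rule der[OF \<open>\<epsilon> \<in> {0..\<epsilon>1}\<close> inJ]) (use ab that in auto)
      from MVT2[OF \<open>a < b\<close> this] obtain z where "a < z" "z < b" "f \<epsilon> \<theta> b - f \<epsilon> \<theta> a = (b - a) * f' \<epsilon> \<theta> z" by auto
      then show ?thesis using ab by (intro exI[of _ z]) auto
    qed
    consider "r < r'" | "r = r'" | "r' < r" by linarith
    then show ?thesis
    proof cases
      case 1
      from *[OF 1 that(2,3)] obtain z where z: "\<bar>z - c0\<bar> \<le> \<eta>" "f \<epsilon> \<theta> r' - f \<epsilon> \<theta> r = (r' - r) * f' \<epsilon> \<theta> z" by blast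
      have "f \<epsilon> \<theta> r - f \<epsilon> \<theta> r' = (r - r') * f' \<epsilon> \<theta> z" using z(2) by (simp add: algebra_simps)
      with z(1) show ?thesis by blast
    next
      case 2 then show ?thesis using \<eta> by (intro exI[of _ c0]) simp
    next
      case 3 from *[OF 3 that(3,2)] show ?thesis .
    qed
  qed
  have lip: "\<bar>f \<epsilon> \<theta> r - f \<epsilon> \<theta> r'\<bar> \<le> L * \<bar>r - r'\<bar>"
    if as: "\<epsilon> \<in> {0..\<epsilon>1}" "\<bar>r - c0\<bar> \<le> \<eta>" "\<bar>r' - c0\<bar> \<le> \<eta>" for \<epsilon> \<theta> r r'
  proof -
    obtain z where z: "\<bar>z - c0\<bar> \<le> \<eta>" "f \<epsilon> \<theta> r - f \<epsilon> \<theta> r' = (r - r') * f' \<epsilon> \<theta> z" using mvt[OF as] by blast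
    show ?thesis unfolding z(2) abs_mult
      using mult_right_mono[OF L(2)[OF as(1) inJ[OF z(1)], of \<theta>], of "\<bar>r - r'\<bar>"] by (simp add: mult.commute)
  qed
  have mono: "k \<theta> * (r - r')\<^sup>2 \<le> \<sigma> * ((r - r') * (f \<epsilon> \<theta> r - f \<epsilon> \<theta> r'))"
    if as: "\<epsilon> \<in> {0..\<epsilon>1}" "\<epsilon> < d1" "\<bar>r - c0\<bar> \<le> \<eta>" "\<bar>r' - c0\<bar> \<le> \<eta>" for \<epsilon> \<theta> r r'
  proof -
    obtain z where z: "\<bar>z - c0\<bar> \<le> \<eta>" "f \<epsilon> \<theta> r - f \<epsilon> \<theta> r' = (r - r') * f' \<epsilon> \<theta> z" using mvt[OF as(1,3,4)] by blast
    have "\<bar>f' \<epsilon> \<theta> z - f' 0 \<theta> c0\<bar> < \<kappa>" by (rule d1(2)[OF as(1,2) inJ[OF z(1)]]) (use z \<eta> in simp)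
    then have "\<bar>\<sigma> * (f' \<epsilon> \<theta> z - f' 0 \<theta> c0)\<bar> < \<kappa>" by (simp add: abs_mult \<sigma>(1))
    then have "k \<theta> \<le> \<sigma> * f' \<epsilon> \<theta> z" unfolding k_def by (simp add: algebra_simps abs_less_iff)
    then have "k \<theta> * (r - r')\<^sup>2 \<le> \<sigma> * f' \<epsilon> \<theta> z * (r - r')\<^sup>2" by (rule mult_right_mono) simp
    then show ?thesis unfolding z(2) by (simp add: power2_eq_square mult_ac)
  qed
  \<comment> \<open>\<open>periodic_solution_exists\<close> is applied to the band of width
    \<open>\<eta>/2\<close>, which puts its test points at distance \<open>\<eta>/4\<close> and the
    solution strictly inside the band of width \<open>\<eta>\<close>.\<close>
  define q where "q = \<eta>/4"
  have q: "q > 0" using \<eta> by (simp add: q_def)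
  \<comment> \<open>The mean at \<open>c0\<close> moves by at most \<open>2 * pi * \<zeta>\<close>,
    one quarter of the gain \<open>q * |\<Lambda>| / 2\<close>.\<close>
  define \<zeta> where "\<zeta> = q * \<bar>\<Lambda>\<bar> / (16 * pi)"
  have \<zeta>: "\<zeta> > 0" using q \<Lambda> by (simp add: \<zeta>_def)
  obtain d2 where d2: "d2 > 0" "\<And>\<epsilon> \<theta> r. \<epsilon> \<in> {0..\<epsilon>1} \<Longrightarrow> \<epsilon> < d2 \<Longrightarrow> r \<in> J \<Longrightarrow> \<bar>r - c0\<bar> < d2 \<Longrightarrow> \<bar>f \<epsilon> \<theta> r - f 0 \<theta> c0\<bar> < \<zeta>"
    by (rule uniform_at_c0[OF contf_K0 _ \<zeta>]) (use per in auto)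
  have up: "q * \<bar>\<Lambda>\<bar> / 4 \<le> \<sigma> * integral {0..2*pi} (\<lambda>\<theta>. f \<epsilon> \<theta> (c0 + q))"
    and down: "\<sigma> * integral {0..2*pi} (\<lambda>\<theta>. f \<epsilon> \<theta> (c0 - q)) \<le> - (q * \<bar>\<Lambda>\<bar> / 4)"
    if e: "\<epsilon> \<in> {0..\<epsilon>1}" "\<epsilon> < d1" "\<epsilon> < d2" for \<epsilon>
  proof -
    have J: "c0 + q \<in> J" "c0 - q \<in> J" using q \<eta> by (auto simp: q_def)
    have cc: "\<bar>f \<epsilon> \<theta> c0 - f 0 \<theta> c0\<bar> \<le> \<zeta>" for \<theta>
      using d2(2)[OF e(1,3) 0(2), of \<theta>] d2(1) by simp
    have I0: "\<bar>integral {0..2*pi} (\<lambda>\<theta>. f \<epsilon> \<theta> c0)\<bar> \<le> \<zeta> * (2*pi)"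
      using integral_diff_le[OF cont_slice(1)[OF e(1) 0(2)] cont_slice(1)[OF 0] cc] zero by simp
    have eq: "2 * (\<zeta> * (2*pi)) = q * \<bar>\<Lambda>\<bar> / 4" by (simp add: \<zeta>_def)
    have \<sigma>I: "\<bar>\<sigma> * integral {0..2*pi} (\<lambda>\<theta>. f \<epsilon> \<theta> c0)\<bar> \<le> \<zeta> * (2*pi)" using I0 \<sigma>(1) by (simp add: abs_mult)
    have int: "(\<lambda>\<theta>. f \<epsilon> \<theta> r) integrable_on {0..2*pi}" if "r \<in> J" for r
      by (rule integrable_continuous_real) (rule continuous_on_subset[OF cont_slice(1)[OF e(1) that]], simp)
    have kq: "integral {0..2*pi} (\<lambda>\<theta>. k \<theta> * q) = q * \<bar>\<Lambda>\<bar> / 2" using intk by simp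
    have "k \<theta> * q \<le> \<sigma> * f \<epsilon> \<theta> (c0 + q) - \<sigma> * f \<epsilon> \<theta> c0" for \<theta>
    proof -
      have "q * (k \<theta> * q) \<le> q * (\<sigma> * f \<epsilon> \<theta> (c0 + q) - \<sigma> * f \<epsilon> \<theta> c0)"
        using mono[OF e(1,2), of "c0 + q" c0 \<theta>] q \<eta> by (simp add: q_def power2_eq_square algebra_simps)
      then show ?thesis using q by simp
    qed
    then have "integral {0..2*pi} (\<lambda>\<theta>. k \<theta> * q) \<le> integral {0..2*pi} (\<lambda>\<theta>. \<sigma> * f \<epsilon> \<theta> (c0 + q) - \<sigma> * f \<epsilon> \<theta> c0)"
      by (intro integral_lower_bound) (auto intro!: continuous_intros contk cont_slice e(1) J 0(2))
    also have "\<dots> = \<sigma> * integral {0..2*pi} (\<lambda>\<theta>. f \<epsilon> \<theta> (c0 + q)) - \<sigma> * integral {0..2*pi} (\<lambda>\<theta>. f \<epsilon> \<theta> c0)"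
      by (subst integral_diff) (auto intro!: integrable_on_mult_right int J 0(2))
    finally show "q * \<bar>\<Lambda>\<bar> / 4 \<le> \<sigma> * integral {0..2*pi} (\<lambda>\<theta>. f \<epsilon> \<theta> (c0 + q))"
      using kq eq abs_le_D1[OF \<sigma>I] abs_le_D2[OF \<sigma>I] by linarith
    have "k \<theta> * q \<le> \<sigma> * f \<epsilon> \<theta> c0 - \<sigma> * f \<epsilon> \<theta> (c0 - q)" for \<theta>
    proof -
      have "q * (k \<theta> * q) \<le> q * (\<sigma> * f \<epsilon> \<theta> c0 - \<sigma> * f \<epsilon> \<theta> (c0 - q))"
        using mono[OF e(1,2), of c0 "c0 - q" \<theta>] q \<eta> by (simp add: q_def power2_eq_square algebra_simps)
      then show ?thesis using q by simp
    qed
    then have "integral {0..2*pi} (\<lambda>\<theta>. k \<theta> * q) \<le> integral {0..2*pi} (\<lambda>\<theta>. \<sigma> * f \<epsilon> \<theta> c0 - \<sigma> * f \<epsilon> \<theta> (c0 - q))"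
      by (intro integral_lower_bound) (auto intro!: continuous_intros contk cont_slice e(1) J 0(2))
    also have "\<dots> = \<sigma> * integral {0..2*pi} (\<lambda>\<theta>. f \<epsilon> \<theta> c0) - \<sigma> * integral {0..2*pi} (\<lambda>\<theta>. f \<epsilon> \<theta> (c0 - q))"
      by (subst integral_diff) (auto intro!: integrable_on_mult_right int J 0(2))
    finally show "\<sigma> * integral {0..2*pi} (\<lambda>\<theta>. f \<epsilon> \<theta> (c0 - q)) \<le> - (q * \<bar>\<Lambda>\<bar> / 4)"
      using kq eq abs_le_D1[OF \<sigma>I] abs_le_D2[OF \<sigma>I] by linarith
  qed
  \<comment> \<open>The last three entries give, in this order, the contraction, the confinement to
    the band and the averaging error below. Adding \<open>1\<close> to \<open>L\<close> and
    \<open>F0\<close> keeps the denominators positive.\<close>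
  define \<epsilon>0 where "\<epsilon>0 = Min {\<epsilon>1, d1, d2, 1 / (8*pi*(L+1)), \<eta> / (16*pi*(F0+1)), q * \<bar>\<Lambda>\<bar> / (32 * pi\<^sup>2 * (L+1) * (F0+1))}"
  have \<epsilon>0: "\<epsilon>0 > 0" unfolding \<epsilon>0_def using \<epsilon>1 d1 d2 L(1) F0(1) \<eta> q \<Lambda> by auto
  have sm: "\<epsilon> \<le> \<epsilon>1" "\<epsilon> < d1" "\<epsilon> < d2" "\<epsilon> < 1 / (8*pi*(L+1))" "\<epsilon> < \<eta> / (16*pi*(F0+1))"
     "\<epsilon> < q * \<bar>\<Lambda>\<bar> / (32 * pi\<^sup>2 * (L+1) * (F0+1))" if "\<epsilon> < \<epsilon>0" for \<epsilon>
    using that unfolding \<epsilon>0_def by auto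
  show ?thesis
  proof (rule that[of \<eta> \<epsilon>0 \<sigma> k])
    show "\<epsilon>0 \<le> \<epsilon>1" unfolding \<epsilon>0_def by auto
    show "k \<theta> * (r - r')\<^sup>2 \<le> \<sigma> * ((r - r') * (f \<epsilon> \<theta> r - f \<epsilon> \<theta> r'))"
      if "0 < \<epsilon>" "\<epsilon> < \<epsilon>0" "\<bar>r - c0\<bar> \<le> \<eta>" "\<bar>r' - c0\<bar> \<le> \<eta>" for \<epsilon> \<theta> r r'
      by (rule mono) (use that sm[OF that(2)] in auto)
    show "\<exists>h. (\<forall>\<theta>. (h has_real_derivative \<epsilon> * f \<epsilon> \<theta> (h \<theta>)) (at \<theta>)) \<and>
       (\<forall>\<theta>. h (\<theta> + 2*pi) = h \<theta>) \<and> (\<forall>\<theta>. \<bar>h \<theta> - c0\<bar> < \<eta>)" if e: "0 < \<epsilon>" "\<epsilon> < \<epsilon>0" for \<epsilon>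
    proof -
      note sm = sm[OF e(2)]
      have e1: "\<epsilon> \<in> {0..\<epsilon>1}" using e sm(1) by auto
      have small: "\<epsilon> * (c * A) \<le> D" if "\<epsilon> < D / (c * (A + 1))" "c > 0" "A \<ge> 0" for c A D
      proof -
        have "\<epsilon> * (c * (A + 1)) < D" using that by (simp add: pos_less_divide_eq)
        moreover have "\<epsilon> * (c * A) \<le> \<epsilon> * (c * (A + 1))" using that e by simp
        ultimately show ?thesis by linarith
      qed
      have s1: "8 * pi * \<epsilon> * L \<le> 1" using small[OF sm(4)] L(1) by (simp add: mult_ac)
      have s2: "8 * pi * \<epsilon> * F0 \<le> \<eta>/2" using small[OF sm(5)] F0(1) by (simp add: mult_ac)
      have s3: "8 * pi\<^sup>2 * \<epsilon> * L * F0 \<le> q * \<bar>\<Lambda>\<bar> / 4"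
      proof -
        have "\<epsilon> * (32 * pi\<^sup>2 * (L+1) * F0) \<le> q * \<bar>\<Lambda>\<bar>"
          by (rule small[OF sm(6)]) (use L F0 in auto)
        moreover have "\<epsilon> * (32 * pi\<^sup>2 * L * F0) \<le> \<epsilon> * (32 * pi\<^sup>2 * (L+1) * F0)"
          using e L(1) F0(1) by (intro mult_left_mono mult_right_mono) auto
        ultimately show ?thesis by (simp add: mult_ac)
      qed
      have "continuous_on (UNIV \<times> {c0 - \<eta>/2..c0 + \<eta>/2}) (\<lambda>z. (\<lambda>z. f (fst (fst z)) (snd (fst z)) (snd z)) ((\<epsilon>, fst z), snd z))"
        by (rule continuous_on_compose2[OF contf]) (use e1 \<eta> in \<open>auto intro!: continuous_intros\<close>)
      then have cont: "continuous_on (UNIV \<times> {c0 - \<eta>/2..c0 + \<eta>/2}) (\<lambda>z. f \<epsilon> (fst z) (snd z))" by simp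
      have q2: "\<eta>/2/2 = q" by (simp add: q_def)
      have bnd: "\<bar>f \<epsilon> \<theta> r\<bar> \<le> F0" if r: "\<bar>r - c0\<bar> \<le> \<eta>/2" for \<theta> r
        by (rule F0(2)[OF e1 inJ]) (use r \<eta>(1) in linarith)
      have lip': "\<bar>f \<epsilon> \<theta> r - f \<epsilon> \<theta> r'\<bar> \<le> L * \<bar>r - r'\<bar>"
        if r: "\<bar>r - c0\<bar> \<le> \<eta>/2" "\<bar>r' - c0\<bar> \<le> \<eta>/2" for \<theta> r r'
        by (rule lip[OF e1]) (use r \<eta>(1) in linarith)+
      have up': "8 * pi\<^sup>2 * \<epsilon> * L * F0 \<le> \<sigma> * integral {0..2*pi} (\<lambda>\<theta>. f \<epsilon> \<theta> (c0 + \<eta>/2/2))"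
        unfolding q2 using up[OF e1 sm(2,3)] s3 by linarith
      have down': "\<sigma> * integral {0..2*pi} (\<lambda>\<theta>. f \<epsilon> \<theta> (c0 - \<eta>/2/2)) \<le> - (8 * pi\<^sup>2 * \<epsilon> * L * F0)"
        unfolding q2 using down[OF e1 sm(2,3)] s3 by linarith
      have "0 < \<eta>/2" using \<eta>(1) by simp
      then obtain h where h: "\<And>\<theta>. (h has_real_derivative \<epsilon> * f \<epsilon> \<theta> (h \<theta>)) (at \<theta>)"
          "\<And>\<theta>. h (\<theta> + 2*pi) = h \<theta>" "\<And>\<theta>. \<bar>h \<theta> - c0\<bar> \<le> \<eta>/2"
        using periodic_solution_exists[OF cont per bnd lip' L(1) _ e(1) s1 s2 \<sigma>(1) up' down'] by metis
      have "\<bar>h \<theta> - c0\<bar> < \<eta>" for \<theta> using h(3)[of \<theta>] \<eta>(1) by linarith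
      with h(1,2) show ?thesis by blast
    qed
  qed (use \<eta> \<epsilon>0 \<sigma>(1) contk perk intk \<Lambda> in auto)
qed

end

section \<open>A chart adapted to the unperturbed system\<close>

text \<open>The angle is the primitive of the angular velocity \<open>C * S' - S * C'\<close>,
  started at a suitable value. The inner product of \<open>(C, S)\<close> with
  \<open>(cos \<theta>, sin \<theta>)\<close> is then constantly \<open>1\<close>, and unit vectors
  with inner product \<open>1\<close> coincide. The one-point parameter set turns
  \<open>C1_on\<close> into plain continuous differentiability.\<close>

lemma angle_lift:
  fixes S C :: "real \<Rightarrow> real"
  assumes S: "C1_on {0::real} UNIV (\<lambda>_. S)" and C: "C1_on {0::real} UNIV (\<lambda>_. C)"
    and unit: "\<And>t. (S t)\<^sup>2 + (C t)\<^sup>2 = 1"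
  obtains \<theta> \<theta>' where "\<And>t. (\<theta> has_real_derivative \<theta>' t) (at t)" "\<And>t. S t = sin (\<theta> t)" "\<And>t. C t = cos (\<theta> t)"
proof -
  have *: "\<exists>h'. continuous_on UNIV h' \<and> (\<forall>t. (h has_real_derivative h' t) (at t))"
    if C1: "C1_on {0::real} UNIV (\<lambda>_. h)" for h
  proof -
    obtain h' where h': "C1_deriv {0::real} UNIV (\<lambda>_. h) h'" using C1 by (auto simp: C1_on_def)
    have "continuous_on UNIV (\<lambda>t. (\<lambda>z. h' (fst z) (snd z)) (0, t))"
      by (rule continuous_on_compose2[of "{0} \<times> UNIV"]) (use h' in \<open>auto simp: C1_deriv_def intro!: continuous_intros\<close>)
    then show ?thesis using h' by (intro exI[of _ "h' 0"]) (auto simp: C1_deriv_def)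
  qed
  obtain S' where S': "continuous_on UNIV S'" "\<And>t. (S has_real_derivative S' t) (at t)" using *[OF S] by blast
  obtain C' where C': "continuous_on UNIV C'" "\<And>t. (C has_real_derivative C' t) (at t)" using *[OF C] by blast
  have cont: "continuous_on UNIV S" "continuous_on UNIV C"
    using derivative_imp_continuous_on[OF S'(2)] derivative_imp_continuous_on[OF C'(2)] by auto
  define \<Theta> where "\<Theta> t = C t * S' t - S t * C' t" for t
  have cont\<Theta>: "continuous_on UNIV \<Theta>" unfolding \<Theta>_def by (intro continuous_intros cont S'(1) C'(1))
  have orth: "S t * S' t + C t * C' t = 0" for t
  proof -
    have "((\<lambda>t. (S t)\<^sup>2 + (C t)\<^sup>2) has_real_derivative 2 * S t * S' t + 2 * C t * C' t) (at t)"
      by (auto intro!: derivative_eq_intros S'(2) C'(2))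
    moreover have "((\<lambda>t. (S t)\<^sup>2 + (C t)\<^sup>2) has_real_derivative 0) (at t)" by (simp add: unit)
    ultimately have "2 * S t * S' t + 2 * C t * C' t = 0" by (rule DERIV_unique)
    then show ?thesis by simp
  qed
  have eqs: "S' t = C t * \<Theta> t" "C' t = - S t * \<Theta> t" for t
    using unit[of t] orth[of t] unfolding \<Theta>_def by algebra+
  obtain \<theta>0 where \<theta>0: "C 0 = cos \<theta>0" "S 0 = sin \<theta>0"
    using sincos_total_2pi[of "C 0" "S 0"] unit[of 0] by (metis add.commute)
  define \<theta> where "\<theta> t = \<theta>0 + primitive \<Theta> t" for t
  have d\<theta>: "(\<theta> has_real_derivative \<Theta> t) (at t)" for t
    unfolding \<theta>_def using primitive_has_derivative[OF cont\<Theta>] by (auto intro!: derivative_eq_intros)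
  have "((\<lambda>t. C t * cos (\<theta> t) + S t * sin (\<theta> t)) has_real_derivative 0) (at t)" for t
  proof -
    have "((\<lambda>t. C t * cos (\<theta> t) + S t * sin (\<theta> t)) has_real_derivative
       (C' t * cos (\<theta> t) + (- sin (\<theta> t) * \<Theta> t) * C t) + (S' t * sin (\<theta> t) + (cos (\<theta> t) * \<Theta> t) * S t)) (at t)"
      by (intro DERIV_add DERIV_mult C'(2) S'(2) DERIV_chain2[OF DERIV_cos d\<theta>] DERIV_chain2[OF DERIV_sin d\<theta>])
    then show ?thesis by (simp add: eqs algebra_simps)
  qed
  from real_derivative_zero_const[OF this, of _ 0]
  have inner: "C t * cos (\<theta> t) + S t * sin (\<theta> t) = 1" for t
    using \<theta>0 by (simp add: \<theta>_def flip: power2_eq_square)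
  have "(C t - cos (\<theta> t))\<^sup>2 + (S t - sin (\<theta> t))\<^sup>2 = 0" for t
    using inner[of t] unit[of t] sin_cos_squared_add[of "\<theta> t"] unfolding power2_diff by linarith
  then have "S t = sin (\<theta> t)" "C t = cos (\<theta> t)" for t
    by (auto simp: sum_power2_eq_zero_iff)
  with d\<theta> show ?thesis using that by blast
qed

text \<open>With \<open>m = v + v\<^sup>2/2\<close> and \<open>w = m + a u\<^sup>2\<close> the Hamiltonian is exactly \<open>w\<^sup>2/2 + b\<^sup>4 u\<^sup>4\<close>, with
  \<open>a = 4 h20 - 2 h11\<^sup>2\<close> and \<open>b\<^sup>4 = -8 (h20\<^sup>2 + h40)\<close>. Its level curves are parametrised by
  \<open>b u = r sin \<theta>\<close>, \<open>w = r\<^sup>2 Y \<theta>\<close> with \<open>Y\<^sup>2/2 + sin\<^sup>4 \<theta> = 1\<close>; below, \<open>S\<close> is \<open>1 + v\<close>, and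
  \<open>U1, U2, V1, V2\<close> are the partial derivatives of \<open>U\<close> and \<open>V\<close>. The bound on \<^term>\<open>R\<close> keeps
  the radicand in \<open>S\<close> at least \<open>1/2\<close>.\<close>

locale quartic_chart =
  fixes a b R :: real
  assumes b: "b > 0" and R: "R > 0" "4 * R\<^sup>2 * (2 + \<bar>a\<bar> / b\<^sup>2) \<le> 1"
begin

definition Q where "Q \<theta> = sqrt (1 + (sin \<theta>)\<^sup>2)"
text \<open>A smooth square root: \<open>2 * (1 - sin^4)\<close> factors as
  \<open>2 * cos^2 * (1 + sin^2)\<close>, and taking \<open>cos\<close> out with its sign avoids a
  corner where it vanishes.\<close>

definition Y where "Y \<theta> = sqrt 2 * cos \<theta> * Q \<theta>"
definition Y' where "Y' \<theta> = sqrt 2 * (- sin \<theta> * Q \<theta> + cos \<theta> * (sin \<theta> * cos \<theta> / Q \<theta>))"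
definition \<mu> where "\<mu> \<theta> = Y \<theta> - a * (sin \<theta> / b)\<^sup>2"
definition \<mu>' where "\<mu>' \<theta> = Y' \<theta> - 2 * a * sin \<theta> * cos \<theta> / b\<^sup>2"
definition S where "S \<theta> r = sqrt (1 + 2 * (r\<^sup>2 * \<mu> \<theta>))"
definition U where "U \<theta> r = r * (sin \<theta> / b)"
definition V where "V \<theta> r = S \<theta> r - 1"
definition U1 where "U1 \<theta> r = r * (cos \<theta> / b)"
definition U2 where "U2 \<theta> (r::real) = sin \<theta> / b"
definition V1 where "V1 \<theta> r = r\<^sup>2 * \<mu>' \<theta> / S \<theta> r"
definition V2 where "V2 \<theta> r = 2 * r * \<mu> \<theta> / S \<theta> r"

lemma Q_pos: "Q \<theta> > 0" and Q_sq: "(Q \<theta>)\<^sup>2 = 1 + (sin \<theta>)\<^sup>2"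
proof -
  have "1 + (sin \<theta>)\<^sup>2 > 0" using zero_le_power2[of "sin \<theta>"] by linarith
  then show "Q \<theta> > 0" "(Q \<theta>)\<^sup>2 = 1 + (sin \<theta>)\<^sup>2" by (simp_all add: Q_def)
qed

lemma Y_sq: "(Y \<theta>)\<^sup>2 = 2 * (1 - sin \<theta> ^ 4)"
proof -
  have "(Y \<theta>)\<^sup>2 = 2 * (cos \<theta>)\<^sup>2 * (Q \<theta>)\<^sup>2" by (simp add: Y_def power_mult_distrib)
  also have "\<dots> = 2 * (1 - sin \<theta> ^ 4)" unfolding Q_sq cos_squared_eq by algebra
  finally show ?thesis .
qed

lemma chart_periodic: "Q (\<theta> + 2*pi) = Q \<theta>" "Y (\<theta> + 2*pi) = Y \<theta>" "Y' (\<theta> + 2*pi) = Y' \<theta>"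
  "\<mu> (\<theta> + 2*pi) = \<mu> \<theta>" "\<mu>' (\<theta> + 2*pi) = \<mu>' \<theta>" "S (\<theta> + 2*pi) r = S \<theta> r"
  "U (\<theta> + 2*pi) r = U \<theta> r" "V (\<theta> + 2*pi) r = V \<theta> r" "U1 (\<theta> + 2*pi) r = U1 \<theta> r" "U2 (\<theta> + 2*pi) r = U2 \<theta> r"
  "V1 (\<theta> + 2*pi) r = V1 \<theta> r" "V2 (\<theta> + 2*pi) r = V2 \<theta> r"
  by (simp_all add: Q_def Y_def Y'_def \<mu>_def \<mu>'_def S_def U_def V_def U1_def U2_def V1_def V2_def)

lemma mu_bound: "\<bar>\<mu> \<theta>\<bar> \<le> 2 + \<bar>a\<bar> / b\<^sup>2"
proof -
  have gen: "2 * (1 - x) \<le> 4" if "x \<ge> 0" for x :: real using that by simp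
  have "sin \<theta> ^ 4 \<ge> 0" by simp
  then have "(Y \<theta>)\<^sup>2 \<le> 4" 
    unfolding Y_sq using gen[of "sin \<theta> ^ 4"] by blast
  then have "\<bar>Y \<theta>\<bar> \<le> 2" using abs_le_square_iff[of "Y \<theta>" 2] by simp
  moreover have "\<bar>a * (sin \<theta> / b)\<^sup>2\<bar> \<le> \<bar>a\<bar> / b\<^sup>2"
  proof -
    have "(sin \<theta>)\<^sup>2 \<le> 1" by (simp add: abs_square_le_1)
    then have "\<bar>a\<bar> * (sin \<theta>)\<^sup>2 / b\<^sup>2 \<le> \<bar>a\<bar> * 1 / b\<^sup>2" by (intro divide_right_mono mult_left_mono) auto
    then show ?thesis by (simp add: abs_mult power_divide)
  qed
  ultimately show ?thesis unfolding \<mu>_def by linarith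
qed

lemma radicand: "0 \<le> r \<Longrightarrow> r \<le> R \<Longrightarrow> \<bar>r\<^sup>2 * \<mu> \<theta>\<bar> \<le> 1/4"
proof -
  assume "0 \<le> r" "r \<le> R"
  then have "r\<^sup>2 * \<bar>\<mu> \<theta>\<bar> \<le> R\<^sup>2 * (2 + \<bar>a\<bar> / b\<^sup>2)" using mu_bound by (intro mult_mono) auto
  then show ?thesis using R(2) by (simp add: abs_mult)
qed

lemma radicand_pos: "0 \<le> r \<Longrightarrow> r \<le> R \<Longrightarrow> 1 + 2 * (r\<^sup>2 * \<mu> \<theta>) > 0"
  using radicand[of r \<theta>] by (simp add: abs_le_iff)

lemma S_pos: "0 \<le> r \<Longrightarrow> r \<le> R \<Longrightarrow> S \<theta> r > 0"
  and S_sq: "0 \<le> r \<Longrightarrow> r \<le> R \<Longrightarrow> (S \<theta> r)\<^sup>2 = 1 + 2 * (r\<^sup>2 * \<mu> \<theta>)"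
  using radicand_pos[of r \<theta>] by (simp_all add: S_def)

lemma DERIV_Q: "(Q has_real_derivative sin \<theta> * cos \<theta> / Q \<theta>) (at \<theta>)"
proof -
  have "1 + (sin \<theta>)\<^sup>2 > 0" using zero_le_power2[of "sin \<theta>"] by linarith
  then have "((\<lambda>\<theta>. sqrt (1 + (sin \<theta>)\<^sup>2)) has_real_derivative inverse (sqrt (1 + (sin \<theta>)\<^sup>2)) / 2 * (2 * sin \<theta> * cos \<theta>)) (at \<theta>)"
    by (intro DERIV_chain2[OF DERIV_real_sqrt]) (auto intro!: derivative_eq_intros)
  then show ?thesis unfolding Q_def[abs_def] by (simp add: field_simps)
qed

lemma DERIV_Y: "(Y has_real_derivative Y' \<theta>) (at \<theta>)"
  unfolding Y_def[abs_def] Y'_def using DERIV_Q by (auto intro!: derivative_eq_intros simp: algebra_simps)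

lemma DERIV_mu: "(\<mu> has_real_derivative \<mu>' \<theta>) (at \<theta>)"
  unfolding \<mu>_def[abs_def] \<mu>'_def using DERIV_Y b
  by (auto intro!: derivative_eq_intros simp: power_divide power2_eq_square)

lemma has_derivative_U:
  "((\<lambda>z. U (fst z) (snd z)) has_derivative (\<lambda>h. U1 \<theta> r * fst h + U2 \<theta> r * snd h)) (at (\<theta>, r))"
  unfolding U_def U1_def U2_def using b
  by (auto intro!: derivative_eq_intros simp: field_simps fun_eq_iff)

lemma has_derivative_V:
  assumes r: "0 \<le> r" "r \<le> R"
  shows "((\<lambda>z. V (fst z) (snd z)) has_derivative (\<lambda>h. V1 \<theta> r * fst h + V2 \<theta> r * snd h)) (at (\<theta>, r))"
proof -
  have m: "((\<lambda>z. \<mu> (fst z)) has_derivative (\<lambda>h. \<mu>' \<theta> * fst h)) (at (\<theta>, r))"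
    using has_derivative_compose[OF has_derivative_fst[OF has_derivative_ident] DERIV_mu[unfolded has_field_derivative_def], of "(\<theta>, r)"]
    by simp
  have sq: "((\<lambda>z. (snd z)\<^sup>2) has_derivative (\<lambda>h. 2 * r * snd h)) (at (\<theta>, r))"
    by (auto intro!: derivative_eq_intros)
  have "((\<lambda>z. 1 + 2 * ((snd z)\<^sup>2 * \<mu> (fst z))) has_derivative
      (\<lambda>h. 0 + 2 * ((snd (\<theta>, r))\<^sup>2 * (\<mu>' \<theta> * fst h) + 2 * r * snd h * \<mu> (fst (\<theta>, r))))) (at (\<theta>, r))"
    by (intro has_derivative_add has_derivative_const has_derivative_mult_right has_derivative_mult[OF sq m])
  then have "((\<lambda>z. 1 + 2 * ((snd z)\<^sup>2 * \<mu> (fst z))) has_derivative (\<lambda>h. 2 * (r\<^sup>2 * (\<mu>' \<theta> * fst h) + 2 * r * snd h * \<mu> \<theta>))) (at (\<theta>, r))"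
    by simp
  moreover have "(sqrt has_derivative (*) (inverse (S \<theta> r) / 2)) (at (1 + 2 * ((snd (\<theta>, r))\<^sup>2 * \<mu> (fst (\<theta>, r)))))"
    using DERIV_real_sqrt[OF radicand_pos[OF r, of \<theta>]] by (simp add: has_field_derivative_def S_def)
  ultimately have "((\<lambda>z. sqrt (1 + 2 * ((snd z)\<^sup>2 * \<mu> (fst z)))) has_derivative
      (\<lambda>h. inverse (S \<theta> r) / 2 * (2 * (r\<^sup>2 * (\<mu>' \<theta> * fst h) + 2 * r * snd h * \<mu> \<theta>)))) (at (\<theta>, r))"
    by (rule has_derivative_compose)
  from has_derivative_diff[OF this has_derivative_const[of 1]]
  have "((\<lambda>z. V (fst z) (snd z)) has_derivative
      (\<lambda>h. inverse (S \<theta> r) / 2 * (2 * (r\<^sup>2 * (\<mu>' \<theta> * fst h) + 2 * r * snd h * \<mu> \<theta>)))) (at (\<theta>, r))"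
    unfolding V_def S_def by (simp only: diff_zero)
  moreover have "(\<lambda>h. inverse (S \<theta> r) / 2 * (2 * (r\<^sup>2 * (\<mu>' \<theta> * fst h) + 2 * r * snd h * \<mu> \<theta>)))
      = (\<lambda>h. V1 \<theta> r * fst h + V2 \<theta> r * snd h)"
    using S_pos[OF r, of \<theta>] by (simp add: V1_def V2_def fun_eq_iff field_simps)
  ultimately show ?thesis by simp
qed

text \<open>In the determinant the terms containing \<open>a\<close> cancel and the remaining
  trigonometric factor is constant, so it is positive for \<open>r > 0\<close>.\<close>

lemma jacobian:
  assumes r: "0 \<le> r" "r \<le> R"
  shows "U1 \<theta> r * V2 \<theta> r - V1 \<theta> r * U2 \<theta> r = 2 * sqrt 2 * r\<^sup>2 / (b * S \<theta> r * Q \<theta>)"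
proof -
  have "2 * cos \<theta> * \<mu> \<theta> - sin \<theta> * \<mu>' \<theta> = sqrt 2 * (2 * (cos \<theta>)\<^sup>2 * (Q \<theta>)\<^sup>2 + (sin \<theta>)\<^sup>2 * (Q \<theta>)\<^sup>2 - (sin \<theta>)\<^sup>2 * (cos \<theta>)\<^sup>2) / Q \<theta>"
    using Q_pos[of \<theta>] b by (simp add: \<mu>_def \<mu>'_def Y_def Y'_def field_simps power2_eq_square)
  also have "2 * (cos \<theta>)\<^sup>2 * (Q \<theta>)\<^sup>2 + (sin \<theta>)\<^sup>2 * (Q \<theta>)\<^sup>2 - (sin \<theta>)\<^sup>2 * (cos \<theta>)\<^sup>2 = 2"
  proof -
    have "2 * (1 - x) * (1 + x) + x * (1 + x) - x * (1 - x) = 2" for x :: real by (simp add: algebra_simps)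
    then show ?thesis unfolding Q_sq cos_squared_eq .
  qed
  finally have *: "2 * cos \<theta> * \<mu> \<theta> - sin \<theta> * \<mu>' \<theta> = 2 * sqrt 2 / Q \<theta>" by simp
  have "U1 \<theta> r * V2 \<theta> r - V1 \<theta> r * U2 \<theta> r = r\<^sup>2 / (b * S \<theta> r) * (2 * cos \<theta> * \<mu> \<theta> - sin \<theta> * \<mu>' \<theta>)"
    using S_pos[OF r, of \<theta>] b by (simp add: U1_def U2_def V1_def V2_def field_simps power2_eq_square)
  also have "\<dots> = 2 * sqrt 2 * r\<^sup>2 / (b * S \<theta> r * Q \<theta>)" unfolding * by simp
  finally show ?thesis .
qed

section \<open>The Hamiltonian and its gradient in the chart\<close>

definition W where "W u v = v + v\<^sup>2/2 + a * u\<^sup>2"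
definition H where "H u v = (W u v)\<^sup>2/2 + b^4 * u^4"
definition Hu where "Hu u v = 4 * b^4 * u^3 + 2 * a * u * W u v"
definition Hv where "Hv u v = W u v * (1 + v)"

lemma W_chart:
  assumes r: "0 \<le> r" "r \<le> R"
  shows "W (U \<theta> r) (V \<theta> r) = r\<^sup>2 * Y \<theta>"
proof -
  have "V \<theta> r + (V \<theta> r)\<^sup>2/2 = ((S \<theta> r)\<^sup>2 - 1)/2" by (simp add: V_def power2_eq_square field_simps)
  also have "\<dots> = r\<^sup>2 * \<mu> \<theta>" by (simp add: S_sq[OF r])
  finally show ?thesis by (simp add: W_def U_def \<mu>_def power_mult_distrib power_divide algebra_simps)
qed

lemma H_chart:
  assumes r: "0 \<le> r" "r \<le> R"
  shows "H (U \<theta> r) (V \<theta> r) = r ^ 4"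
proof -
  have "H (U \<theta> r) (V \<theta> r) = r^4 * ((Y \<theta>)\<^sup>2/2 + sin \<theta> ^ 4)"
    unfolding H_def W_chart[OF r] using b by (simp add: U_def power_mult_distrib power_divide algebra_simps)
  moreover have "2 * (1 - x) / 2 + x = 1" for x :: real by (simp add: field_simps)
  ultimately show ?thesis unfolding Y_sq by simp
qed

text \<open>These are the derivatives of the identity \<open>H_chart\<close> in
  \<open>\<theta>\<close> and in \<open>r\<close>, checked algebraically with the derivative of
  \<open>Y_sq\<close>.\<close>

lemma H_tangential:
  assumes r: "0 \<le> r" "r \<le> R"
  shows "Hu (U \<theta> r) (V \<theta> r) * U1 \<theta> r + Hv (U \<theta> r) (V \<theta> r) * V1 \<theta> r = 0"
    and "Hu (U \<theta> r) (V \<theta> r) * U2 \<theta> r + Hv (U \<theta> r) (V \<theta> r) * V2 \<theta> r = 4 * r ^ 3"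
proof -
  have YY: "Y \<theta> * Y' \<theta> = - 4 * sin \<theta> ^ 3 * cos \<theta>"
  proof -
    have "((\<lambda>\<theta>. Y \<theta> ^ 2) has_real_derivative of_nat 2 * (Y' \<theta> * Y \<theta> ^ (2 - Suc 0))) (at \<theta>)"
      by (intro DERIV_power DERIV_Y)
    moreover have "((\<lambda>\<theta>. 2 * (1 - sin \<theta> ^ 4)) has_real_derivative 2 * (0 - of_nat 4 * (cos \<theta> * sin \<theta> ^ (4 - Suc 0)))) (at \<theta>)"
      by (intro DERIV_cmult DERIV_diff DERIV_const DERIV_power DERIV_sin)
    ultimately have "of_nat 2 * (Y' \<theta> * Y \<theta> ^ (2 - Suc 0)) = 2 * (0 - of_nat 4 * (cos \<theta> * sin \<theta> ^ (4 - Suc 0)))"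
      unfolding Y_sq by (rule DERIV_unique)
    then show ?thesis by (simp add: mult.commute)
  qed
  have s: "S \<theta> r > 0" by (rule S_pos[OF r])
  define x c where "x = sin \<theta> / b" and "c = cos \<theta> / b"
  have sc: "sin \<theta> = b * x" "cos \<theta> = b * c" using b by (auto simp: x_def c_def)
  have Hv: "Hv (U \<theta> r) (V \<theta> r) = r\<^sup>2 * Y \<theta> * S \<theta> r" unfolding Hv_def W_chart[OF r] by (simp add: V_def)
  have Hu: "Hu (U \<theta> r) (V \<theta> r) = 4 * b^4 * (r * x)^3 + 2 * a * (r * x) * (r\<^sup>2 * Y \<theta>)"
    unfolding Hu_def W_chart[OF r] by (simp add: U_def x_def)
  have 1: "Hv (U \<theta> r) (V \<theta> r) * V1 \<theta> r = r\<^sup>2 * Y \<theta> * (r\<^sup>2 * (Y' \<theta> - 2 * a * x * c))"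
    unfolding Hv V1_def \<mu>'_def using s by (simp add: x_def c_def power2_eq_square)
  have 2: "Hv (U \<theta> r) (V \<theta> r) * V2 \<theta> r = r\<^sup>2 * Y \<theta> * (2 * r * (Y \<theta> - a * x\<^sup>2))"
    unfolding Hv V2_def \<mu>_def using s by (simp add: x_def)
  have "Hu (U \<theta> r) (V \<theta> r) * U1 \<theta> r + Hv (U \<theta> r) (V \<theta> r) * V1 \<theta> r
      = r^4 * (4 * (b * x) ^ 3 * (b * c) + Y \<theta> * Y' \<theta>)"
    unfolding 1 unfolding Hu U1_def c_def[symmetric] by algebra
  then show "Hu (U \<theta> r) (V \<theta> r) * U1 \<theta> r + Hv (U \<theta> r) (V \<theta> r) * V1 \<theta> r = 0" by (simp add: YY flip: sc)
  have "Hu (U \<theta> r) (V \<theta> r) * U2 \<theta> r + Hv (U \<theta> r) (V \<theta> r) * V2 \<theta> r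
      = r^3 * (4 * (b * x) ^ 4 + 2 * (Y \<theta>)\<^sup>2)"
    unfolding 2 unfolding Hu U2_def x_def[symmetric] by algebra
  then show "Hu (U \<theta> r) (V \<theta> r) * U2 \<theta> r + Hv (U \<theta> r) (V \<theta> r) * V2 \<theta> r = 4 * r ^ 3"
    by (simp add: Y_sq algebra_simps flip: sc)
qed

end

context quartic_chart
begin

lemma continuous_on_trig_parts:
  "continuous_on A Q" "continuous_on A Y" "continuous_on A \<mu>" "continuous_on A \<mu>'"
proof -
  show Q: "continuous_on A Q" for A by (rule derivative_imp_continuous_on[OF DERIV_Q])
  show "continuous_on A Y" by (rule derivative_imp_continuous_on[OF DERIV_Y])
  show "continuous_on A \<mu>" by (rule derivative_imp_continuous_on[OF DERIV_mu])
  show "continuous_on A \<mu>'" unfolding \<mu>'_def Y'_def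
    using Q_pos b by (intro continuous_intros Q) (auto simp: less_imp_neq[THEN not_sym])
qed

text \<open>The angle enters as a function \<open>t\<close> of the parameter, so that pairs such as
  \<open>(\<epsilon>, \<theta>)\<close> are covered by \<open>t = snd\<close>.\<close>

lemma C1_chart:
  fixes t :: "'a::t2_space \<Rightarrow> real"
  assumes t: "continuous_on K t" and J: "J \<subseteq> {0..R}"
  shows "C1_on K J (\<lambda>x r. S (t x) r)" "C1_on K J (\<lambda>x r. U (t x) r)" "C1_on K J (\<lambda>x r. V (t x) r)"
    "C1_on K J (\<lambda>x r. U1 (t x) r)" "C1_on K J (\<lambda>x r. U2 (t x) r)"
    "C1_on K J (\<lambda>x r. V1 (t x) r)" "C1_on K J (\<lambda>x r. V2 (t x) r)"
proof -
  have \<mu>: "continuous_on K (\<lambda>x. \<mu> (t x))" and \<mu>': "continuous_on K (\<lambda>x. \<mu>' (t x))"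
    using continuous_on_compose[OF t, of \<mu>] continuous_on_compose[OF t, of \<mu>'] continuous_on_trig_parts(3,4)
    by (simp_all add: o_def)
  have sc: "continuous_on K (\<lambda>x. sin (t x) / b)" "continuous_on K (\<lambda>x. cos (t x) / b)"
    using b by (auto intro!: continuous_on_divide continuous_on_sin continuous_on_cos continuous_on_const t)
  have r: "0 \<le> r" "r \<le> R" if "r \<in> J" for r using that J by auto
  show S: "C1_on K J (\<lambda>x r. S (t x) r)" unfolding S_def
    by (intro C1_intros \<mu>) (use radicand_pos r in auto)
  have Sn: "S (t x) r \<noteq> 0" if "r \<in> J" for x r using S_pos[OF r[OF that]] by (metis less_irrefl)
  show "C1_on K J (\<lambda>x r. U (t x) r)" unfolding U_def
    by (intro C1_on_mult C1_on_id C1_on_param sc)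
  show "C1_on K J (\<lambda>x r. V (t x) r)" unfolding V_def by (intro C1_on_diff C1_on_const S)
  show "C1_on K J (\<lambda>x r. U1 (t x) r)" unfolding U1_def
    by (intro C1_on_mult C1_on_id C1_on_param sc)
  show "C1_on K J (\<lambda>x r. U2 (t x) r)" unfolding U2_def
    by (intro C1_on_param sc)
  show "C1_on K J (\<lambda>x r. V1 (t x) r)" unfolding V1_def
    by (intro C1_on_divide C1_on_mult C1_on_power C1_on_id C1_on_param \<mu>' S Sn)
  show "C1_on K J (\<lambda>x r. V2 (t x) r)" unfolding V2_def
    by (intro C1_on_divide C1_on_mult C1_on_const C1_on_id C1_on_param \<mu> S Sn)
qed

end

section \<open>The perturbed system in chart coordinates\<close>

lemma C1_on_poly3:
  assumes "C1_on K J f" "C1_on K J g"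
  shows "C1_on K J (\<lambda>x r. poly3 c (f x r) (g x r))"
  unfolding poly3_def by (intro C1_on_sum C1_on_mult C1_on_power C1_on_const assms)

lemma continuous_on_poly3:
  "continuous_on A f \<Longrightarrow> continuous_on A g \<Longrightarrow> continuous_on A (\<lambda>x. poly3 c (f x) (g x))"
  unfolding poly3_def by (intro continuous_intros)

locale perturbed_chart = quartic_chart +
  fixes pc qc :: "nat \<Rightarrow> nat \<Rightarrow> real"
begin

definition pert_field where "pert_field \<epsilon> z = (Hv (fst z) (snd z) + \<epsilon> * poly3 pc (fst z) (snd z), - Hu (fst z) (snd z) + \<epsilon> * poly3 qc (fst z) (snd z))"
text \<open>Cramer's rule in the frame of the chart, together with \<open>H_tangential\<close>,
  gives angular speed \<open>den / D\<close> and radial speed \<open>\<epsilon> * flux / D\<close>.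
  Hence \<open>\<tau>\<close> is the former and \<open>\<epsilon> * f\<close> is
  \<open>dr/d\<theta>\<close>. \<open>flux\<close> is the one-form \<open>q du - p dv\<close> pulled
  back to a level curve; its integral is the Melnikov function.\<close>

definition flux where "flux \<theta> r = poly3 qc (U \<theta> r) (V \<theta> r) * U1 \<theta> r - poly3 pc (U \<theta> r) (V \<theta> r) * V1 \<theta> r"
definition drift where "drift \<theta> r = poly3 pc (U \<theta> r) (V \<theta> r) * V2 \<theta> r - poly3 qc (U \<theta> r) (V \<theta> r) * U2 \<theta> r"
definition den where "den \<epsilon> \<theta> r = 4 * r^3 + \<epsilon> * drift \<theta> r"
definition f where "f \<epsilon> \<theta> r = flux \<theta> r / den \<epsilon> \<theta> r"
definition D where "D \<theta> r = U1 \<theta> r * V2 \<theta> r - V1 \<theta> r * U2 \<theta> r"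
definition \<tau> where "\<tau> \<epsilon> \<theta> r = den \<epsilon> \<theta> r / D \<theta> r"

lemma D_pos: "0 < r \<Longrightarrow> r \<le> R \<Longrightarrow> D \<theta> r > 0"
  using jacobian[of r \<theta>] S_pos[of r \<theta>] Q_pos[of \<theta>] b by (simp add: D_def)

lemma pert_field_chart:
  assumes r: "0 < r" "r \<le> R" and den: "den \<epsilon> \<theta> r \<noteq> 0"
  shows "pert_field \<epsilon> (U \<theta> r, V \<theta> r) =
     (\<tau> \<epsilon> \<theta> r * (U1 \<theta> r + (\<epsilon> * f \<epsilon> \<theta> r) * U2 \<theta> r), \<tau> \<epsilon> \<theta> r * (V1 \<theta> r + (\<epsilon> * f \<epsilon> \<theta> r) * V2 \<theta> r))"
proof -
  have r0: "0 \<le> r" using r by simp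
  have D: "D \<theta> r \<noteq> 0" using D_pos[OF r] by (metis less_irrefl)
  define u1 u2 v1 v2 hu hv P q where "u1 = U1 \<theta> r" and "u2 = U2 \<theta> r" and "v1 = V1 \<theta> r" and "v2 = V2 \<theta> r"
    and "hu = Hu (U \<theta> r) (V \<theta> r)" and "hv = Hv (U \<theta> r) (V \<theta> r)"
    and "P = poly3 pc (U \<theta> r) (V \<theta> r)" and "q = poly3 qc (U \<theta> r) (V \<theta> r)"
  note defs = this
  have t: "hu * u1 + hv * v1 = 0" "hu * u2 + hv * v2 = 4 * r^3"
    using H_tangential[OF r0 r(2), of \<theta>] by (simp_all add: defs)
  have \<tau>f: "\<tau> \<epsilon> \<theta> r * (x + (\<epsilon> * f \<epsilon> \<theta> r) * y) = (den \<epsilon> \<theta> r * x + \<epsilon> * flux \<theta> r * y) / D \<theta> r" for x y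
  proof -
    have "den \<epsilon> \<theta> r * (x + (\<epsilon> * f \<epsilon> \<theta> r) * y) = den \<epsilon> \<theta> r * x + \<epsilon> * flux \<theta> r * y"
      using den by (simp add: f_def distrib_left)
    then show ?thesis by (simp add: \<tau>_def)
  qed
  have d: "den \<epsilon> \<theta> r = hu * u2 + hv * v2 + \<epsilon> * (P * v2 - q * u2)" "flux \<theta> r = q * u1 - P * v1" "D \<theta> r = u1 * v2 - v1 * u2"
    unfolding t(2) by (simp_all add: den_def drift_def flux_def D_def defs)
  have "den \<epsilon> \<theta> r * u1 + \<epsilon> * flux \<theta> r * u2 = (hv + \<epsilon> * P) * D \<theta> r"
    unfolding d using t(1) by algebra
  moreover have "den \<epsilon> \<theta> r * v1 + \<epsilon> * flux \<theta> r * v2 = (- hu + \<epsilon> * q) * D \<theta> r"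
    unfolding d using t(1) by algebra
  ultimately show ?thesis
    unfolding \<tau>f using D by (simp add: pert_field_def flip: defs)
qed

text \<open>The coordinates are forced: \<open>r\<close> is the fourth root of \<open>H\<close>,
  \<open>b * u / r\<close> must be the sine, and \<open>w\<close> then determines the cosine. The
  level set equation says that these two have square sum \<open>1\<close>, so
  \<open>angle_lift\<close> applies. Positive energy makes all divisions legitimate.\<close>

lemma lift_to_chart:
  assumes x: "is_solution (pert_field \<epsilon>) x" and \<alpha>: "0 \<le> \<alpha>" "\<alpha> < \<beta>"
    and N: "\<And>t. snd (x t) > -1" "\<And>t. \<alpha>^4 < H (fst (x t)) (snd (x t))" "\<And>t. H (fst (x t)) (snd (x t)) < \<beta>^4"
  obtains \<theta> r \<theta>' r' where "\<And>t. (\<theta> has_real_derivative \<theta>' t) (at t)" "\<And>t. (r has_real_derivative r' t) (at t)"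
    "\<And>t. x t = (U (\<theta> t) (r t), V (\<theta> t) (r t))" "\<And>t. \<alpha> \<le> r t" "\<And>t. r t \<le> \<beta>"
proof -
  define u v where "u t = fst (x t)" and "v t = snd (x t)" for t
  define u' v' where "u' t = fst (pert_field \<epsilon> (x t))" and "v' t = snd (pert_field \<epsilon> (x t))" for t
  have du: "(u has_real_derivative u' t) (at t)" and dv: "(v has_real_derivative v' t) (at t)" for t
  proof -
    have dx: "(x has_vector_derivative pert_field \<epsilon> (x t)) (at t)" using x by (simp add: is_solution_def)
    show "(u has_real_derivative u' t) (at t)" "(v has_real_derivative v' t) (at t)"
      using bounded_linear.has_vector_derivative[OF bounded_linear_fst dx]
        bounded_linear.has_vector_derivative[OF bounded_linear_snd dx]
      by (simp_all add: u_def[abs_def] v_def[abs_def] u'_def v'_def has_real_derivative_iff_has_vector_derivative)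
  qed
  have cu: "continuous_on A u" and cv: "continuous_on A v" for A
    using derivative_imp_continuous_on[OF du] derivative_imp_continuous_on[OF dv] by auto
  have cu': "continuous_on A u'" and cv': "continuous_on A v'" for A
  proof -
    have "u' = (\<lambda>t. (v t + (v t)^2/2 + a * (u t)^2) * (1 + v t) + \<epsilon> * poly3 pc (u t) (v t))"
      by (simp add: u'_def u_def v_def pert_field_def Hv_def W_def fun_eq_iff)
    then show "continuous_on A u'" by (auto intro!: continuous_intros continuous_on_poly3 cu cv)
    have "v' = (\<lambda>t. - (4 * b^4 * (u t)^3 + 2 * a * u t * (v t + (v t)^2/2 + a * (u t)^2)) + \<epsilon> * poly3 qc (u t) (v t))"
      by (simp add: v'_def u_def v_def pert_field_def Hu_def W_def fun_eq_iff)
    then show "continuous_on A v'" by (auto intro!: continuous_intros continuous_on_poly3 cu cv)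
  qed
  have snd_comp: "continuous_on ({0::real} \<times> UNIV) (\<lambda>z. h (snd z))" if "continuous_on UNIV h" for h :: "real \<Rightarrow> real"
    by (rule continuous_on_compose2[OF that]) (auto intro!: continuous_intros)
  have C1u: "C1_on {0::real} UNIV (\<lambda>_. u)"
    by (rule C1_onI[of _ _ _ "\<lambda>_. u'"]) (auto simp: C1_deriv_def du intro!: snd_comp cu cu')
  have C1v: "C1_on {0::real} UNIV (\<lambda>_. v)"
    by (rule C1_onI[of _ _ _ "\<lambda>_. v'"]) (auto simp: C1_deriv_def dv intro!: snd_comp cv cv')
  define w where "w t = W (u t) (v t)" for t
  define h where "h t = (w t)^2/2 + b^4 * (u t)^4" for t
  define r where "r t = sqrt (sqrt (h t))" for t
  define s where "s t = b * u t / r t" for t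
  define c where "c t = w t / (sqrt 2 * (r t)^2 * sqrt (1 + (s t)^2))" for t
  have hH: "h t = H (fst (x t)) (snd (x t))" for t by (simp add: h_def w_def H_def u_def v_def)
  have h: "\<alpha>^4 < h t" "h t < \<beta>^4" for t using N by (simp_all add: hH)
  have hpos: "h t > 0" for t using h(1)[of t] zero_le_power[OF \<alpha>(1), of 4] by linarith
  have rpos: "r t > 0" for t using hpos[of t] by (simp add: r_def)
  have r4: "r t ^ 4 = h t" for t
  proof -
    have "r t ^ 4 = ((r t)^2)^2" by simp
    also have "\<dots> = h t" using hpos[of t] by (simp add: r_def)
    finally show ?thesis .
  qed
  have C1w: "C1_on {0::real} UNIV (\<lambda>_ t. w t)" unfolding w_def W_def by (intro C1_intros C1u C1v; simp)
  have C1h: "C1_on {0::real} UNIV (\<lambda>_ t. h t)" unfolding h_def by (intro C1_intros C1u C1w; simp)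
  have C1r: "C1_on {0::real} UNIV (\<lambda>_ t. r t)" unfolding r_def by (intro C1_on_sqrt C1h) (use hpos in auto)
  have C1s: "C1_on {0::real} UNIV (\<lambda>_ t. s t)" unfolding s_def
    by (intro C1_on_divide C1_on_mult C1_on_const C1u C1r) (use rpos in \<open>auto simp: less_imp_neq[THEN not_sym]\<close>)
  have q1: "1 + (s t)^2 > 0" for t using zero_le_power2[of "s t"] by linarith
  have C1c: "C1_on {0::real} UNIV (\<lambda>_ t. c t)" unfolding c_def
    by (intro C1_on_divide C1_on_mult C1_on_const C1_on_power C1_on_sqrt C1_on_add C1w C1r C1s)
       (use rpos q1 in \<open>auto simp: less_imp_neq[THEN not_sym]\<close>)
  have bu: "b * u t = r t * s t" for t using rpos[of t] by (simp add: s_def)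
  have w2: "(w t)^2 = 2 * r t ^ 4 * (1 - s t ^ 4)" for t
  proof -
    have "r t ^ 4 = (w t)^2/2 + (b * u t)^4" unfolding r4 by (simp add: h_def power_mult_distrib)
    then show ?thesis unfolding bu by (simp add: power_mult_distrib algebra_simps)
  qed
  have wc: "w t = sqrt 2 * (r t)^2 * sqrt (1 + (s t)^2) * c t" for t
    using rpos[of t] q1[of t] by (simp add: c_def)
  have unit: "(s t)^2 + (c t)^2 = 1" for t
  proof -
    have "2 * r t ^ 4 * (1 + (s t)^2) * (c t)^2 = (w t)^2"
      unfolding wc[of t] using q1[of t] by (simp add: power_mult_distrib)
    also have "\<dots> = 2 * r t ^ 4 * (1 + (s t)^2) * (1 - (s t)^2)" unfolding w2 by algebra
    finally have "(c t)^2 = 1 - (s t)^2" using rpos[of t] q1[of t] by simp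
    then show ?thesis by simp
  qed
  obtain \<theta> \<theta>' where \<theta>: "\<And>t. (\<theta> has_real_derivative \<theta>' t) (at t)" "\<And>t. s t = sin (\<theta> t)" "\<And>t. c t = cos (\<theta> t)"
    by (rule angle_lift[of s c]) (use C1s C1c unit in auto)
  obtain r' where r': "C1_deriv {0::real} UNIV (\<lambda>_ t. r t) r'" using C1r by (auto simp: C1_on_def)
  show ?thesis
  proof (rule that[of \<theta> \<theta>' r "r' 0"])
    show "(\<theta> has_real_derivative \<theta>' t) (at t)" for t by (rule \<theta>(1))
    show "(r has_real_derivative r' 0 t) (at t)" for t using r' by (simp add: C1_deriv_def)
    show "x t = (U (\<theta> t) (r t), V (\<theta> t) (r t))" for t
    proof -
      have "U (\<theta> t) (r t) = u t" using bu[of t] b by (simp add: U_def \<theta>(2)[symmetric] field_simps)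
      moreover have "V (\<theta> t) (r t) = v t"
      proof -
        have "(r t)^2 * Y (\<theta> t) = w t" unfolding wc[of t] by (simp add: Y_def Q_def \<theta>(2,3)[symmetric])
        moreover have "(r t)^2 * (sin (\<theta> t) / b)^2 = (u t)^2"
          using bu[of t] b by (simp add: \<theta>(2)[symmetric] field_simps flip: power_mult_distrib)
        ultimately have "(r t)^2 * \<mu> (\<theta> t) = w t - a * (u t)^2"
          by (simp add: \<mu>_def right_diff_distrib)
        also have "\<dots> = v t + (v t)^2/2" by (simp add: w_def W_def)
        \<comment> \<open>Both square roots of the radicand solve this; \<open>v > -1\<close>
          selects the one used in the chart.\<close>
        finally have "1 + 2 * ((r t)^2 * \<mu> (\<theta> t)) = (1 + v t)^2" by (simp add: power2_eq_square field_simps)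
        then show ?thesis using N(1)[of t] by (simp add: V_def S_def v_def)
      qed
      ultimately show ?thesis by (simp add: u_def v_def)
    qed
    show "\<alpha> \<le> r t" for t
      using power_less_imp_less_base[of \<alpha> 4 "r t"] h(1)[of t] rpos[of t] r4[of t] by simp
    show "r t \<le> \<beta>" for t
      using power_less_imp_less_base[of "r t" 4 \<beta>] h(2)[of t] \<alpha> r4[of t] by simp
  qed
qed

end

context perturbed_chart
begin

lemma perturbation_periodic: "flux (\<theta> + 2*pi) r = flux \<theta> r" "drift (\<theta> + 2*pi) r = drift \<theta> r" "den \<epsilon> (\<theta> + 2*pi) r = den \<epsilon> \<theta> r"
  "f \<epsilon> (\<theta> + 2*pi) r = f \<epsilon> \<theta> r" "D (\<theta> + 2*pi) r = D \<theta> r" "\<tau> \<epsilon> (\<theta> + 2*pi) r = \<tau> \<epsilon> \<theta> r"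
  by (simp_all add: flux_def drift_def den_def f_def D_def \<tau>_def chart_periodic)

lemma C1_fields:
  fixes t :: "'a::t2_space \<Rightarrow> real"
  assumes t: "continuous_on K t" and J: "J \<subseteq> {0..R}"
  shows "C1_on K J (\<lambda>x r. flux (t x) r)" "C1_on K J (\<lambda>x r. drift (t x) r)" "C1_on K J (\<lambda>x r. D (t x) r)"
  unfolding flux_def drift_def D_def by (intro C1_on_diff C1_on_mult C1_on_poly3 C1_chart[OF t J])+

lemma C1_den:
  fixes t e :: "'a::t2_space \<Rightarrow> real"
  assumes t: "continuous_on K t" and e: "continuous_on K e" and J: "J \<subseteq> {0..R}"
  shows "C1_on K J (\<lambda>x r. den (e x) (t x) r)"
  unfolding den_def by (intro C1_on_add C1_on_mult C1_on_const C1_on_power C1_on_id C1_on_param e C1_fields[OF t J])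

lemma continuous_H: "continuous_on A (\<lambda>z. H (fst z) (snd z))"
  unfolding H_def W_def by (auto intro!: continuous_intros)

text \<open>At \<open>\<epsilon> = 0\<close> the denominator is \<open>4 * r^3\<close>, so the
  averaged function is the Melnikov function divided by it, and \<open>simple\<close> is its
  derivative by differentiation under the integral. \<open>averaged_family\<close> then supplies the
  periodic graph and \<open>annulus_chart\<close> makes it a limit cycle.\<close>

lemma melnikov_cycle:
  assumes \<rho>0: "0 < \<rho>0" "\<rho>0 < R"
    and zero: "integral {0..2*pi} (\<lambda>\<theta>. flux \<theta> \<rho>0 / (4 * \<rho>0^3)) = 0"
    and simple: "((\<lambda>r. integral {0..2*pi} (\<lambda>\<theta>. flux \<theta> r / (4 * r^3))) has_real_derivative m) (at \<rho>0)" "m \<noteq> 0"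
    and \<eta>m: "\<eta>m > 0"
  obtains \<epsilon>0 where "\<epsilon>0 > 0" "\<And>\<epsilon>. 0 < \<epsilon> \<Longrightarrow> \<epsilon> < \<epsilon>0 \<Longrightarrow> \<exists>\<Gamma>. \<Gamma> \<noteq> {} \<and> limit_cycle (pert_field \<epsilon>) \<Gamma> \<and>
    (\<forall>z\<in>\<Gamma>. \<exists>\<theta> r. \<bar>r - \<rho>0\<bar> < \<eta>m \<and> 0 < r \<and> r \<le> R \<and> z = (U \<theta> r, V \<theta> r))"
proof -
  \<comment> \<open>The three bounds keep the band away from the singular point, inside the chart,
    and within the requested distance.\<close>
  define \<eta>0 where "\<eta>0 = min (min (\<rho>0/2) (R - \<rho>0)) \<eta>m"
  have \<eta>0: "0 < \<eta>0" "\<eta>0 \<le> \<rho>0/2" "\<eta>0 \<le> R - \<rho>0" "\<eta>0 \<le> \<eta>m" using \<rho>0 \<eta>m unfolding \<eta>0_def by linarith+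
  let ?J = "{\<rho>0-\<eta>0..\<rho>0+\<eta>0}"
  have J: "?J \<subseteq> {0..R}" using \<eta>0 \<rho>0 by auto
  have Jr: "\<rho>0/2 \<le> r" "r \<le> R" if "r \<in> ?J" for r using that \<eta>0 by auto
  have "continuous_on ({0..2*pi} \<times> ?J) (\<lambda>z. drift (fst z) (snd z))"
    by (rule C1_on_continuous[OF C1_fields(2)[OF continuous_on_id J]])
  then obtain M where M: "M \<ge> 0" "\<And>z. z \<in> {0..2*pi} \<times> ?J \<Longrightarrow> \<bar>drift (fst z) (snd z)\<bar> \<le> M"
    by (rule compact_abs_bound[rotated]) (auto intro: compact_Times)
  have drift: "\<bar>drift \<theta> r\<bar> \<le> M" if "r \<in> ?J" for \<theta> r
  proof -
    obtain y where "y \<in> {0..2*pi}" "drift \<theta> r = drift y r"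
      by (rule periodic_in_period[of "\<lambda>\<theta>. drift \<theta> r" \<theta>]) (auto simp: perturbation_periodic)
    then show ?thesis using M(2)[of "(y, r)"] that by auto
  qed
  \<comment> \<open>On the band \<open>r \<ge> \<rho>0/2\<close>, so up to this size the
    perturbation of \<open>den\<close> is below the unperturbed \<open>4 * r^3\<close>.\<close>
  define \<epsilon>1 where "\<epsilon>1 = (\<rho>0/2)^3 / (M + 1)"
  have \<epsilon>1: "\<epsilon>1 > 0" using \<rho>0 M by (simp add: \<epsilon>1_def)
  have den: "den \<epsilon> \<theta> r > 0" if e: "0 \<le> \<epsilon>" "\<epsilon> \<le> \<epsilon>1" and r: "r \<in> ?J" for \<epsilon> \<theta> r
  proof -
    have "\<bar>\<epsilon> * drift \<theta> r\<bar> \<le> \<epsilon>1 * (M + 1)"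
      unfolding abs_mult using e drift[OF r, of \<theta>] by (intro mult_mono) auto
    also have "\<dots> = (\<rho>0/2)^3" using M(1) by (simp add: \<epsilon>1_def)
    finally have "\<bar>\<epsilon> * drift \<theta> r\<bar> \<le> (\<rho>0/2)^3" .
    moreover have "(\<rho>0/2)^3 \<le> r^3" using Jr[OF r] \<rho>0 by (intro power_mono) auto
    moreover have "(\<rho>0/2)^3 > 0" using \<rho>0 by simp
    ultimately show ?thesis unfolding den_def by linarith
  qed
  let ?K = "{0..\<epsilon>1} \<times> (UNIV :: real set)"
  have cfst: "continuous_on ?K fst" and csnd: "continuous_on ?K snd" by (auto intro!: continuous_intros)
  have "C1_on ?K ?J (\<lambda>x. f (fst x) (snd x))"
    unfolding f_def
    by (intro C1_on_divide C1_fields(1)[OF csnd J] C1_den[OF csnd cfst J])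
       (use den in \<open>force simp: less_imp_neq[THEN not_sym]\<close>)
  then obtain g where g: "C1_deriv ?K ?J (\<lambda>x. f (fst x) (snd x)) g" by (auto simp: C1_on_def)
  define f' where "f' \<epsilon> \<theta> r = g (\<epsilon>, \<theta>) r" for \<epsilon> \<theta> r
  have C1: "C1_deriv ?K ?J (\<lambda>x. f (fst x) (snd x)) (\<lambda>x. f' (fst x) (snd x))" using g by (simp add: f'_def[abs_def])
  have f0: "f 0 \<theta> r = flux \<theta> r / (4 * r^3)" for \<theta> r by (simp add: f_def den_def)
  have slice: "continuous_on ({0..2*pi} \<times> ?J) (\<lambda>z. h 0 (fst z) (snd z))"
    if "continuous_on (?K \<times> ?J) (\<lambda>z. h (fst (fst z)) (snd (fst z)) (snd z))" for h :: "real \<Rightarrow> real \<Rightarrow> real \<Rightarrow> real"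
  proof -
    have "continuous_on ({0..2*pi} \<times> ?J) (\<lambda>z. (\<lambda>z. h (fst (fst z)) (snd (fst z)) (snd z)) ((0, fst z), snd z))"
      by (rule continuous_on_compose2[OF that]) (use \<epsilon>1 in \<open>auto intro!: continuous_intros\<close>)
    then show ?thesis by simp
  qed
  have C10: "C1_deriv {0..2*pi} ?J (f 0) (f' 0)"
    using C1 slice[of f] slice[of f'] \<epsilon>1 by (auto simp: C1_deriv_def)
  have "((\<lambda>r. integral {0..2*pi} (\<lambda>\<theta>. f 0 \<theta> r)) has_real_derivative integral {0..2*pi} (\<lambda>\<theta>. f' 0 \<theta> \<rho>0)) (at \<rho>0)"
    by (rule C1_deriv_integral[OF C10]) (use \<eta>0 in auto)
  then have "m = integral {0..2*pi} (\<lambda>\<theta>. f' 0 \<theta> \<rho>0)"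
    unfolding f0 by (rule DERIV_unique[OF simple(1)])
  with simple(2) have m: "integral {0..2*pi} (\<lambda>\<theta>. f' 0 \<theta> \<rho>0) \<noteq> 0" by simp
  interpret fam: averaged_family f f' \<rho>0 \<eta>0 \<epsilon>1
    using C1 \<epsilon>1 \<eta>0(1) perturbation_periodic(4) zero m by unfold_locales (auto simp: f0)
  obtain \<eta> \<epsilon>0 k \<sigma> where \<eta>: "0 < \<eta>" "\<eta> \<le> \<eta>0" and \<epsilon>0: "0 < \<epsilon>0" "\<epsilon>0 \<le> \<epsilon>1" and \<sigma>: "\<bar>\<sigma>\<bar> = 1"
    and k: "continuous_on UNIV k" "\<And>\<theta>. k (\<theta> + 2*pi) = k \<theta>" "integral {0..2*pi} k > 0"
    and mono: "\<And>\<epsilon> \<theta> r r'. 0 < \<epsilon> \<Longrightarrow> \<epsilon> < \<epsilon>0 \<Longrightarrow> \<bar>r - \<rho>0\<bar> \<le> \<eta> \<Longrightarrow> \<bar>r' - \<rho>0\<bar> \<le> \<eta> \<Longrightarrow>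
       k \<theta> * (r - r')^2 \<le> \<sigma> * ((r - r') * (f \<epsilon> \<theta> r - f \<epsilon> \<theta> r'))"
    and sol: "\<And>\<epsilon>. 0 < \<epsilon> \<Longrightarrow> \<epsilon> < \<epsilon>0 \<Longrightarrow> \<exists>h. (\<forall>\<theta>. (h has_real_derivative \<epsilon> * f \<epsilon> \<theta> (h \<theta>)) (at \<theta>)) \<and>
       (\<forall>\<theta>. h (\<theta> + 2*pi) = h \<theta>) \<and> (\<forall>\<theta>. \<bar>h \<theta> - \<rho>0\<bar> < \<eta>)"
    by (rule fam.hyperbolic_periodic_solutions) blast
  have W: "r \<in> ?J" "0 < r" "0 \<le> r" "r \<le> R" if "\<bar>r - \<rho>0\<bar> \<le> \<eta>" for r
  proof -
    show "r \<in> ?J" using that \<eta> by (auto simp: abs_le_iff)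
    from Jr[OF this] \<rho>0 show "0 < r" "0 \<le> r" "r \<le> R" by auto
  qed
  \<comment> \<open>\<open>H\<close> is symmetric under \<open>v \<mapsto> -2 - v\<close>, so its
    level sets have mirror images; \<open>snd z > -1\<close> excludes them.\<close>
  define N where "N = {z :: real \<times> real. snd z > -1 \<and> (\<rho>0 - \<eta>)^4 < H (fst z) (snd z) \<and> H (fst z) (snd z) < (\<rho>0 + \<eta>)^4}"
  have openN: "open N" unfolding N_def
    by (intro open_Collect_conj open_Collect_less continuous_H) (auto intro!: continuous_intros)
  show ?thesis
  proof (rule that[OF \<epsilon>0(1)])
    fix \<epsilon> assume e: "0 < \<epsilon>" "\<epsilon> < \<epsilon>0"
    have e1: "0 \<le> \<epsilon>" "\<epsilon> \<le> \<epsilon>1" using e \<epsilon>0 by auto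
    obtain h where h: "\<And>\<theta>. (h has_real_derivative \<epsilon> * f \<epsilon> \<theta> (h \<theta>)) (at \<theta>)"
       "\<And>\<theta>. h (\<theta> + 2*pi) = h \<theta>" "\<And>\<theta>. \<bar>h \<theta> - \<rho>0\<bar> < \<eta>" using sol[OF e] by blast
    interpret ch: annulus_chart "pert_field \<epsilon>" U V U1 U2 V1 V2 "\<tau> \<epsilon>" "\<lambda>\<theta> r. \<epsilon> * f \<epsilon> \<theta> r" \<rho>0 \<eta> N
    proof unfold_locales
      show "0 < \<eta>" "open N" using \<eta> openN by auto
      fix \<theta> r
      show "U (\<theta> + 2*pi) r = U \<theta> r" "V (\<theta> + 2*pi) r = V \<theta> r" "\<tau> \<epsilon> (\<theta> + 2*pi) r = \<tau> \<epsilon> \<theta> r"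
        by (simp_all add: chart_periodic perturbation_periodic)
      show "(U \<theta> r, V \<theta> r) \<in> N" if "\<bar>r - \<rho>0\<bar> < \<eta>"
      proof -
        note w = W[OF less_imp_le[OF that]]
        have "(\<rho>0 - \<eta>)^4 < r^4" "r^4 < (\<rho>0 + \<eta>)^4"
          using that w \<eta> \<eta>0 \<rho>0 by (auto intro!: power_strict_mono simp: abs_less_iff)
        then show ?thesis using H_chart[OF w(3,4)] S_pos[OF w(3,4)] by (simp add: N_def V_def)
      qed
      assume r: "\<bar>r - \<rho>0\<bar> \<le> \<eta>"
      note w = W[OF r]
      show "((\<lambda>z. U (fst z) (snd z)) has_derivative (\<lambda>h. U1 \<theta> r * fst h + U2 \<theta> r * snd h)) (at (\<theta>, r))"
        by (rule has_derivative_U)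
      show "((\<lambda>z. V (fst z) (snd z)) has_derivative (\<lambda>h. V1 \<theta> r * fst h + V2 \<theta> r * snd h)) (at (\<theta>, r))"
        by (rule has_derivative_V[OF w(3,4)])
      show "U1 \<theta> r * V2 \<theta> r - V1 \<theta> r * U2 \<theta> r \<noteq> 0" using D_pos[OF w(2,4), of \<theta>] by (simp add: D_def)
      show "0 < \<tau> \<epsilon> \<theta> r" using D_pos[OF w(2,4), of \<theta>] den[OF e1 w(1), of \<theta>] by (simp add: \<tau>_def)
      show "pert_field \<epsilon> (U \<theta> r, V \<theta> r) = (\<tau> \<epsilon> \<theta> r * (U1 \<theta> r + \<epsilon> * f \<epsilon> \<theta> r * U2 \<theta> r), \<tau> \<epsilon> \<theta> r * (V1 \<theta> r + \<epsilon> * f \<epsilon> \<theta> r * V2 \<theta> r))"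
        by (rule pert_field_chart[OF w(2,4)]) (use den[OF e1 w(1), of \<theta>] in simp)
    next
      let ?I = "{\<rho>0 - \<eta>..\<rho>0 + \<eta>}"
      have I: "?I \<subseteq> {0..R}" using J \<eta> by auto
      have IW: "\<bar>r - \<rho>0\<bar> \<le> \<eta>" if "r \<in> ?I" for r using that by (auto simp: abs_le_iff)
      have "C1_on UNIV ?I (\<lambda>\<theta>. \<tau> \<epsilon> \<theta>)" unfolding \<tau>_def
      proof (intro C1_on_divide C1_den[OF continuous_on_id _ I] C1_fields(3)[OF continuous_on_id I] continuous_on_const)
        fix \<theta> r assume "r \<in> ?I"
        then show "D \<theta> r \<noteq> 0" using D_pos[OF W(2,4)[OF IW], of r \<theta>] by simp
      qed
      then show "continuous_on (UNIV \<times> ?I) (\<lambda>z. \<tau> \<epsilon> (fst z) (snd z))" by (rule C1_on_continuous)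
    next
      fix x assume x: "is_solution (pert_field \<epsilon>) x" "range x \<subseteq> N"
      have "0 \<le> \<rho>0 - \<eta>" "\<rho>0 - \<eta> < \<rho>0 + \<eta>" using \<eta> \<eta>0 \<rho>0 by auto
      moreover have "snd (x t) > -1" "(\<rho>0 - \<eta>)^4 < H (fst (x t)) (snd (x t))" "H (fst (x t)) (snd (x t)) < (\<rho>0 + \<eta>)^4" for t
        using x(2) by (auto simp: N_def)
      ultimately obtain \<theta> r \<theta>' r' where "\<And>t. (\<theta> has_real_derivative \<theta>' t) (at t)" "\<And>t. (r has_real_derivative r' t) (at t)"
        "\<And>t. x t = (U (\<theta> t) (r t), V (\<theta> t) (r t))" "\<And>t. \<rho>0 - \<eta> \<le> r t" "\<And>t. r t \<le> \<rho>0 + \<eta>"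
        using lift_to_chart[OF x(1), of "\<rho>0 - \<eta>" "\<rho>0 + \<eta>"] by metis
      moreover from this have "\<bar>r t - \<rho>0\<bar> \<le> \<eta>" for t by (auto simp: abs_le_iff algebra_simps)
      ultimately show "\<exists>\<theta> r \<theta>' r'. \<forall>t. (\<theta> has_real_derivative \<theta>' t) (at t) \<and> (r has_real_derivative r' t) (at t)
          \<and> x t = (U (\<theta> t) (r t), V (\<theta> t) (r t)) \<and> \<bar>r t - \<rho>0\<bar> \<le> \<eta>" by blast
    qed
    have "limit_cycle (pert_field \<epsilon>) (range (\<lambda>\<theta>. (U \<theta> (h \<theta>), V \<theta> (h \<theta>))))"
    proof (rule ch.limit_cycle_of_graph[OF h k e(1) \<sigma>])
      fix \<theta> r r' assume "\<bar>r - \<rho>0\<bar> \<le> \<eta>" "\<bar>r' - \<rho>0\<bar> \<le> \<eta>"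
      from mult_left_mono[OF mono[OF e this, of \<theta>], of \<epsilon>] e
      show "\<epsilon> * k \<theta> * (r - r')^2 \<le> \<sigma> * ((r - r') * (\<epsilon> * f \<epsilon> \<theta> r - \<epsilon> * f \<epsilon> \<theta> r'))"
        by (simp add: algebra_simps)
    qed
    moreover have "\<exists>\<theta>' r. \<bar>r - \<rho>0\<bar> < \<eta>m \<and> 0 < r \<and> r \<le> R \<and> (U \<theta> (h \<theta>), V \<theta> (h \<theta>)) = (U \<theta>' r, V \<theta>' r)" for \<theta>
      using h(3)[of \<theta>] \<eta> \<eta>0 W[of "h \<theta>"] by (intro exI[of _ \<theta>] exI[of _ "h \<theta>"]) auto
    ultimately show "\<exists>\<Gamma>. \<Gamma> \<noteq> {} \<and> limit_cycle (pert_field \<epsilon>) \<Gamma> \<and>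
      (\<forall>z\<in>\<Gamma>. \<exists>\<theta> r. \<bar>r - \<rho>0\<bar> < \<eta>m \<and> 0 < r \<and> r \<le> R \<and> z = (U \<theta> r, V \<theta> r))"
      by (intro exI[of _ "range (\<lambda>\<theta>. (U \<theta> (h \<theta>), V \<theta> (h \<theta>)))"]) auto
  qed
qed

end

section \<open>The Melnikov integral\<close>

lemma has_integral_periodic_derivative:
  fixes F :: "real \<Rightarrow> real"
  assumes "\<And>\<theta>. (F has_real_derivative F' \<theta>) (at \<theta>)" "F (2*pi) = F 0"
  shows "(F' has_integral 0) {0..2*pi}"
proof -
  have "(F' has_integral (F (2*pi) - F 0)) {0..2*pi}"
    by (rule fundamental_theorem_of_calculus)
       (use assms(1) in \<open>auto simp flip: has_real_derivative_iff_has_vector_derivative intro: has_field_derivative_at_within\<close>)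
  then show ?thesis by (simp add: assms(2))
qed

lemma has_integral_sin_power_cos: "((\<lambda>\<theta>. sin \<theta> ^ n * cos \<theta>) has_integral 0) {0..2*pi :: real}"
proof (rule has_integral_periodic_derivative)
  show "((\<lambda>\<theta>. sin \<theta> ^ Suc n / of_nat (Suc n)) has_real_derivative sin \<theta> ^ n * cos \<theta>) (at \<theta>)" for \<theta> :: real
  proof -
    have "((\<lambda>\<theta>. sin \<theta> ^ Suc n / of_nat (Suc n)) has_real_derivative of_nat (Suc n) * (cos \<theta> * sin \<theta> ^ (Suc n - Suc 0)) / of_nat (Suc n)) (at \<theta>)"
      by (intro DERIV_cdivide DERIV_power DERIV_sin)
    then show ?thesis by (simp add: mult.commute del: of_nat_Suc)
  qed
qed simp

lemma has_integral_continuous: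
  fixes g :: "real \<Rightarrow> real"
  assumes "continuous_on UNIV g"
  shows "(g has_integral integral {0..2*pi} g) {0..2*pi}"
  by (rule integrable_integral[OF integrable_continuous_real]) (use assms continuous_on_subset in blast)

text \<open>The primitive of an odd function is even, while periodicity makes its values at
  \<open>2 * pi\<close> and \<open>- 2 * pi\<close> opposite.\<close>

lemma has_integral_periodic_odd:
  fixes g :: "real \<Rightarrow> real"
  assumes g: "continuous_on UNIV g" and per: "\<And>x. g (x + 2*pi) = g x" and odd: "\<And>x. g (- x) = - g x"
  shows "(g has_integral 0) {0..2*pi}"
proof -
  have "((\<lambda>x. primitive g x - primitive g (- x)) has_real_derivative 0) (at x)" for x
  proof -
    have "((\<lambda>x. primitive g (- x)) has_real_derivative g (- x) * (- 1)) (at x)"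
      by (rule DERIV_chain2[OF primitive_has_derivative[OF g]]) (auto intro!: derivative_eq_intros)
    from DERIV_diff[OF primitive_has_derivative[OF g, of x] this] show ?thesis by (simp add: odd)
  qed
  from real_derivative_zero_const[OF this, of "2*pi" 0]
  have "primitive g (2*pi) = primitive g (- (2*pi))" by simp
  also have "\<dots> = - primitive g (2*pi)" using primitive_multiple_period[OF g per, of "-1"] by simp
  finally have "integral {0..2*pi} g = 0" by (simp add: primitive_pos)
  then show ?thesis using has_integral_continuous[OF g] by simp
qed

lemma integral_pos_periodic:
  fixes g :: "real \<Rightarrow> real"
  assumes g: "continuous_on UNIV g" "\<And>x. g x \<ge> 0" and p: "p \<in> {0..2*pi}" "g p > 0"
  shows "integral {0..2*pi} g > 0"
proof -
  have c: "continuous_on {0..2*pi} g" using g(1) continuous_on_subset by blast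
  have "integral {0..2*pi} g \<ge> 0" using g(2) by (intro integral_nonneg integrable_continuous_real c)
  moreover have "integral {0..2*pi} g \<noteq> 0"
    using integral_eq_0_iff[OF c _ g(2)] p by force
  ultimately show ?thesis by simp
qed

context quartic_chart
begin

text \<open>The quotient of \<open>V\<close> by \<open>r^2\<close>, rationalised through
  \<open>(S - 1) * (S + 1) = 2 * r^2 * \<mu>\<close> so that it is regular at
  \<open>r = 0\<close>.\<close>

definition vhat where "vhat \<theta> r = 2 * \<mu> \<theta> / (1 + S \<theta> r)"
text \<open>The one-form \<open>q0 du\<close> along a level curve, sorted by powers of \<open>r\<close>: inserting \<open>v = r\<^sup>2 vhat\<close> and
  \<open>m = r\<^sup>2 \<mu>\<close> in \<open>v\<^sup>2 + v\<^sup>3/3 + 2 a u\<^sup>2 v = m\<^sup>2 + 2 a u\<^sup>2 m - 2/3 m\<^sup>3 - a u\<^sup>2 m\<^sup>2 + O(r\<^sup>8)\<close>, the terms of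
  order \<open>r\<^sup>4\<close> add up to \<open>w\<^sup>2 - a\<^sup>2 u\<^sup>4\<close>, whose integral vanishes, and \<open>G2\<close> collects the others.\<close>

definition G0 where "G0 \<theta> r = vhat \<theta> r * (cos \<theta> / b)"
definition G1 where "G1 \<theta> r = (sin \<theta> / b)^2 * vhat \<theta> r * (cos \<theta> / b)"
definition G2 where "G2 \<theta> r = (- (2/3) * \<mu> \<theta> ^ 3 - a * (sin \<theta> / b)^2 * (\<mu> \<theta>)^2
   + r^2 * (vhat \<theta> r ^ 4 * (3/4 + r^2 * vhat \<theta> r / 2 + (r^2 * vhat \<theta> r)^2 / 12)
        + 2 * a * (sin \<theta> / b)^2 * vhat \<theta> r ^ 3 * (1/2 + r^2 * vhat \<theta> r / 8))) * (cos \<theta> / b)"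

lemma V_vhat: "0 \<le> r \<Longrightarrow> r \<le> R \<Longrightarrow> V \<theta> r = r^2 * vhat \<theta> r"
proof -
  assume r: "0 \<le> r" "r \<le> R"
  have "(S \<theta> r - 1) * (1 + S \<theta> r) = 2 * r^2 * \<mu> \<theta>"
    using S_sq[OF r, of \<theta>] by (simp add: algebra_simps power2_eq_square)
  then show ?thesis using S_pos[OF r, of \<theta>] by (simp add: V_def vhat_def field_simps)
qed

text \<open>The radius is an arbitrary function \<open>\<rho>\<close> so that the scaling
  \<open>r = s * x\<close>, including \<open>s = 0\<close>, can be inserted.\<close>

lemma C1_G:
  fixes t :: "'a::t2_space \<Rightarrow> real"
  assumes t: "continuous_on K t" and \<rho>: "C1_on K J \<rho>" "\<And>x r. x \<in> K \<Longrightarrow> r \<in> J \<Longrightarrow> 0 \<le> \<rho> x r \<and> \<rho> x r \<le> R"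
  shows "C1_on K J (\<lambda>x r. G0 (t x) (\<rho> x r))" "C1_on K J (\<lambda>x r. G1 (t x) (\<rho> x r))" "C1_on K J (\<lambda>x r. G2 (t x) (\<rho> x r))"
proof -
  have \<mu>: "continuous_on K (\<lambda>x. \<mu> (t x))"
    using continuous_on_compose[OF t, of \<mu>] continuous_on_trig_parts(3) by (simp add: o_def)
  have sc: "continuous_on K (\<lambda>x. sin (t x) / b)" "continuous_on K (\<lambda>x. cos (t x) / b)"
    using b by (auto intro!: continuous_on_divide continuous_on_sin continuous_on_cos continuous_on_const t)
  have S: "C1_on K J (\<lambda>x r. S (t x) (\<rho> x r))" unfolding S_def
    by (intro C1_on_sqrt C1_on_add C1_on_mult C1_on_power C1_on_const C1_on_param \<mu> \<rho>(1))
       (use radicand_pos \<rho>(2) in auto)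
  have vhat: "C1_on K J (\<lambda>x r. vhat (t x) (\<rho> x r))" unfolding vhat_def
  proof (intro C1_on_divide C1_on_add C1_on_mult C1_on_const C1_on_param \<mu> S)
    fix x r assume "x \<in> K" "r \<in> J"
    then show "1 + S (t x) (\<rho> x r) \<noteq> 0" using S_pos[of "\<rho> x r" "t x"] \<rho>(2)[of x r] by simp
  qed
  note i = C1_on_add C1_on_diff C1_on_mult C1_on_power C1_on_const C1_on_param[OF sc(1)] C1_on_param[OF sc(2)] C1_on_param[OF \<mu>] vhat \<rho>(1)
  show "C1_on K J (\<lambda>x r. G0 (t x) (\<rho> x r))" unfolding G0_def by (intro i)
  show "C1_on K J (\<lambda>x r. G1 (t x) (\<rho> x r))" unfolding G1_def by (intro i)
  have d: "C1_on K J (\<lambda>x r. F x r / c)" if "C1_on K J F" for F c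
    using C1_on_mult[OF that C1_on_const[of K J "inverse c"]] by (simp add: divide_inverse)
  show "C1_on K J (\<lambda>x r. G2 (t x) (\<rho> x r))" unfolding G2_def by (intro i d)
qed

lemma continuous_G:
  assumes "0 \<le> r" "r \<le> R"
  shows "continuous_on UNIV (\<lambda>\<theta>. G0 \<theta> r)" "continuous_on UNIV (\<lambda>\<theta>. G1 \<theta> r)" "continuous_on UNIV (\<lambda>\<theta>. G2 \<theta> r)"
proof -
  have *: "continuous_on UNIV (\<lambda>\<theta>. G \<theta> r)" if "C1_on UNIV {0::real} (\<lambda>\<theta> _. G \<theta> r)" for G :: "real \<Rightarrow> real \<Rightarrow> real"
  proof -
    have "continuous_on UNIV (\<lambda>\<theta>. (\<lambda>z. G (fst z) r) (\<theta>, 0::real))"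
      by (rule continuous_on_compose2[OF C1_on_continuous[OF that]]) (auto intro!: continuous_intros)
    then show ?thesis by simp
  qed
  show "continuous_on UNIV (\<lambda>\<theta>. G0 \<theta> r)" "continuous_on UNIV (\<lambda>\<theta>. G1 \<theta> r)" "continuous_on UNIV (\<lambda>\<theta>. G2 \<theta> r)"
    by (intro * C1_G[of UNIV "\<lambda>x. x" "{0}" "\<lambda>_ _. r"] C1_on_const continuous_on_id; use assms in simp)+
qed

definition I0 where "I0 r = integral {0..2*pi} (\<lambda>\<theta>. G0 \<theta> r)"
definition I1 where "I1 r = integral {0..2*pi} (\<lambda>\<theta>. G1 \<theta> r)"
definition I2 where "I2 r = integral {0..2*pi} (\<lambda>\<theta>. G2 \<theta> r)"

text \<open>\<open>sin * Y * cos\<close> is odd because \<open>Y\<close> is even. All other terms,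
  including \<open>Y^2\<close> times \<open>cos\<close>, are powers of \<open>sin\<close> times
  \<open>cos\<close>, which have periodic primitives.\<close>

lemma zero_means:
  "((\<lambda>\<theta>. (sin \<theta> / b) * \<mu> \<theta> * (cos \<theta> / b)) has_integral 0) {0..2*pi}"
  "((\<lambda>\<theta>. ((Y \<theta>)^2 - a^2 * (sin \<theta> / b)^4) * (cos \<theta> / b)) has_integral 0) {0..2*pi}"
proof -
  note h = has_integral_add[OF has_integral_mult_right has_integral_mult_right]
  have "((\<lambda>\<theta>. sin \<theta> * Y \<theta> * cos \<theta>) has_integral 0) {0..2*pi}"
    by (rule has_integral_periodic_odd)
       (auto simp: chart_periodic Y_def Q_def intro!: continuous_intros)
  from h[OF this has_integral_sin_power_cos[of 3], of "1/b^2" "-a/b^4"]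
  have "((\<lambda>\<theta>. 1/b^2 * (sin \<theta> * Y \<theta> * cos \<theta>) + -a/b^4 * (sin \<theta> ^ 3 * cos \<theta>)) has_integral 0) {0..2*pi}" by simp
  then show "((\<lambda>\<theta>. (sin \<theta> / b) * \<mu> \<theta> * (cos \<theta> / b)) has_integral 0) {0..2*pi}"
    by (rule has_integral_eq[rotated]) (use b in \<open>simp add: \<mu>_def field_simps eval_nat_numeral\<close>)
  from h[OF has_integral_sin_power_cos[of 0] has_integral_sin_power_cos[of 4], of "2/b" "-(2 + a^2/b^4)/b"]
  have "((\<lambda>\<theta>. 2/b * (sin \<theta> ^ 0 * cos \<theta>) + -(2 + a^2/b^4)/b * (sin \<theta> ^ 4 * cos \<theta>)) has_integral 0) {0..2*pi}" by simp
  then show "((\<lambda>\<theta>. ((Y \<theta>)^2 - a^2 * (sin \<theta> / b)^4) * (cos \<theta> / b)) has_integral 0) {0..2*pi}"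
    by (rule has_integral_eq[rotated]) (use b in \<open>simp add: Y_sq field_simps\<close>)
qed

lemma vhat_0: "vhat \<theta> 0 = \<mu> \<theta>" by (simp add: vhat_def S_def)

lemma Ycos: "Y \<theta> * cos \<theta> = sqrt 2 * (cos \<theta>)^2 * Q \<theta>" by (simp add: Y_def power2_eq_square)

lemma Ycos_nonneg: "0 \<le> Y \<theta> * cos \<theta>"
  unfolding Ycos by (intro mult_nonneg_nonneg less_imp_le[OF Q_pos]) simp_all

lemma continuous_Y: "continuous_on A Y" by (rule continuous_on_trig_parts)

text \<open>At \<open>r = 0\<close> the factor \<open>vhat\<close> is \<open>\<mu>\<close>, whose
  part with \<open>a\<close> integrates to zero against \<open>cos\<close>. What remains is
  \<open>Y * cos\<close>, nonnegative because \<open>Y\<close> has the sign of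
  \<open>cos\<close>.\<close>

lemma I0_pos: "I0 0 > 0"
proof -
  have pos: "integral {0..2*pi} (\<lambda>\<theta>. Y \<theta> * cos \<theta>) > 0"
  proof (rule integral_pos_periodic[where p = 0])
    show "continuous_on UNIV (\<lambda>\<theta>. Y \<theta> * cos \<theta>)" by (intro continuous_intros continuous_Y)
    show "0 < Y 0 * cos 0" unfolding Ycos using Q_pos[of 0] by simp
    show "0 \<le> Y x * cos x" for x by (rule Ycos_nonneg)
  qed simp
  note h = has_integral_add[OF has_integral_mult_right has_integral_mult_right]
  have c: "continuous_on UNIV (\<lambda>\<theta>. Y \<theta> * cos \<theta>)" by (intro continuous_intros continuous_Y)
  from h[OF has_integral_continuous[OF c] has_integral_sin_power_cos[of 2], of "1/b" "-a/b^3"]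
  have "((\<lambda>\<theta>. 1/b * (Y \<theta> * cos \<theta>) + -a/b^3 * (sin \<theta> ^ 2 * cos \<theta>)) has_integral (1/b * integral {0..2*pi} (\<lambda>\<theta>. Y \<theta> * cos \<theta>))) {0..2*pi}" by simp
  then have "((\<lambda>\<theta>. G0 \<theta> 0) has_integral (1/b * integral {0..2*pi} (\<lambda>\<theta>. Y \<theta> * cos \<theta>))) {0..2*pi}"
    by (rule has_integral_eq[rotated]) (use b in \<open>simp add: G0_def vhat_0 \<mu>_def field_simps eval_nat_numeral\<close>)
  then have "I0 0 = 1/b * integral {0..2*pi} (\<lambda>\<theta>. Y \<theta> * cos \<theta>)" unfolding I0_def by (rule integral_unique)
  then show ?thesis using pos b by simp
qed

lemma I1_pos: "I1 0 > 0"
proof -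
  have pos: "integral {0..2*pi} (\<lambda>\<theta>. (sin \<theta>)^2 * (Y \<theta> * cos \<theta>)) > 0"
  \<comment> \<open>The integrand vanishes at the angle \<open>0\<close> because of the sine, hence
    the different test point.\<close>
  proof (rule integral_pos_periodic[where p = "pi/4"])
    show "0 < (sin (pi/4))^2 * (Y (pi/4) * cos (pi/4))" unfolding Ycos using Q_pos by (simp add: sin_45 cos_45)
    show "continuous_on UNIV (\<lambda>\<theta>. (sin \<theta>)^2 * (Y \<theta> * cos \<theta>))" by (intro continuous_intros continuous_Y)
    show "0 \<le> (sin x)^2 * (Y x * cos x)" for x by (intro mult_nonneg_nonneg Ycos_nonneg zero_le_power2)
  qed simp
  note h = has_integral_add[OF has_integral_mult_right has_integral_mult_right]
  have c: "continuous_on UNIV (\<lambda>\<theta>. (sin \<theta>)^2 * (Y \<theta> * cos \<theta>))" by (intro continuous_intros continuous_Y)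
  from h[OF has_integral_continuous[OF c] has_integral_sin_power_cos[of 4], of "1/b^3" "-a/b^5"]
  have "((\<lambda>\<theta>. 1/b^3 * ((sin \<theta>)^2 * (Y \<theta> * cos \<theta>)) + -a/b^5 * (sin \<theta> ^ 4 * cos \<theta>)) has_integral (1/b^3 * integral {0..2*pi} (\<lambda>\<theta>. (sin \<theta>)^2 * (Y \<theta> * cos \<theta>)))) {0..2*pi}" by simp
  then have "((\<lambda>\<theta>. G1 \<theta> 0) has_integral (1/b^3 * integral {0..2*pi} (\<lambda>\<theta>. (sin \<theta>)^2 * (Y \<theta> * cos \<theta>)))) {0..2*pi}"
    by (rule has_integral_eq[rotated]) (use b in \<open>simp add: G1_def vhat_0 \<mu>_def field_simps eval_nat_numeral\<close>)
  then have "I1 0 = 1/b^3 * integral {0..2*pi} (\<lambda>\<theta>. (sin \<theta>)^2 * (Y \<theta> * cos \<theta>))" unfolding I1_def by (rule integral_unique)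
  then show ?thesis using pos b by simp
qed

text \<open>When \<open>\<mu> = Y - a * x^2\<close> is expanded, the terms linear in
  \<open>Y\<close> cancel. The terms even in \<open>Y\<close> are polynomials in \<open>sin\<close>
  times \<open>cos\<close> and integrate to zero, leaving \<open>- 2/3\<close> times the integral of
  \<open>Y^3 * cos\<close>.\<close>

lemma I2_neg: "I2 0 < 0"
proof -
  have pos: "integral {0..2*pi} (\<lambda>\<theta>. (Y \<theta>)^2 * (Y \<theta> * cos \<theta>)) > 0"
  proof (rule integral_pos_periodic[where p = 0])
    show "continuous_on UNIV (\<lambda>\<theta>. (Y \<theta>)^2 * (Y \<theta> * cos \<theta>))" by (intro continuous_intros continuous_Y)
    show "0 < (Y 0)^2 * (Y 0 * cos 0)" unfolding Ycos Y_sq using Q_pos[of 0] by simp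
    show "0 \<le> (Y x)^2 * (Y x * cos x)" for x by (intro mult_nonneg_nonneg Ycos_nonneg zero_le_power2)
  qed simp
  note h = has_integral_add[OF has_integral_mult_right has_integral_mult_right]
  have c: "continuous_on UNIV (\<lambda>\<theta>. (Y \<theta>)^2 * (Y \<theta> * cos \<theta>))" by (intro continuous_intros continuous_Y)
  define x where "x \<theta> = sin \<theta> / b" for \<theta>
  from has_integral_add[OF h[OF has_integral_continuous[OF c] has_integral_sin_power_cos[of 2], of "- (2/3)/b" "2*a/b^3"]
      has_integral_mult_right[OF has_integral_sin_power_cos[of 6], of "- 2*a/b^3 - a^3/(3*b^7)"]]
  have "((\<lambda>\<theta>. - (2/3)/b * ((Y \<theta>)^2 * (Y \<theta> * cos \<theta>)) + 2*a/b^3 * (sin \<theta> ^ 2 * cos \<theta>) + (- 2*a/b^3 - a^3/(3*b^7)) * (sin \<theta> ^ 6 * cos \<theta>))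
      has_integral (- (2/3)/b * integral {0..2*pi} (\<lambda>\<theta>. (Y \<theta>)^2 * (Y \<theta> * cos \<theta>)))) {0..2*pi}" by simp
  moreover have "- (2/3)/b * ((Y \<theta>)^2 * (Y \<theta> * cos \<theta>)) + 2*a/b^3 * (sin \<theta> ^ 2 * cos \<theta>) + (- 2*a/b^3 - a^3/(3*b^7)) * (sin \<theta> ^ 6 * cos \<theta>) = G2 \<theta> 0" for \<theta>
  proof -
    define x c where "x = sin \<theta> / b" and "c = cos \<theta> / b"
    have sc: "sin \<theta> = b * x" "cos \<theta> = b * c" using b by (auto simp: x_def c_def)
    have "G2 \<theta> 0 = (- (2/3) * (Y \<theta> - a * x^2) ^ 3 - a * x^2 * (Y \<theta> - a * x^2)^2) * c"
      by (simp add: G2_def vhat_0 \<mu>_def x_def c_def)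
    also have "\<dots> = (- (2/3) * (Y \<theta> * (Y \<theta>)^2) + a * x^2 * (Y \<theta>)^2 - a^3/3 * x^6) * c"
      by (simp add: field_simps power2_eq_square eval_nat_numeral)
    also have "\<dots> = - (2/3) * ((Y \<theta>)^2 * (Y \<theta> * c)) + a * x^2 * (2 * (1 - (b * x)^4)) * c - a^3/3 * x^6 * c"
      unfolding sc[symmetric] Y_sq[symmetric] by (simp add: algebra_simps)
    also have "\<dots> = - (2/3)/b * ((Y \<theta>)^2 * (Y \<theta> * (b * c))) + 2*a/b^3 * ((b * x)^2 * (b * c)) + (- 2*a/b^3 - a^3/(3*b^7)) * ((b * x)^6 * (b * c))"
      using b by (simp add: field_simps power_mult_distrib eval_nat_numeral)
    finally show ?thesis by (simp flip: sc)
  qed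
  ultimately have "((\<lambda>\<theta>. G2 \<theta> 0) has_integral (- (2/3)/b * integral {0..2*pi} (\<lambda>\<theta>. (Y \<theta>)^2 * (Y \<theta> * cos \<theta>)))) {0..2*pi}" by simp
  then have "I2 0 = - (2/3)/b * integral {0..2*pi} (\<lambda>\<theta>. (Y \<theta>)^2 * (Y \<theta> * cos \<theta>))" unfolding I2_def by (rule integral_unique)
  moreover have "- (2/3)/b < 0" using b by simp
  ultimately show ?thesis by (simp only: mult_neg_pos[OF _ pos])
qed

text \<open>The derivative of \<open>q0\<close> in \<open>v\<close> is the prescribed divergence, so the perturbation differs from
  \<open>(0, q0)\<close> by a Hamiltonian vector field.\<close>

definition q0 where "q0 e A c B u v = e * v + A * u * (v + v^2/2) + c * (v^2 + v^3/3) + B * u^2 * v" for e A c B u v :: real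

lemma q0_chart:
  assumes r: "0 \<le> r" "r \<le> R"
  shows "q0 e A c (d + 2*a*c) (U \<theta> r) (V \<theta> r) * U1 \<theta> r =
    r^3 * (e * G0 \<theta> r + A * r * ((sin \<theta> / b) * \<mu> \<theta> * (cos \<theta> / b)) + c * r^2 * (((Y \<theta>)^2 - a^2 * (sin \<theta> / b)^4) * (cos \<theta> / b))
      + d * r^2 * G1 \<theta> r + c * r^4 * G2 \<theta> r)"
proof -
  define x k y w v where "x = sin \<theta> / b" and "k = cos \<theta> / b" and "y = Y \<theta>" and "w = vhat \<theta> r" and "v = V \<theta> r"
  note defs = this
  have v: "v = r^2 * w" unfolding defs by (rule V_vhat[OF r])
  have m: "v + v^2/2 = r^2 * (y - a * x^2)"
    using W_chart[OF r, of \<theta>] by (simp add: W_def U_def defs power_mult_distrib power_divide algebra_simps)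
  \<comment> \<open>An expansion in \<open>m\<close> with an exact polynomial remainder; under the
    scaling of the chart the terms still containing \<open>v\<close> have order
    \<open>r^8\<close>.\<close>
  have id: "v^2 + v^3/3 + 2*a*u^2* v = m^2 - (2/3)*m^3 + 2*a*u^2*m - a*u^2*m^2 + v^4*(3/4 + v/2 + v^2/12) + 2*a*u^2* v^3*(1/2+v/8)"
    if "m = v + v^2/2" for m u :: real
    unfolding that by (simp add: field_simps eval_nat_numeral)
  have "q0 e A c (d + 2*a*c) (r * x) v = e * v + A * (r*x) * (v + v^2/2) + c * (v^2 + v^3/3 + 2*a*(r*x)^2* v) + d * (r*x)^2 * v"
    by (simp add: q0_def algebra_simps)
  also have "\<dots> = e * v + A * (r*x) * (r^2 * (y - a * x^2)) + c * (r^4 * (y^2 - a^2 * x^4) + r^6 * (- (2/3) * (y - a*x^2)^3 - a * x^2 * (y - a*x^2)^2)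
       + v^4*(3/4 + v/2 + v^2/12) + 2*a*(r*x)^2* v^3*(1/2+v/8)) + d * (r*x)^2 * v"
    unfolding id[OF m[symmetric], of "r*x"] m by (simp add: field_simps eval_nat_numeral)
  finally have "q0 e A c (d + 2*a*c) (r * x) v * (r * k) = \<dots> * (r * k)" by simp
  also have "\<dots> = r^3 * (e * (w * k) + A * r * (x * (y - a*x^2) * k) + c * r^2 * ((y^2 - a^2 * x^4) * k)
      + d * r^2 * (x^2 * w * k) + c * r^4 * ((- (2/3) * (y - a*x^2)^3 - a * x^2 * (y - a*x^2)^2
          + r^2 * (w^4 * (3/4 + r^2 * w/2 + (r^2*w)^2/12) + 2*a*x^2*w^3*(1/2 + r^2*w/8))) * k))"
    unfolding v by (simp add: field_simps eval_nat_numeral)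
  finally show ?thesis
    by (simp add: G0_def G1_def G2_def U_def U1_def \<mu>_def flip: defs)
qed

end

section \<open>Reduction to the divergence, and the scaled Melnikov function\<close>

lemma poly3_expand: "poly3 a u v = a 0 0 + a 0 1 * v + a 0 2 * v^2 + a 0 3 * v^3 + a 1 0 * u + a 1 1 * u * v
    + a 1 2 * u * v^2 + a 2 0 * u^2 + a 2 1 * u^2 * v + a 3 0 * u^3"
  by (simp add: poly3_def eval_nat_numeral algebra_simps)

context quartic_chart
begin

text \<open>The one-form \<open>(q0 - q) du + p dv\<close> is closed: the
  \<open>v\<close>-derivative of \<open>q0\<close> is the divergence, so that of
  \<open>q0 - q\<close> is the \<open>u\<close>-derivative of \<open>p\<close>. On the plane it
  therefore has a potential, here an explicit polynomial.\<close>

lemma potential_exists: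
  fixes pc qc :: "nat \<Rightarrow> nat \<Rightarrow> real"
  assumes div: "\<And>u v. deriv (\<lambda>u'. poly3 pc u' v) u + deriv (\<lambda>v'. poly3 qc u v') v
      = e + A * u * (1 + v) + c * (2 * v + v^2) + B * u^2"
  obtains K where "\<And>x y x' y' t. (x has_real_derivative x') (at t) \<Longrightarrow> (y has_real_derivative y') (at t) \<Longrightarrow>
     ((\<lambda>t. K (x t) (y t)) has_real_derivative
        (q0 e A c B (x t) (y t) - poly3 qc (x t) (y t)) * x' + poly3 pc (x t) (y t) * y') (at t)"
proof -
  define p00 p01 p02 p03 p10 p11 p12 p20 p21 p30 where "p00 = pc 0 0" and "p01 = pc 0 1" and "p02 = pc 0 2" and "p03 = pc 0 3"
    and "p10 = pc 1 0" and "p11 = pc 1 1" and "p12 = pc 1 2" and "p20 = pc 2 0" and "p21 = pc 2 1" and "p30 = pc 3 0"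
  note p = this
  define q00 q01 q02 q03 q10 q11 q12 q20 q21 q30 where "q00 = qc 0 0" and "q01 = qc 0 1" and "q02 = qc 0 2" and "q03 = qc 0 3"
    and "q10 = qc 1 0" and "q11 = qc 1 1" and "q12 = qc 1 2" and "q20 = qc 2 0" and "q21 = qc 2 1" and "q30 = qc 3 0"
  note q = this
  have P: "poly3 pc u v = p00 + p01 * v + p02 * v^2 + p03 * v^3 + p10 * u + p11 * u * v + p12 * u * v^2 + p20 * u^2 + p21 * u^2 * v + p30 * u^3" for u v
    unfolding poly3_expand p ..
  have Q: "poly3 qc u v = q00 + q01 * v + q02 * v^2 + q03 * v^3 + q10 * u + q11 * u * v + q12 * u * v^2 + q20 * u^2 + q21 * u^2 * v + q30 * u^3" for u v
    unfolding poly3_expand q ..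
  have dP: "deriv (\<lambda>u'. poly3 pc u' v) u = p10 + p11 * v + p12 * v^2 + 2 * p20 * u + 2 * p21 * u * v + 3 * p30 * u^2" for u v
    unfolding P by (rule DERIV_imp_deriv) (auto intro!: derivative_eq_intros)
  have dQ: "deriv (\<lambda>v'. poly3 qc u v') v = q01 + q11 * u + q21 * u^2 + 2 * q02 * v + 2 * q12 * u * v + 3 * q03 * v^2" for u v
    unfolding Q by (rule DERIV_imp_deriv) (auto intro!: derivative_eq_intros)
  note d = div[unfolded dP dQ]
  \<comment> \<open>The coefficients of the divergence are read off by evaluating the polynomial
    identity at points with coordinates \<open>-1\<close>, \<open>0\<close> and
    \<open>1\<close>.\<close>
  have "q01 = e - p10" using d[of 0 0] by simp
  moreover have "3 * q03 = c - p12" "2 * q02 = 2 * c - p11" using d[of 0 0] d[where u = 0 and v = 1] d[where u = 0 and v = "-1"] by simp_all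
  moreover have "q21 = B - 3 * p30" "q11 = A - 2 * p20" using d[of 0 0] d[where u = 1 and v = 0] d[where u = "-1" and v = 0] by simp_all
  moreover have "2 * q12 = A - 2 * p21"
    using d[where u = 1 and v = 1] d[where u = "-1" and v = 1] d[where u = 1 and v = 0] d[where u = "-1" and v = 0] by simp
  ultimately have qs: "q01 = e - p10" "q03 = (c - p12)/3" "q02 = c - p11/2" "q21 = B - 3 * p30" "q11 = A - 2 * p20" "q12 = A/2 - p21"
    by simp_all
  \<comment> \<open>The integral of \<open>p\<close> in \<open>v\<close> from \<open>0\<close>,
    minus the integral of \<open>q\<close> along the axis \<open>v = 0\<close>, where
    \<open>q0\<close> vanishes.\<close>
  define K where "K u v = p00 * v + (p01/2) * v^2 + (p02/3) * v^3 + (p03/4) * v^4 + p10 * (u * v) + (p11/2) * (u * v^2) + (p12/3) * (u * v^3)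
     + p20 * (u^2 * v) + (p21/2) * (u^2 * v^2) + p30 * (u^3 * v) - q00 * u - (q10/2) * u^2 - (q20/3) * u^3 - (q30/4) * u^4" for u v
  show ?thesis
  proof (rule that[of K])
    fix x y :: "real \<Rightarrow> real" and x' y' t :: real
    assume xy: "(x has_real_derivative x') (at t)" "(y has_real_derivative y') (at t)"
    define u v where "u = x t" and "v = y t"
    have "((\<lambda>t. K (x t) (y t)) has_real_derivative
       (p10 * v + p11 * v^2/2 + p12 * v^3/3 + 2 * p20 * u * v + p21 * u * v^2 + 3 * p30 * u^2 * v - q00 - q10 * u - q20 * u^2 - q30 * u^3) * x'
       + (p00 + p01 * v + p02 * v^2 + p03 * v^3 + p10 * u + p11 * u * v + p12 * u * v^2 + p20 * u^2 + p21 * u^2 * v + p30 * u^3) * y') (at t)"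
    proof -
      have pw: "((\<lambda>t. x t ^ n) has_real_derivative of_nat n * (x' * x t ^ (n - Suc 0))) (at t)"
        "((\<lambda>t. y t ^ n) has_real_derivative of_nat n * (y' * y t ^ (n - Suc 0))) (at t)" for n
        by (intro DERIV_power xy)+
      show ?thesis
        unfolding K_def
        by (rule DERIV_cong, (rule DERIV_add DERIV_diff DERIV_cmult DERIV_mult pw xy)+)
           (simp add: u_def v_def field_simps eval_nat_numeral)
    qed
    moreover have "p10 * v + p11 * v^2/2 + p12 * v^3/3 + 2 * p20 * u * v + p21 * u * v^2 + 3 * p30 * u^2 * v - q00 - q10 * u - q20 * u^2 - q30 * u^3
      = q0 e A c B u v - poly3 qc u v"
      unfolding Q q0_def qs by (simp add: field_simps eval_nat_numeral)
    moreover have "p00 + p01 * v + p02 * v^2 + p03 * v^3 + p10 * u + p11 * u * v + p12 * u * v^2 + p20 * u^2 + p21 * u^2 * v + p30 * u^3 = poly3 pc u v"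
      unfolding P ..
    ultimately show "((\<lambda>t. K (x t) (y t)) has_real_derivative
        (q0 e A c B (x t) (y t) - poly3 qc (x t) (y t)) * x' + poly3 pc (x t) (y t) * y') (at t)"
      by (simp add: u_def v_def)
  qed
qed

lemma DERIV_UV:
  assumes r: "0 \<le> r" "r \<le> R"
  shows "((\<lambda>\<theta>. U \<theta> r) has_real_derivative U1 \<theta> r) (at \<theta>)" "((\<lambda>\<theta>. V \<theta> r) has_real_derivative V1 \<theta> r) (at \<theta>)"
proof -
  have p: "((\<lambda>\<theta>. (\<theta>, r)) has_derivative (\<lambda>h. (h, 0))) (at \<theta>)"
    by (intro has_derivative_Pair has_derivative_ident has_derivative_const)
  show "((\<lambda>\<theta>. U \<theta> r) has_real_derivative U1 \<theta> r) (at \<theta>)"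
    using has_derivative_compose[OF p has_derivative_U] by (simp add: has_field_derivative_def)
  show "((\<lambda>\<theta>. V \<theta> r) has_real_derivative V1 \<theta> r) (at \<theta>)"
    using has_derivative_compose[OF p has_derivative_V[OF r]] by (simp add: has_field_derivative_def)
qed

text \<open>The radial interval shrinks because \<open>C1_deriv_integral\<close> differentiates only
  at interior points, whereas \<open>C1_deriv\<close> asks for two-sided derivatives on the whole
  closed interval.\<close>

lemma C1_on_integral:
  fixes G :: "real \<Rightarrow> real \<Rightarrow> real \<Rightarrow> real"
  assumes G: "C1_on ({0..s1} \<times> UNIV) {l..u} (\<lambda>z. G (fst z) (snd z))" and lu: "l < l'" "u' < u"
  shows "C1_on {0..s1} {l'..u'} (\<lambda>s x. integral {0..2*pi} (\<lambda>\<theta>. G s \<theta> x))"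
proof -
  obtain g where g: "C1_deriv ({0..s1} \<times> UNIV) {l..u} (\<lambda>z. G (fst z) (snd z)) g" using G by (auto simp: C1_on_def)
  have slice: "continuous_on (K \<times> {l..u}) (\<lambda>z. h (s, fst z) (snd z))"
    if "continuous_on (({0..s1} \<times> UNIV) \<times> {l..u}) (\<lambda>z. h (fst z) (snd z))" "s \<in> {0..s1}"
    for h :: "real \<times> real \<Rightarrow> real \<Rightarrow> real" and s and K :: "real set"
  proof -
    have "continuous_on (K \<times> {l..u}) (\<lambda>z. (\<lambda>z. h (fst z) (snd z)) ((s, fst z), snd z))"
      by (rule continuous_on_compose2[OF that(1)]) (use that(2) in \<open>auto intro!: continuous_intros\<close>)
    then show ?thesis by simp
  qed
  have param: "continuous_on ({0..s1} \<times> {l'..u'}) (\<lambda>z. integral {0..2*pi} (\<lambda>\<theta>. h (fst z, \<theta>) (snd z)))"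
    if h: "continuous_on (({0..s1} \<times> UNIV) \<times> {l..u}) (\<lambda>z. h (fst z) (snd z))" for h :: "real \<times> real \<Rightarrow> real \<Rightarrow> real"
  proof -
    have "continuous_on (({0..s1} \<times> {l'..u'}) \<times> cbox 0 (2*pi)) (\<lambda>w. (\<lambda>z. h (fst z) (snd z)) ((fst (fst w), snd w), snd (fst w)))"
      by (rule continuous_on_compose2[OF h]) (use lu in \<open>auto intro!: continuous_intros\<close>)
    then have "continuous_on (({0..s1} \<times> {l'..u'}) \<times> cbox 0 (2*pi)) (\<lambda>(z, \<theta>). h (fst z, \<theta>) (snd z))"
      by (simp add: split_def)
    from integral_continuous_on_param[OF this] show ?thesis by simp
  qed
  show ?thesis
  proof (rule C1_onI[of _ _ _ "\<lambda>s x. integral {0..2*pi} (\<lambda>\<theta>. g (s, \<theta>) x)"], unfold C1_deriv_def, intro conjI ballI)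
    show "continuous_on ({0..s1} \<times> {l'..u'}) (\<lambda>z. integral {0..2*pi} (\<lambda>\<theta>. G (fst z) \<theta> (snd z)))"
      using param[of "\<lambda>w. G (fst w) (snd w)"] g by (simp add: C1_deriv_def)
    show "continuous_on ({0..s1} \<times> {l'..u'}) (\<lambda>z. integral {0..2*pi} (\<lambda>\<theta>. g (fst z, \<theta>) (snd z)))"
      using param[of g] g by (simp add: C1_deriv_def)
    fix s x assume sx: "s \<in> {0..s1}" "x \<in> {l'..u'}"
    have "C1_deriv {0..2*pi} {l..u} (G s) (\<lambda>\<theta>. g (s, \<theta>))"
      unfolding C1_deriv_def
    proof (intro conjI ballI)
      show "continuous_on ({0..2*pi} \<times> {l..u}) (\<lambda>z. G s (fst z) (snd z))"
        using slice[of "\<lambda>w. G (fst w) (snd w)" s] g sx by (simp add: C1_deriv_def)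
      show "continuous_on ({0..2*pi} \<times> {l..u}) (\<lambda>z. g (s, fst z) (snd z))"
        using slice[of g s] g sx by (simp add: C1_deriv_def)
      show "(G s \<theta> has_real_derivative g (s, \<theta>) r) (at r)" if "r \<in> {l..u}" for \<theta> r
        using g sx that by (auto simp: C1_deriv_def)
    qed
    from C1_deriv_integral[OF this, of x] sx lu
    show "((\<lambda>x. integral {0..2*pi} (\<lambda>\<theta>. G s \<theta> x)) has_real_derivative integral {0..2*pi} (\<lambda>\<theta>. g (s, \<theta>) x)) (at x)"
      by auto
  qed
qed

text \<open>The Melnikov function under the scaling \<open>r = s x\<close> with coefficients \<open>s\<^sup>4 e\<close> and \<open>s\<^sup>2 d\<close>, divided by \<open>s\<^sup>4 r\<^sup>3\<close>.\<close>

definition L where "L e d c s x = e * I0 (s * x) + d * x^2 * I1 (s * x) + c * x^4 * I2 (s * x)"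

lemma C1_L:
  assumes l: "0 \<le> l" "l < l'" "u' < u" "s1 * u \<le> R"
  shows "C1_on {0..s1} {l'..u'} (L e d c)"
proof -
  have t: "continuous_on ({0..s1} \<times> (UNIV :: real set)) snd" by (auto intro!: continuous_intros)
  have \<rho>: "C1_on ({0..s1} \<times> (UNIV :: real set)) {l..u} (\<lambda>z x. fst z * x)"
    by (intro C1_on_mult C1_on_id C1_on_param) (auto intro!: continuous_intros)
  have bd: "0 \<le> fst z * x \<and> fst z * x \<le> R" if "z \<in> {0..s1} \<times> (UNIV :: real set)" "x \<in> {l..u}" for z x
  proof -
    have "fst z * x \<le> s1 * u" using that l by (intro mult_mono) auto
    then show ?thesis using that l by auto
  qed
  note G = C1_G[OF t \<rho> bd]
  have "C1_on {0..s1} {l'..u'} (\<lambda>s x. I0 (s * x))" unfolding I0_def by (rule C1_on_integral[OF _ l(2,3)]) (use G(1) in simp)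
  moreover have "C1_on {0..s1} {l'..u'} (\<lambda>s x. I1 (s * x))" unfolding I1_def by (rule C1_on_integral[OF _ l(2,3)]) (use G(2) in simp)
  moreover have "C1_on {0..s1} {l'..u'} (\<lambda>s x. I2 (s * x))" unfolding I2_def by (rule C1_on_integral[OF _ l(2,3)]) (use G(3) in simp)
  ultimately have "C1_on {0..s1} {l'..u'} (\<lambda>s x. e * I0 (s * x) + d * x^2 * I1 (s * x) + c * x^4 * I2 (s * x))"
    by (intro C1_on_add C1_on_mult C1_on_const C1_on_power C1_on_id)
  moreover have "L e d c = (\<lambda>s x. e * I0 (s * x) + d * x^2 * I1 (s * x) + c * x^4 * I2 (s * x))"
    by (simp add: L_def fun_eq_iff)
  ultimately show ?thesis by simp
qed

text \<open>The coefficients are chosen such that \<open>L e d c 0 x\<close> is a multiple of \<open>(x\<^sup>2 - 1) (x\<^sup>2 - 4)\<close>.\<close>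

lemma two_simple_zeros:
  assumes c: "c \<noteq> 0"
  obtains e d s0 where "s0 > 0" "\<And>s. 0 < s \<Longrightarrow> s < s0 \<Longrightarrow>
      (\<exists>x D. \<bar>x - 1\<bar> < 1/4 \<and> L e d c s x = 0 \<and> (L e d c s has_real_derivative D) (at x) \<and> D \<noteq> 0) \<and>
      (\<exists>x D. \<bar>x - 2\<bar> < 1/4 \<and> L e d c s x = 0 \<and> (L e d c s has_real_derivative D) (at x) \<and> D \<noteq> 0)"
proof -
  define k where "k = c * I2 0"
  have k: "k \<noteq> 0" using c I2_neg by (simp add: k_def)
  \<comment> \<open>These make the three terms at \<open>s = 0\<close> equal to
    \<open>4 * k\<close>, \<open>- 5 * k * x^2\<close> and \<open>k * x^4\<close>.\<close>
  define e d where "e = 4 * k / I0 0" and "d = - 5 * k / I1 0"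
  have L0: "L e d c 0 x = k * (4 - 5 * x^2 + x^4)" for x
    using I0_pos I1_pos by (simp add: L_def e_def d_def k_def algebra_simps)
  have dL0: "(L e d c 0 has_real_derivative k * (- 10 * x + 4 * x^3)) (at x)" for x
    unfolding L0[abs_def] by (auto intro!: derivative_eq_intros)
  have persist: "\<exists>s0>0. \<forall>s. 0 \<le> s \<and> s < s0 \<longrightarrow>
      (\<exists>x D. \<bar>x - x0\<bar> < 1/4 \<and> L e d c s x = 0 \<and> (L e d c s has_real_derivative D) (at x) \<and> D \<noteq> 0)"
    if x0: "x0 \<in> {1..2}" "L e d c 0 x0 = 0" "k * (- 10 * x0 + 4 * x0^3) \<noteq> 0" for x0
  proof -
    \<comment> \<open>With \<open>s \<le> R/4\<close> and \<open>x\<close> at most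
      \<open>5/2\<close>, the radius \<open>s * x\<close> stays within the chart.\<close>
    have "R/4 * (x0 + 1/2) \<le> R/4 * 4" using x0(1) R(1) by (intro mult_left_mono) auto
    then have "C1_on {0..R/4} {x0 - 1/4..x0 + 1/4} (L e d c)"
      using x0(1) by (intro C1_L[of "x0 - 1/2" _ _ "x0 + 1/2"]) auto
    then obtain L' where L': "C1_deriv {0..R/4} {x0 - 1/4..x0 + 1/4} (L e d c) L'" by (auto simp: C1_on_def)
    have "(L e d c 0 has_real_derivative L' 0 x0) (at x0)" using L' R(1) by (auto simp: C1_deriv_def)
    then have "L' 0 x0 = k * (- 10 * x0 + 4 * x0^3)" by (rule DERIV_unique[OF _ dL0])
    then show ?thesis
      using C1_simple_zero_persists[OF L' _ _ x0(2)] x0(3) R(1) by (metis divide_pos_pos zero_less_numeral zero_less_one)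
  qed
  obtain s1 where s1: "s1 > 0" "\<And>s. 0 \<le> s \<Longrightarrow> s < s1 \<Longrightarrow>
      \<exists>x D. \<bar>x - 1\<bar> < 1/4 \<and> L e d c s x = 0 \<and> (L e d c s has_real_derivative D) (at x) \<and> D \<noteq> 0"
    using persist[of 1] k by (auto simp: L0)
  obtain s2 where s2: "s2 > 0" "\<And>s. 0 \<le> s \<Longrightarrow> s < s2 \<Longrightarrow>
      \<exists>x D. \<bar>x - 2\<bar> < 1/4 \<and> L e d c s x = 0 \<and> (L e d c s has_real_derivative D) (at x) \<and> D \<noteq> 0"
    using persist[of 2] k by (auto simp: L0)
  show ?thesis
    by (rule that[of "min s1 s2" e d]) (use s1 s2 in auto)
qed

end

context perturbed_chart
begin

text \<open>The exact form from \<open>potential_exists\<close> integrates to zero over a closed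
  level curve, which replaces \<open>q du - p dv\<close> by \<open>q0 du\<close>. In the expansion
  \<open>q0_chart\<close> the \<open>A\<close> term and the leading \<open>c\<close> term have zero
  mean.\<close>

lemma melnikov_mean:
  assumes div: "\<And>u v. deriv (\<lambda>u'. poly3 pc u' v) u + deriv (\<lambda>v'. poly3 qc u v') v
      = e + A * u * (1 + v) + c * (2 * v + v^2) + (d + 2*a*c) * u^2"
    and r: "0 \<le> r" "r \<le> R"
  shows "((\<lambda>\<theta>. flux \<theta> r) has_integral r^3 * (e * I0 r + d * r^2 * I1 r + c * r^4 * I2 r)) {0..2*pi}"
proof -
  obtain K where K: "\<And>x y x' y' t. (x has_real_derivative x') (at t) \<Longrightarrow> (y has_real_derivative y') (at t) \<Longrightarrow>
     ((\<lambda>t. K (x t) (y t)) has_real_derivative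
        (q0 e A c (d + 2*a*c) (x t) (y t) - poly3 qc (x t) (y t)) * x' + poly3 pc (x t) (y t) * y') (at t)"
    by (rule potential_exists[OF div]) blast
  have "((\<lambda>\<theta>. (q0 e A c (d + 2*a*c) (U \<theta> r) (V \<theta> r) - poly3 qc (U \<theta> r) (V \<theta> r)) * U1 \<theta> r + poly3 pc (U \<theta> r) (V \<theta> r) * V1 \<theta> r) has_integral 0) {0..2*pi}"
    using chart_periodic(7,8)[of 0 r] by (intro has_integral_periodic_derivative[OF K] DERIV_UV r) simp
  moreover have "((\<lambda>\<theta>. r^3 * (e * G0 \<theta> r + A * r * ((sin \<theta> / b) * \<mu> \<theta> * (cos \<theta> / b)) + c * r^2 * (((Y \<theta>)^2 - a^2 * (sin \<theta> / b)^4) * (cos \<theta> / b))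
      + d * r^2 * G1 \<theta> r + c * r^4 * G2 \<theta> r)) has_integral
      r^3 * (e * I0 r + A * r * 0 + c * r^2 * 0 + d * r^2 * I1 r + c * r^4 * I2 r)) {0..2*pi}"
    unfolding I0_def I1_def I2_def
    by (intro has_integral_mult_right has_integral_add zero_means has_integral_continuous continuous_G r)
  ultimately have "((\<lambda>\<theta>. r^3 * (e * G0 \<theta> r + A * r * ((sin \<theta> / b) * \<mu> \<theta> * (cos \<theta> / b)) + c * r^2 * (((Y \<theta>)^2 - a^2 * (sin \<theta> / b)^4) * (cos \<theta> / b))
      + d * r^2 * G1 \<theta> r + c * r^4 * G2 \<theta> r)
      - ((q0 e A c (d + 2*a*c) (U \<theta> r) (V \<theta> r) - poly3 qc (U \<theta> r) (V \<theta> r)) * U1 \<theta> r + poly3 pc (U \<theta> r) (V \<theta> r) * V1 \<theta> r)) has_integral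
      r^3 * (e * I0 r + A * r * 0 + c * r^2 * 0 + d * r^2 * I1 r + c * r^4 * I2 r) - 0) {0..2*pi}"
    by (rule has_integral_diff[rotated])
  then show ?thesis
    unfolding q0_chart[OF r, symmetric] by (simp add: flux_def algebra_simps)
qed

text \<open>With coefficients \<open>s^4 * e\<close> and \<open>s^2 * d\<close> the mean at radius
  \<open>r\<close> is \<open>s^4/4\<close> times \<open>L\<close> at \<open>r/s\<close>, so a simple
  zero \<open>x\<close> of \<open>L\<close> becomes a simple zero at \<open>s * x\<close>.\<close>

lemma limit_cycle_at_simple_zero:
  assumes div: "\<And>u v. deriv (\<lambda>u'. poly3 pc u' v) u + deriv (\<lambda>v'. poly3 qc u v') v
      = s^4 * e + A * u * (1 + v) + c * (2 * v + v^2) + (s^2 * d + 2*a*c) * u^2"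
    and s: "0 < s" and x: "0 < x" "s * x < R"
    and zero: "L e d c s x = 0" "(L e d c s has_real_derivative D') (at x)" "D' \<noteq> 0"
    and \<eta>: "\<eta> > 0"
  obtains \<epsilon>0 where "\<epsilon>0 > 0" "\<And>\<epsilon>. 0 < \<epsilon> \<Longrightarrow> \<epsilon> < \<epsilon>0 \<Longrightarrow> \<exists>\<Gamma>. \<Gamma> \<noteq> {} \<and> limit_cycle (pert_field \<epsilon>) \<Gamma> \<and>
    (\<forall>z\<in>\<Gamma>. \<exists>\<theta> r. \<bar>r - s * x\<bar> < \<eta> \<and> 0 < r \<and> r \<le> R \<and> z = (U \<theta> r, V \<theta> r))"
proof -
  have mean: "integral {0..2*pi} (\<lambda>\<theta>. flux \<theta> r / (4 * r^3)) = s^4/4 * L e d c s (r/s)" if r: "0 < r" "r \<le> R" for r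
  proof -
    have "((\<lambda>\<theta>. flux \<theta> r / (4 * r^3)) has_integral (r^3 * (s^4 * e * I0 r + s^2 * d * r^2 * I1 r + c * r^4 * I2 r)) / (4 * r^3)) {0..2*pi}"
      by (intro has_integral_divide melnikov_mean[OF div]) (use r in auto)
    then have "integral {0..2*pi} (\<lambda>\<theta>. flux \<theta> r / (4 * r^3)) = (r^3 * (s^4 * e * I0 r + s^2 * d * r^2 * I1 r + c * r^4 * I2 r)) / (4 * r^3)"
      by (rule integral_unique)
    also have "\<dots> = s^4/4 * L e d c s (r/s)"
      using r s by (simp add: L_def field_simps eval_nat_numeral)
    finally show ?thesis .
  qed
  have \<rho>: "0 < s * x" using s x by simp
  have "((\<lambda>r. s^4/4 * L e d c s (r/s)) has_real_derivative s^4/4 * (D' * (1/s))) (at (s * x))"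
  proof (intro DERIV_cmult DERIV_chain2[of "L e d c s"])
    show "(L e d c s has_real_derivative D') (at (s * x / s))" using zero(2) s by simp
    show "((\<lambda>r. r/s) has_real_derivative 1/s) (at (s * x))" by (intro DERIV_cdivide DERIV_ident)
  qed
  then have der: "((\<lambda>r. integral {0..2*pi} (\<lambda>\<theta>. flux \<theta> r / (4 * r^3))) has_real_derivative s^4/4 * (D' * (1/s))) (at (s * x))"
    by (rule has_field_derivative_transform_within_open[where S = "{0<..<R}"]) (use \<rho> x mean in auto)
  show ?thesis
    by (rule melnikov_cycle[OF \<rho> x(2) _ der _ \<eta>]) (use mean[OF \<rho>] x zero s that in auto)
qed

end

section \<open>Two limit cycles\<close>

context quartic_chart
begin

text \<open>\<open>U\<close> is linear in \<open>r\<close>, and rationalising \<open>S - 1\<close>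
  bounds \<open>V\<close> by a multiple of \<open>r^2\<close>, hence of \<open>r\<close>. This puts
  cycles of small radius into a given neighbourhood of the origin.\<close>

lemma chart_norm_le:
  assumes r: "0 \<le> r" "r \<le> R" "r \<le> 1"
  shows "norm (U \<theta> r, V \<theta> r) \<le> r * (1/b + 2 * (2 + \<bar>a\<bar>/b^2))"
proof -
  have "norm (U \<theta> r, V \<theta> r) \<le> \<bar>U \<theta> r\<bar> + \<bar>V \<theta> r\<bar>"
    unfolding norm_Pair using sqrt_sum_squares_le_sum_abs[of "U \<theta> r" "V \<theta> r"] by simp
  moreover have "\<bar>U \<theta> r\<bar> \<le> r * (1/b)"
    unfolding U_def abs_mult using r b abs_sin_le_one[of \<theta>] by (intro mult_mono) (auto simp: divide_right_mono)
  moreover have "\<bar>V \<theta> r\<bar> \<le> r * (2 * (2 + \<bar>a\<bar>/b^2))"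
  proof -
    have s: "S \<theta> r > 0" by (rule S_pos[OF r(1,2)])
    have "\<bar>V \<theta> r\<bar> * 1 \<le> \<bar>V \<theta> r\<bar> * (S \<theta> r + 1)" using s by (intro mult_left_mono) auto
    also have "\<dots> = \<bar>(S \<theta> r - 1) * (S \<theta> r + 1)\<bar>" using s by (simp add: abs_mult V_def)
    also have "\<dots> = 2 * (r^2 * \<bar>\<mu> \<theta>\<bar>)"
      using S_sq[OF r(1,2), of \<theta>] by (simp add: algebra_simps power2_eq_square abs_mult)
    also have "\<dots> \<le> 2 * (r * (2 + \<bar>a\<bar>/b^2))"
    proof -
      have "r^2 \<le> r" using r mult_left_mono[of r 1 r] by (simp add: power2_eq_square)
      then have "r^2 * \<bar>\<mu> \<theta>\<bar> \<le> r * (2 + \<bar>a\<bar>/b^2)" using mu_bound r by (intro mult_mono) auto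
      then show ?thesis by simp
    qed
    finally show ?thesis by (simp add: algebra_simps)
  qed
  ultimately show ?thesis by (simp add: distrib_left)
qed

end

lemma (in perturbed_chart) field_eq_pert_field:
  fixes p q :: "real \<times> real \<times> real \<Rightarrow> nat \<Rightarrow> nat \<Rightarrow> nat \<Rightarrow> real"
  assumes b4: "b ^ 4 = - 8 * (h20^2 + h40)" and a: "a = 4 * h20 - 2 * h11^2"
    and p: "\<And>u v. pert p (h11, h20, h40) \<delta> u v = poly3 pc u v" and q: "\<And>u v. pert q (h11, h20, h40) \<delta> u v = poly3 qc u v"
  shows "field p q (h11, h20, h40) \<delta> \<epsilon> = pert_field \<epsilon>"
proof
  fix z :: "real \<times> real"
  obtain u v where z: "z = (u, v)" by fastforce
  \<comment> \<open>The relations for \<open>a\<close> and \<open>b^4\<close> complete the square: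
    \<open>b^4 + a^2/2\<close> is the given coefficient of \<open>u^4\<close>.\<close>
  have H: "H2 (h11, h20, h40) u v = 1/2 * v^2 + a * (u^2 * v) + 1/2 * v^3 + (b^4 + a^2/2) * u^4 + a/2 * (u^2 * v^2) + 1/8 * v^4" for u v
    unfolding H2_def a b4 by (simp add: field_simps power2_eq_square eval_nat_numeral)
  have pw: "((\<lambda>x. x ^ n) has_real_derivative of_nat n * (1 * x ^ (n - Suc 0))) (at x)" for x :: real and n
    by (intro DERIV_power DERIV_ident)
  note rules = DERIV_add DERIV_cmult DERIV_cmult_right DERIV_const pw DERIV_ident
  have "deriv (\<lambda>v'. H2 (h11, h20, h40) u v') v = Hv u v"
    unfolding H
    by (rule DERIV_imp_deriv, rule DERIV_cong, (rule rules)+)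
       (simp add: Hv_def W_def distrib_left distrib_right power2_eq_square power3_eq_cube)
  moreover have "deriv (\<lambda>u'. H2 (h11, h20, h40) u' v) u = Hu u v"
    unfolding H
    by (rule DERIV_imp_deriv, rule DERIV_cong, (rule rules)+)
       (simp add: Hu_def W_def distrib_left distrib_right power2_eq_square power3_eq_cube)
  ultimately show "field p q (h11, h20, h40) \<delta> \<epsilon> z = pert_field \<epsilon> z"
    by (simp add: z field_def pert_field_def p q)
qed

lemma pert_eq_poly3:
  "pert P \<sigma> (c00, c02, c11, c20) u v =
    poly3 (\<lambda>i j. c00 * P \<sigma> 0 i j + c02 * P \<sigma> 1 i j + c11 * P \<sigma> 2 i j + c20 * P \<sigma> 3 i j) u v"
  by (simp add: pert_def poly3_def sum.distrib sum_distrib_left distrib_right mult.assoc)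

theorem theorem10:
  fixes P Q :: "real \<times> real \<times> real \<Rightarrow> nat \<Rightarrow> nat \<Rightarrow> nat \<Rightarrow> real"
    and h11s h20s h40s c00s c02s c11s c20s :: real
  assumes div: "\<And>h11 h20 h40 c00 c02 c11 c20 u v. h20^2 + h40 < 0 \<Longrightarrow>
      deriv (\<lambda>u'. pert P (h11, h20, h40) (c00, c02, c11, c20) u' v) u
    + deriv (\<lambda>v'. pert Q (h11, h20, h40) (c00, c02, c11, c20) u v') v
    = (c00 + c02) + (-2*c11 + 4*h11*c02) * u + 2*c02 * v
      + (4*c20 - 4*h11*c11 + 4*h11^2*c02) * u^2 + (-2*c11 + 4*h11*c02) * u * v + c02 * v^2"
    and s0: "h20s^2 + h40s < 0"
    and d1: "c00s = - c02s"
    and d2: "c02s \<noteq> 0"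
    and d3: "c20s = h11s * c11s - 2 * c02s * (h11s^2 - h20s)"
  shows "\<forall>V \<eta>. open V \<and> (0, 0) \<in> V \<and> \<eta> > 0 \<longrightarrow>
     (\<exists>\<epsilon> \<delta> \<sigma>. 0 < \<bar>\<epsilon>\<bar> \<and> \<bar>\<epsilon>\<bar> < \<eta>
        \<and> dist \<delta> (c00s, c02s, c11s, c20s) < \<eta> \<and> dist \<sigma> (h11s, h20s, h40s) < \<eta>
        \<and> (\<exists>\<Gamma>1 \<Gamma>2. \<Gamma>1 \<noteq> \<Gamma>2
             \<and> limit_cycle (field P Q \<sigma> \<delta> \<epsilon>) \<Gamma>1 \<and> \<Gamma>1 \<subseteq> V
             \<and> limit_cycle (field P Q \<sigma> \<delta> \<epsilon>) \<Gamma>2 \<and> \<Gamma>2 \<subseteq> V))"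
proof (intro allI impI, elim conjE)
  fix N :: "(real \<times> real) set" and \<eta> :: real
  assume N: "open N" "(0, 0) \<in> N" and \<eta>: "\<eta> > 0"
  define a where "a = 4 * h20s - 2 * h11s^2"
  define b where "b = sqrt (sqrt (- 8 * (h20s^2 + h40s)))"
  have b: "b > 0" using s0 by (simp add: b_def)
  have b4: "b ^ 4 = - 8 * (h20s^2 + h40s)"
  proof -
    have "b ^ 4 = (b^2)^2" by simp
    then show ?thesis using s0 by (simp add: b_def)
  qed
  define M where "M = 2 + \<bar>a\<bar> / b^2"
  have M: "M \<ge> 2" using b by (simp add: M_def)
  \<comment> \<open>Then \<open>4 * R^2 * M = 1/M\<close>, which is at most \<open>1\<close> because
    \<open>M \<ge> 2\<close>.\<close>
  define R where "R = 1 / (2 * M)"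
  have R: "R > 0" "4 * R^2 * M \<le> 1" using M by (simp_all add: R_def field_simps power2_eq_square)
  interpret quartic_chart a b R using b R by unfold_locales (simp_all add: M_def)
  obtain e d s0' where s0': "s0' > 0" and zeros: "\<And>s. 0 < s \<Longrightarrow> s < s0' \<Longrightarrow>
      (\<exists>x D. \<bar>x - 1\<bar> < 1/4 \<and> L e d c02s s x = 0 \<and> (L e d c02s s has_real_derivative D) (at x) \<and> D \<noteq> 0) \<and>
      (\<exists>x D. \<bar>x - 2\<bar> < 1/4 \<and> L e d c02s s x = 0 \<and> (L e d c02s s has_real_derivative D) (at x) \<and> D \<noteq> 0)"
    by (rule two_simple_zeros[OF d2]) blast
  obtain \<rho> where \<rho>: "\<rho> > 0" "ball (0, 0) \<rho> \<subseteq> N" using N open_contains_ball by blast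
  define C where "C = 1/b + 2 * M"
  have C: "C > 0" using b M by (simp add: C_def add_pos_pos)
  \<comment> \<open>In this order: the zeros of \<open>L\<close> exist, radii below
    \<open>3 * s\<close> lie in the chart, they are below \<open>1\<close>, they lie in the
    neighbourhood, and the two changes of \<open>\<delta>\<close> are each below
    \<open>\<eta>/2\<close>.\<close>
  define m where "m = Min {s0', R / 3, 1 / 3, \<rho> / (3 * C), \<eta> / (2 * (\<bar>e\<bar> + 1)), \<eta> / (\<bar>d\<bar> + 1)}"
  have m: "m > 0" using s0' R \<rho> C \<eta> by (simp add: m_def add_pos_nonneg add_nonneg_pos)
  have le_m: "m \<le> s0'" "m \<le> R / 3" "m \<le> 1 / 3" "m \<le> \<rho> / (3 * C)" "m \<le> \<eta> / (2 * (\<bar>e\<bar> + 1))" "m \<le> \<eta> / (\<bar>d\<bar> + 1)"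
    unfolding m_def by (rule Min_le; simp)+
  define s where "s = m / 2"
  have s: "0 < s" "s < m" using m by (simp_all add: s_def)
  note sm = less_le_trans[OF s(2)]
  have sb: "s < s0'" "3 * s < R" "3 * s < 1" "s < \<rho> / (3 * C)" "s < \<eta> / (2 * (\<bar>e\<bar> + 1))" "s < \<eta> / (\<bar>d\<bar> + 1)"
    using sm[OF le_m(1)] sm[OF le_m(2)] sm[OF le_m(3)] sm[OF le_m(4)] sm[OF le_m(5)] sm[OF le_m(6)] by simp_all
  have small_\<rho>: "3 * s * C < \<rho>" using sb(4) C by (simp add: pos_less_divide_eq mult_ac)
  have small_e: "\<bar>s^4 * e\<bar> < \<eta>/2"
  proof -
    have "s ^ 4 \<le> s ^ 1" using s sb by (intro power_decreasing) auto
    then have "\<bar>s^4 * e\<bar> \<le> s * (\<bar>e\<bar> + 1)" unfolding abs_mult using s by (intro mult_mono) auto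
    also have "\<dots> < \<eta>/2" using sb(5) by (simp add: pos_less_divide_eq mult_ac)
    finally show ?thesis .
  qed
  have small_d: "\<bar>s^2 * d / 4\<bar> < \<eta>/2"
  proof -
    have "s ^ 2 \<le> s ^ 1" using s sb by (intro power_decreasing) auto
    then have "\<bar>s^2 * d\<bar> \<le> s * (\<bar>d\<bar> + 1)" unfolding abs_mult using s by (intro mult_mono) auto
    also have "\<dots> < \<eta>" using sb(6) by (simp add: pos_less_divide_eq mult_ac)
    finally show ?thesis by simp
  qed
  \<comment> \<open>Only these two coordinates leave the starting point. Since \<open>c20\<close>
    enters the divergence with factor \<open>4\<close>, the shifts produce exactly the coefficients
    \<open>s^4 * e\<close> and \<open>s^2 * d\<close>.\<close>
  define c00 c20 where "c00 = s^4 * e - c02s" and "c20 = c20s + s^2 * d / 4"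
  define \<sigma> where "\<sigma> = (h11s, h20s, h40s)"
  define \<delta> where "\<delta> = (c00, c02s, c11s, c20)"
  define pc where "pc i j = c00 * P \<sigma> 0 i j + c02s * P \<sigma> 1 i j + c11s * P \<sigma> 2 i j + c20 * P \<sigma> 3 i j" for i j
  define qc where "qc i j = c00 * Q \<sigma> 0 i j + c02s * Q \<sigma> 1 i j + c11s * Q \<sigma> 2 i j + c20 * Q \<sigma> 3 i j" for i j
  have pert: "pert P \<sigma> \<delta> u v = poly3 pc u v" "pert Q \<sigma> \<delta> u v = poly3 qc u v" for u v
    unfolding \<delta>_def pert_eq_poly3 pc_def[abs_def] qc_def[abs_def] by simp_all
  interpret perturbed_chart a b R pc qc by unfold_locales
  have field: "field P Q \<sigma> \<delta> \<epsilon> = pert_field \<epsilon>" for \<epsilon>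
    unfolding \<sigma>_def by (rule field_eq_pert_field[OF b4 a_def]) (use pert in \<open>simp_all add: \<sigma>_def\<close>)
  have dv: "deriv (\<lambda>u'. poly3 pc u' v) u + deriv (\<lambda>v'. poly3 qc u v') v
      = s^4 * e + (- 2 * c11s + 4 * h11s * c02s) * u * (1 + v) + c02s * (2 * v + v^2) + (s^2 * d + 2*a*c02s) * u^2" for u v
    using div[OF s0, of h11s c00 c02s c11s c20 v u] unfolding pert[unfolded \<sigma>_def \<delta>_def]
    by (simp add: c00_def c20_def d3 a_def algebra_simps power2_eq_square)
  from zeros[OF s(1) sb(1)] obtain x1 D1 x2 D2
    where x1: "\<bar>x1 - 1\<bar> < 1/4" "L e d c02s s x1 = 0" "(L e d c02s s has_real_derivative D1) (at x1)" "D1 \<noteq> 0"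
      and x2: "\<bar>x2 - 2\<bar> < 1/4" "L e d c02s s x2 = 0" "(L e d c02s s has_real_derivative D2) (at x2)" "D2 \<noteq> 0"
    by blast
  have bounds: "0 < x1" "0 < x2" "s * x1 < s * (5/4)" "s * (7/4) < s * x2" "s * x2 < s * (9/4)"
  proof -
    have x: "0 < x1" "x1 < 5/4" "7/4 < x2" "x2 < 9/4" using x1(1) x2(1) by linarith+
    show "0 < x1" "0 < x2" "s * x1 < s * (5/4)" "s * (7/4) < s * x2" "s * x2 < s * (9/4)"
      using x s(1) by (auto intro: mult_strict_left_mono)
  qed
  have R12: "s * x1 < R" "s * x2 < R" and s4: "s/4 > 0" using bounds sb(2) s(1) by linarith+
  obtain \<epsilon>1 where \<epsilon>1: "\<epsilon>1 > 0" "\<And>\<epsilon>. 0 < \<epsilon> \<Longrightarrow> \<epsilon> < \<epsilon>1 \<Longrightarrow> \<exists>\<Gamma>. \<Gamma> \<noteq> {} \<and> limit_cycle (pert_field \<epsilon>) \<Gamma> \<and>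
    (\<forall>z\<in>\<Gamma>. \<exists>\<theta> r. \<bar>r - s * x1\<bar> < s/4 \<and> 0 < r \<and> r \<le> R \<and> z = (U \<theta> r, V \<theta> r))"
    by (rule limit_cycle_at_simple_zero[OF dv s(1) bounds(1) R12(1) x1(2-4) s4]) blast
  obtain \<epsilon>2 where \<epsilon>2: "\<epsilon>2 > 0" "\<And>\<epsilon>. 0 < \<epsilon> \<Longrightarrow> \<epsilon> < \<epsilon>2 \<Longrightarrow> \<exists>\<Gamma>. \<Gamma> \<noteq> {} \<and> limit_cycle (pert_field \<epsilon>) \<Gamma> \<and>
    (\<forall>z\<in>\<Gamma>. \<exists>\<theta> r. \<bar>r - s * x2\<bar> < s/4 \<and> 0 < r \<and> r \<le> R \<and> z = (U \<theta> r, V \<theta> r))"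
    by (rule limit_cycle_at_simple_zero[OF dv s(1) bounds(2) R12(2) x2(2-4) s4]) blast
  \<comment> \<open>The thresholds depend on \<open>s\<close>, which is already fixed, so one
    \<open>\<epsilon>\<close> serves both cycles.\<close>
  define \<epsilon> where "\<epsilon> = min (min \<epsilon>1 \<epsilon>2) \<eta> / 2"
  have \<epsilon>: "0 < \<epsilon>" "\<epsilon> < \<epsilon>1" "\<epsilon> < \<epsilon>2" "\<epsilon> < \<eta>" using \<epsilon>1(1) \<epsilon>2(1) \<eta> unfolding \<epsilon>_def by linarith+
  obtain \<Gamma>1 where \<Gamma>1: "\<Gamma>1 \<noteq> {}" "limit_cycle (pert_field \<epsilon>) \<Gamma>1"
    "\<And>z. z \<in> \<Gamma>1 \<Longrightarrow> \<exists>\<theta> r. \<bar>r - s * x1\<bar> < s/4 \<and> 0 < r \<and> r \<le> R \<and> z = (U \<theta> r, V \<theta> r)"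
    using \<epsilon>1(2)[OF \<epsilon>(1,2)] by blast
  obtain \<Gamma>2 where \<Gamma>2: "\<Gamma>2 \<noteq> {}" "limit_cycle (pert_field \<epsilon>) \<Gamma>2"
    "\<And>z. z \<in> \<Gamma>2 \<Longrightarrow> \<exists>\<theta> r. \<bar>r - s * x2\<bar> < s/4 \<and> 0 < r \<and> r \<le> R \<and> z = (U \<theta> r, V \<theta> r)"
    using \<epsilon>2(2)[OF \<epsilon>(1,3)] by blast
  have near: "(U \<theta> r, V \<theta> r) \<in> N" if "0 < r" "r < 3 * s" for \<theta> r
  proof -
    have "norm (U \<theta> r, V \<theta> r) \<le> r * C"
      unfolding C_def M_def by (rule chart_norm_le) (use that sb in auto)
    also have "\<dots> < 3 * s * C" using that C by simp
    also note small_\<rho>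
    finally have "(U \<theta> r, V \<theta> r) \<in> ball (0, 0) \<rho>" by (simp add: dist_norm norm_Pair)
    then show ?thesis using \<rho>(2) by blast
  qed
  \<comment> \<open>The radii lie on different sides of \<open>s * (3/2)\<close>. A common point
    would have two different energies \<open>r^4\<close>, so the cycles are distinct.\<close>
  have w1: "r < 3 * s \<and> r < s * (3/2)" if "\<bar>r - s * x1\<bar> < s/4" for r
    using that bounds s(1) by linarith
  have w2: "r < 3 * s \<and> s * (3/2) < r" if "\<bar>r - s * x2\<bar> < s/4" for r
    using that bounds s(1) by linarith
  have sub: "\<Gamma>1 \<subseteq> N" "\<Gamma>2 \<subseteq> N" using \<Gamma>1(3) \<Gamma>2(3) near w1 w2 by fast+
  have ne: "\<Gamma>1 \<noteq> \<Gamma>2"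
  proof
    assume eq: "\<Gamma>1 = \<Gamma>2"
    obtain z where z: "z \<in> \<Gamma>1" using \<Gamma>1(1) by blast
    obtain \<theta> r where r: "\<bar>r - s * x1\<bar> < s/4" "0 < r" "r \<le> R" "z = (U \<theta> r, V \<theta> r)" using \<Gamma>1(3)[OF z] by blast
    obtain \<theta>' r' where r': "\<bar>r' - s * x2\<bar> < s/4" "0 < r'" "r' \<le> R" "z = (U \<theta>' r', V \<theta>' r')" using \<Gamma>2(3) z eq by blast
    have "r ^ 4 = r' ^ 4" using H_chart[of r \<theta>] H_chart[of r' \<theta>'] r r' by simp
    then have "r = r'" using power_eq_imp_eq_base[of r 4 r'] r(2) r'(2) by simp
    then show False using w1[OF r(1)] w2[OF r'(1)] by simp
  qed
  have "dist \<delta> (c00s, c02s, c11s, c20s) < \<eta>"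
  proof -
    have "dist \<delta> (c00s, c02s, c11s, c20s) = sqrt ((s^4 * e)^2 + (s^2 * d / 4)^2)"
      by (simp add: \<delta>_def c00_def c20_def d1 dist_Pair_Pair dist_real_def power_divide)
    also have "\<dots> \<le> \<bar>s^4 * e\<bar> + \<bar>s^2 * d / 4\<bar>" by (rule sqrt_sum_squares_le_sum_abs)
    also have "\<dots> < \<eta>" using small_e small_d by linarith
    finally show ?thesis .
  qed
  moreover have "dist \<sigma> (h11s, h20s, h40s) < \<eta>" using \<eta> by (simp add: \<sigma>_def)
  moreover have "0 < \<bar>\<epsilon>\<bar>" "\<bar>\<epsilon>\<bar> < \<eta>" using \<epsilon> by auto
  ultimately show "\<exists>\<epsilon> \<delta> \<sigma>. 0 < \<bar>\<epsilon>\<bar> \<and> \<bar>\<epsilon>\<bar> < \<eta>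
        \<and> dist \<delta> (c00s, c02s, c11s, c20s) < \<eta> \<and> dist \<sigma> (h11s, h20s, h40s) < \<eta>
        \<and> (\<exists>\<Gamma>1 \<Gamma>2. \<Gamma>1 \<noteq> \<Gamma>2
             \<and> limit_cycle (field P Q \<sigma> \<delta> \<epsilon>) \<Gamma>1 \<and> \<Gamma>1 \<subseteq> N
             \<and> limit_cycle (field P Q \<sigma> \<delta> \<epsilon>) \<Gamma>2 \<and> \<Gamma>2 \<subseteq> N)"
    using \<Gamma>1(2) \<Gamma>2(2) sub ne unfolding field[symmetric] by blast
qed

end
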